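(* Let $K$ be a commutative ring, $A,B$ two $K$-algebras and $M,N$ two $A\otimes B^o$-modules. Then $N\in\delta[M]$ if and only if, for all $\alpha\in\mathrm{Der}(A)$ and $\beta\in\mathrm{Der}(B)$: if there exists $\mu\in\mathrm{End}_K(M)$ with $$\mu(am)=\alpha(a)m+a\mu(m)\quad\text{and}\quad\mu(mb)=\mu(m)b+m\beta(b)\qquad(a\in A,\ b\in B,\ m\in M),$$ then there exists $\nu\in\mathrm{End}_K(N)$ with $$\nu(an)=\alpha(a)n+a\nu(n)\quad\text{and}\quad\nu(nb)=\nu(n)b+n\beta(b)\qquad(a\in A,\ b\in B,\ n\in N).$$ In that case there is an exact sequence $$0\to Z\begin{pmatrix}A&M\oplus N\\0&B\end{pmatrix}\xrightarrow{r^0_{M,N}}Z\begin{pmatrix}A&M\\0&B\end{pmatrix}\to\mathrm{Hom}_{A\otimes B^o}(M,N)\times\mathrm{End}_{A\otimes B^o}N\times\mathrm{Hom}_{A\otimes B^o}(N,M)\to HH^1\begin{pmatrix}A&M\oplus N\\0&B\end{pmatrix}\xrightarrow{r^1_{M,N}}HH^1\begin{pmatrix}A&M\\0&B\end{pmatrix}\to 0,$$ from which one deduces the exact sequence $$0\to Z\begin{pmatrix}A&M\oplus N\\0&B\end{pmatrix}\xrightarrow{r^0_{M,N}}Z\begin{pmatrix}A&M\\0&B\end{pmatrix}\to\mathrm{End}_{A\otimes B^o}N\to\mathcal H^1\{M,N\}\xrightarrow{\rho^1_{M,\{M,N\}}}HH^1\begin{pmatrix}A&M\\0&B\end{pmatrix}\to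 0.$$
   Context: $K$ is a commutative ring, $\otimes=\otimes_K$; algebras are associative unital $K$-algebras, modules are unital left modules, $B^o$ is the opposite algebra. No projectivity over $K$ is assumed. For an $A\otimes B^o$-module $M$, $\begin{pmatrix}A&M\\0&B\end{pmatrix}$ is the triangular matrix algebra with product $\begin{pmatrix}a&m\\0&b\end{pmatrix}\begin{pmatrix}a'&m'\\0&b'\end{pmatrix}=\begin{pmatrix}aa'&am'+mb'\\0&bb'\end{pmatrix}$. $Z(T)$, written $ZT$, is the center of $T$; central elements of a triangular matrix algebra are diagonal, and $r^0_{M,N}$ sends $\begin{pmatrix}a&0\\0&b\end{pmatrix}$ to $\begin{pmatrix}a&0\\0&b\end{pmatrix}$. For an algebra $T$, $\mathrm{Der}(T)$ is the Lie algebra of $K$-linear derivations of $T$, $\mathrm{Int}(T)$ the Lie ideal of inner derivations $t\mapsto t_0t-tt_0$, and $HH^1T=\mathrm{Der}(T)/\mathrm{Int}(T)$. Every derivation of $\begin{pmatrix}A&M\\0&B\end{pmatrix}$ has the form $\begin{pmatrix}a&m\\0&b\end{pmatrix}\mapsto\begin{pmatrix}\alpha(a)&\mu(m)-am_0+m_0b\\0&\beta(b)\end{pmatrix}$ with $\alpha\in\mathrm{Der}(A)$, $\beta\in\mathrm{Der}(B)$, $m_0\in M$, $\mu\in\mathrm{End}_K(M)$ satisfying $\mu(am)=\alpha(a)m+a\mu(m)$ and $\mu(mb)=\mu(m)b+m\beta(b)$. The derivations with $\alpha=0,\beta=0,\mu=0$ are inner, so every class in $HH^1$ is represented by a derivation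 with $m_0=0$, written $\begin{bmatrix}\alpha&\mu\\0&\beta\end{bmatrix}$. If $\begin{bmatrix}\alpha&\gamma\\0&\beta\end{bmatrix}$ is such a derivation of $\begin{pmatrix}A&M\oplus N\\0&B\end{pmatrix}$ and $\mu$ is the component $M\to M$ of $\gamma\in\mathrm{End}_K(M\oplus N)$, then $\begin{bmatrix}\alpha&\mu\\0&\beta\end{bmatrix}$ is a derivation of $\begin{pmatrix}A&M\\0&B\end{pmatrix}$; this induces $r^1_{M,N}:HH^1\begin{pmatrix}A&M\oplus N\\0&B\end{pmatrix}\to HH^1\begin{pmatrix}A&M\\0&B\end{pmatrix}$. $\mathcal H^1\{M,N\}\subset HH^1\begin{pmatrix}A&M\oplus N\\0&B\end{pmatrix}$ is the Lie subalgebra of classes of derivations $\begin{bmatrix}\alpha&\gamma\\0&\beta\end{bmatrix}$ whose $\gamma$ has zero components $M\to N$ and $N\to M$, and $\rho^1_{M,\{M,N\}}$ is the restriction of $r^1_{M,N}$ to it. $\delta[M]$ is the full subcategory of the $A\otimes B^o$-modules $N$ for which $r^1_{M,N}$ is surjective (equivalently, for which $\rho^1_{M,\{M,N\}}$ is surjective). *)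

theory Defs
  imports "HOL-Algebra.QuotRing" "HOL-Algebra.Module"
begin

text \<open>
  Associative unital algebras over a commutative ring. The library locale \<open>algebra\<close> is not used
  because it requires the algebra to be commutative. The zero algebra is allowed.
\<close>

locale assoc_algebra = module K A + ring A
  for K :: "'k ring" and A :: "('k, 'a) module" +
  assumes smult_mult_left:
      "\<lbrakk>k \<in> carrier K; x \<in> carrier A; y \<in> carrier A\<rbrakk>
        \<Longrightarrow> (k \<odot>\<^bsub>A\<^esub> x) \<otimes>\<^bsub>A\<^esub> y = k \<odot>\<^bsub>A\<^esub> (x \<otimes>\<^bsub>A\<^esub> y)"
    and smult_mult_right:
      "\<lbrakk>k \<in> carrier K; x \<in> carrier A; y \<in> carrier A\<rbrakk>
        \<Longrightarrow> x \<otimes>\<^bsub>A\<^esub> (k \<odot>\<^bsub>A\<^esub> y) = k \<odot>\<^bsub>A\<^esub> (x \<otimes>\<^bsub>A\<^esub> y)"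

text \<open>
  Left modules over \<open>A \<otimes>\<^sub>K B\<^sup>o\<close>: the element \<open>a \<otimes> b\<close> acts by \<open>m \<mapsto> a m b\<close>. Equivalently, the
  two actions commute and both restrict to the same action of \<open>K\<close>. The fields \<open>mult\<close> and \<open>one\<close>
  inherited from the record \<open>module\<close> carry no meaning here.
\<close>

record ('k, 'a, 'b, 'm) bimodule = "('k, 'm) module" +
  lact :: "'a \<Rightarrow> 'm \<Rightarrow> 'm"  (infixl \<open>\<triangleright>\<index>\<close> 70)
  ract :: "'m \<Rightarrow> 'b \<Rightarrow> 'm"  (infixl \<open>\<triangleleft>\<index>\<close> 70)

locale bimodule = A: assoc_algebra K A + B: assoc_algebra K B + module K M
  for K :: "'k ring" and A :: "('k, 'a) module" and B :: "('k, 'b) module"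
    and M :: "('k, 'a, 'b, 'm) bimodule" +
  assumes lact_closed:
      "\<lbrakk>a \<in> carrier A; m \<in> carrier M\<rbrakk> \<Longrightarrow> a \<triangleright>\<^bsub>M\<^esub> m \<in> carrier M"
    and lact_add:
      "\<lbrakk>a \<in> carrier A; m \<in> carrier M; m' \<in> carrier M\<rbrakk>
        \<Longrightarrow> a \<triangleright>\<^bsub>M\<^esub> (m \<oplus>\<^bsub>M\<^esub> m') = a \<triangleright>\<^bsub>M\<^esub> m \<oplus>\<^bsub>M\<^esub> a \<triangleright>\<^bsub>M\<^esub> m'"
    and add_lact:
      "\<lbrakk>a \<in> carrier A; a' \<in> carrier A; m \<in> carrier M\<rbrakk>
        \<Longrightarrow> (a \<oplus>\<^bsub>A\<^esub> a') \<triangleright>\<^bsub>M\<^esub> m = a \<triangleright>\<^bsub>M\<^esub> m \<oplus>\<^bsub>M\<^esub> a' \<triangleright>\<^bsub>M\<^esub> m"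
    and mult_lact:
      "\<lbrakk>a \<in> carrier A; a' \<in> carrier A; m \<in> carrier M\<rbrakk>
        \<Longrightarrow> (a \<otimes>\<^bsub>A\<^esub> a') \<triangleright>\<^bsub>M\<^esub> m = a \<triangleright>\<^bsub>M\<^esub> (a' \<triangleright>\<^bsub>M\<^esub> m)"
    and one_lact:
      "m \<in> carrier M \<Longrightarrow> \<one>\<^bsub>A\<^esub> \<triangleright>\<^bsub>M\<^esub> m = m"
    and smult_lact:
      "\<lbrakk>k \<in> carrier K; a \<in> carrier A; m \<in> carrier M\<rbrakk>
        \<Longrightarrow> (k \<odot>\<^bsub>A\<^esub> a) \<triangleright>\<^bsub>M\<^esub> m = k \<odot>\<^bsub>M\<^esub> (a \<triangleright>\<^bsub>M\<^esub> m)"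
    and ract_closed:
      "\<lbrakk>b \<in> carrier B; m \<in> carrier M\<rbrakk> \<Longrightarrow> m \<triangleleft>\<^bsub>M\<^esub> b \<in> carrier M"
    and add_ract:
      "\<lbrakk>b \<in> carrier B; m \<in> carrier M; m' \<in> carrier M\<rbrakk>
        \<Longrightarrow> (m \<oplus>\<^bsub>M\<^esub> m') \<triangleleft>\<^bsub>M\<^esub> b = m \<triangleleft>\<^bsub>M\<^esub> b \<oplus>\<^bsub>M\<^esub> m' \<triangleleft>\<^bsub>M\<^esub> b"
    and ract_add:
      "\<lbrakk>b \<in> carrier B; b' \<in> carrier B; m \<in> carrier M\<rbrakk>
        \<Longrightarrow> m \<triangleleft>\<^bsub>M\<^esub> (b \<oplus>\<^bsub>B\<^esub> b') = m \<triangleleft>\<^bsub>M\<^esub> b \<oplus>\<^bsub>M\<^esub> m \<triangleleft>\<^bsub>M\<^esub> b'"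
    and ract_mult:
      "\<lbrakk>b \<in> carrier B; b' \<in> carrier B; m \<in> carrier M\<rbrakk>
        \<Longrightarrow> m \<triangleleft>\<^bsub>M\<^esub> (b \<otimes>\<^bsub>B\<^esub> b') = (m \<triangleleft>\<^bsub>M\<^esub> b) \<triangleleft>\<^bsub>M\<^esub> b'"
    and ract_one:
      "m \<in> carrier M \<Longrightarrow> m \<triangleleft>\<^bsub>M\<^esub> \<one>\<^bsub>B\<^esub> = m"
    and ract_smult:
      "\<lbrakk>k \<in> carrier K; b \<in> carrier B; m \<in> carrier M\<rbrakk>
        \<Longrightarrow> m \<triangleleft>\<^bsub>M\<^esub> (k \<odot>\<^bsub>B\<^esub> b) = k \<odot>\<^bsub>M\<^esub> (m \<triangleleft>\<^bsub>M\<^esub> b)"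
    and lact_ract:
      "\<lbrakk>a \<in> carrier A; b \<in> carrier B; m \<in> carrier M\<rbrakk>
        \<Longrightarrow> (a \<triangleright>\<^bsub>M\<^esub> m) \<triangleleft>\<^bsub>M\<^esub> b = a \<triangleright>\<^bsub>M\<^esub> (m \<triangleleft>\<^bsub>M\<^esub> b)"

definition mod_hom ::
    "'k ring \<Rightarrow> ('k, 'x, 'p) module_scheme \<Rightarrow> ('k, 'y, 'q) module_scheme \<Rightarrow> ('x \<Rightarrow> 'y) set" where
  "mod_hom K X Y = {f \<in> carrier X \<rightarrow> carrier Y.
     (\<forall>x\<in>carrier X. \<forall>y\<in>carrier X. f (x \<oplus>\<^bsub>X\<^esub> y) = f x \<oplus>\<^bsub>Y\<^esub> f y) \<and>
     (\<forall>k\<in>carrier K. \<forall>x\<in>carrier X. f (k \<odot>\<^bsub>X\<^esub> x) = k \<odot>\<^bsub>Y\<^esub> f x)}"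

definition prod_module :: "('k, 'x) module \<Rightarrow> ('k, 'y) module \<Rightarrow> ('k, 'x \<times> 'y) module" where
  "prod_module X Y = \<lparr>carrier = carrier X \<times> carrier Y, mult = undefined, one = undefined,
     zero = (\<zero>\<^bsub>X\<^esub>, \<zero>\<^bsub>Y\<^esub>),
     add = (\<lambda>(x, y) (x', y'). (x \<oplus>\<^bsub>X\<^esub> x', y \<oplus>\<^bsub>Y\<^esub> y')),
     smult = (\<lambda>k (x, y). (k \<odot>\<^bsub>X\<^esub> x, k \<odot>\<^bsub>Y\<^esub> y))\<rparr>"

definition bimod_sum ::
    "('k, 'a, 'b, 'm) bimodule \<Rightarrow> ('k, 'a, 'b, 'n) bimodule \<Rightarrow> ('k, 'a, 'b, 'm \<times> 'n) bimodule"
    (infixl \<open>\<oplus>\<^sub>b\<close> 65) where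
  "M \<oplus>\<^sub>b N = \<lparr>carrier = carrier M \<times> carrier N, mult = undefined, one = undefined,
     zero = (\<zero>\<^bsub>M\<^esub>, \<zero>\<^bsub>N\<^esub>),
     add = (\<lambda>(m, n) (m', n'). (m \<oplus>\<^bsub>M\<^esub> m', n \<oplus>\<^bsub>N\<^esub> n')),
     smult = (\<lambda>k (m, n). (k \<odot>\<^bsub>M\<^esub> m, k \<odot>\<^bsub>N\<^esub> n)),
     lact = (\<lambda>a (m, n). (a \<triangleright>\<^bsub>M\<^esub> m, a \<triangleright>\<^bsub>N\<^esub> n)),
     ract = (\<lambda>(m, n) b. (m \<triangleleft>\<^bsub>M\<^esub> b, n \<triangleleft>\<^bsub>N\<^esub> b))\<rparr>"

text \<open>
  Elements of \<open>Hom\<close> and, below, of \<open>Der\<close> are functions that are \<open>undefined\<close> outside the carrier, so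
  that equality of functions is equality on the carrier.
\<close>

definition bimod_hom ::
    "'k ring \<Rightarrow> ('k, 'a) module \<Rightarrow> ('k, 'b) module \<Rightarrow>
     ('k, 'a, 'b, 'm) bimodule \<Rightarrow> ('k, 'a, 'b, 'n) bimodule \<Rightarrow> ('k, 'm \<Rightarrow> 'n) module" where
  "bimod_hom K A B M N = \<lparr>carrier = {f \<in> mod_hom K M N \<inter> extensional (carrier M).
       (\<forall>a\<in>carrier A. \<forall>m\<in>carrier M. f (a \<triangleright>\<^bsub>M\<^esub> m) = a \<triangleright>\<^bsub>N\<^esub> f m) \<and>
       (\<forall>b\<in>carrier B. \<forall>m\<in>carrier M. f (m \<triangleleft>\<^bsub>M\<^esub> b) = f m \<triangleleft>\<^bsub>N\<^esub> b)},
     mult = undefined, one = undefined,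
     zero = (\<lambda>m\<in>carrier M. \<zero>\<^bsub>N\<^esub>),
     add = (\<lambda>f g. \<lambda>m\<in>carrier M. f m \<oplus>\<^bsub>N\<^esub> g m),
     smult = (\<lambda>k f. \<lambda>m\<in>carrier M. k \<odot>\<^bsub>N\<^esub> f m)\<rparr>"

text \<open>The triple \<open>(a, m, b)\<close> stands for the upper triangular matrix with diagonal \<open>a, b\<close>.\<close>

definition tri_alg ::
    "('k, 'a) module \<Rightarrow> ('k, 'a, 'b, 'm) bimodule \<Rightarrow> ('k, 'b) module \<Rightarrow>
     ('k, 'a \<times> 'm \<times> 'b) module" where
  "tri_alg A M B = \<lparr>carrier = carrier A \<times> carrier M \<times> carrier B,
     mult = (\<lambda>(a, m, b) (a', m', b').
       (a \<otimes>\<^bsub>A\<^esub> a', a \<triangleright>\<^bsub>M\<^esub> m' \<oplus>\<^bsub>M\<^esub> m \<triangleleft>\<^bsub>M\<^esub> b', b \<otimes>\<^bsub>B\<^esub> b')),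
     one = (\<one>\<^bsub>A\<^esub>, \<zero>\<^bsub>M\<^esub>, \<one>\<^bsub>B\<^esub>),
     zero = (\<zero>\<^bsub>A\<^esub>, \<zero>\<^bsub>M\<^esub>, \<zero>\<^bsub>B\<^esub>),
     add = (\<lambda>(a, m, b) (a', m', b'). (a \<oplus>\<^bsub>A\<^esub> a', m \<oplus>\<^bsub>M\<^esub> m', b \<oplus>\<^bsub>B\<^esub> b')),
     smult = (\<lambda>k (a, m, b). (k \<odot>\<^bsub>A\<^esub> a, k \<odot>\<^bsub>M\<^esub> m, k \<odot>\<^bsub>B\<^esub> b))\<rparr>"

definition alg_center :: "('k, 't) module \<Rightarrow> ('k, 't) module" where
  "alg_center T =
     T\<lparr>carrier := {z \<in> carrier T. \<forall>t\<in>carrier T. z \<otimes>\<^bsub>T\<^esub> t = t \<otimes>\<^bsub>T\<^esub> z}\<rparr>"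

text \<open>The field \<open>mult\<close> of \<open>Der\<close> is the Lie bracket; \<open>one\<close> has no meaning.\<close>

definition Der :: "'k ring \<Rightarrow> ('k, 't) module \<Rightarrow> ('k, 't \<Rightarrow> 't) module" where
  "Der K T = \<lparr>carrier = {D \<in> mod_hom K T T \<inter> extensional (carrier T).
       \<forall>s\<in>carrier T. \<forall>t\<in>carrier T. D (s \<otimes>\<^bsub>T\<^esub> t) = D s \<otimes>\<^bsub>T\<^esub> t \<oplus>\<^bsub>T\<^esub> s \<otimes>\<^bsub>T\<^esub> D t},
     mult = (\<lambda>D E. \<lambda>t\<in>carrier T. D (E t) \<ominus>\<^bsub>T\<^esub> E (D t)), one = undefined,
     zero = (\<lambda>t\<in>carrier T. \<zero>\<^bsub>T\<^esub>),
     add = (\<lambda>D E. \<lambda>t\<in>carrier T. D t \<oplus>\<^bsub>T\<^esub> E t),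
     smult = (\<lambda>k D. \<lambda>t\<in>carrier T. k \<odot>\<^bsub>T\<^esub> D t)\<rparr>"

definition Inn :: "('k, 't) module \<Rightarrow> ('t \<Rightarrow> 't) set" where
  "Inn T = (\<lambda>t0. \<lambda>t\<in>carrier T. t0 \<otimes>\<^bsub>T\<^esub> t \<ominus>\<^bsub>T\<^esub> t \<otimes>\<^bsub>T\<^esub> t0) ` carrier T"

definition quot_module :: "('k, 'x) module \<Rightarrow> 'x set \<Rightarrow> ('k, 'x set) module" where
  "quot_module X I = \<lparr>carrier = a_rcosets\<^bsub>X\<^esub> I, mult = rcoset_mult X I, one = I +>\<^bsub>X\<^esub> \<one>\<^bsub>X\<^esub>,
     zero = I, add = set_add X, smult = (\<lambda>k C. \<Union>x\<in>C. I +>\<^bsub>X\<^esub> (k \<odot>\<^bsub>X\<^esub> x))\<rparr>"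

definition HH1 :: "'k ring \<Rightarrow> ('k, 't) module \<Rightarrow> ('k, ('t \<Rightarrow> 't) set) module" where
  "HH1 K T = quot_module (Der K T) (Inn T)"

abbreviation der_class :: "'k ring \<Rightarrow> ('k, 't) module \<Rightarrow> ('t \<Rightarrow> 't) \<Rightarrow> ('t \<Rightarrow> 't) set" where
  "der_class K T D \<equiv> Inn T +>\<^bsub>Der K T\<^esub> D"

text \<open>
  The \<open>K\<close>-endomorphisms \<open>\<mu>\<close> of \<open>M\<close> for which \<open>[\<alpha>, \<mu>; 0, \<beta>]\<close> is a derivation of the triangular
  algebra, and that derivation.
\<close>

definition compat_end ::
    "'k ring \<Rightarrow> ('k, 'a) module \<Rightarrow> ('k, 'a, 'b, 'm) bimodule \<Rightarrow> ('k, 'b) module \<Rightarrow>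
     ('a \<Rightarrow> 'a) \<Rightarrow> ('b \<Rightarrow> 'b) \<Rightarrow> ('m \<Rightarrow> 'm) set" where
  "compat_end K A M B \<alpha> \<beta> = {\<mu> \<in> mod_hom K M M.
     (\<forall>a\<in>carrier A. \<forall>m\<in>carrier M. \<mu> (a \<triangleright>\<^bsub>M\<^esub> m) = \<alpha> a \<triangleright>\<^bsub>M\<^esub> m \<oplus>\<^bsub>M\<^esub> a \<triangleright>\<^bsub>M\<^esub> \<mu> m) \<and>
     (\<forall>b\<in>carrier B. \<forall>m\<in>carrier M. \<mu> (m \<triangleleft>\<^bsub>M\<^esub> b) = \<mu> m \<triangleleft>\<^bsub>M\<^esub> b \<oplus>\<^bsub>M\<^esub> m \<triangleleft>\<^bsub>M\<^esub> \<beta> b)}"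

definition diag_der ::
    "('k, 'a) module \<Rightarrow> ('k, 'a, 'b, 'm) bimodule \<Rightarrow> ('k, 'b) module \<Rightarrow>
     ('a \<Rightarrow> 'a) \<Rightarrow> ('m \<Rightarrow> 'm) \<Rightarrow> ('b \<Rightarrow> 'b) \<Rightarrow> ('a \<times> 'm \<times> 'b \<Rightarrow> 'a \<times> 'm \<times> 'b)" where
  "diag_der A M B \<alpha> \<mu> \<beta> = restrict (\<lambda>(a, m, b). (\<alpha> a, \<mu> m, \<beta> b)) (carrier (tri_alg A M B))"

definition diag_der_data ::
    "'k ring \<Rightarrow> ('k, 'a) module \<Rightarrow> ('k, 'a, 'b, 'm) bimodule \<Rightarrow> ('k, 'b) module \<Rightarrow>
     (('a \<Rightarrow> 'a) \<times> ('m \<Rightarrow> 'm) \<times> ('b \<Rightarrow> 'b)) set" where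
  "diag_der_data K A M B =
     {(\<alpha>, \<mu>, \<beta>). \<alpha> \<in> carrier (Der K A) \<and> \<beta> \<in> carrier (Der K B) \<and> \<mu> \<in> compat_end K A M B \<alpha> \<beta>}"

definition comp11 ::
    "('k, 'a, 'b, 'n) bimodule \<Rightarrow> ('m \<times> 'n \<Rightarrow> 'm \<times> 'n) \<Rightarrow> 'm \<Rightarrow> 'm" where
  "comp11 N \<gamma> = (\<lambda>m. fst (\<gamma> (m, \<zero>\<^bsub>N\<^esub>)))"

definition r0 ::
    "('k, 'a, 'b, 'm) bimodule \<Rightarrow> 'a \<times> ('m \<times> 'n) \<times> 'b \<Rightarrow> 'a \<times> 'm \<times> 'b" where
  "r0 M = (\<lambda>(a, _, b). (a, \<zero>\<^bsub>M\<^esub>, b))"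

text \<open>
  The class of \<open>[\<alpha>, \<gamma>; 0, \<beta>]\<close> goes to the class of \<open>[\<alpha>, \<mu>; 0, \<beta>]\<close>, with \<open>\<mu>\<close> the component of \<open>\<gamma>\<close>
  from \<open>M\<close> to \<open>M\<close>; all representatives of this shape of a class give the same value.
\<close>

definition r1 ::
    "'k ring \<Rightarrow> ('k, 'a) module \<Rightarrow> ('k, 'b) module \<Rightarrow>
     ('k, 'a, 'b, 'm) bimodule \<Rightarrow> ('k, 'a, 'b, 'n) bimodule \<Rightarrow>
     ('a \<times> ('m \<times> 'n) \<times> 'b \<Rightarrow> 'a \<times> ('m \<times> 'n) \<times> 'b) set \<Rightarrow>
     ('a \<times> 'm \<times> 'b \<Rightarrow> 'a \<times> 'm \<times> 'b) set" where
  "r1 K A B M N C = the_elem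
     ((\<lambda>(\<alpha>, \<gamma>, \<beta>). der_class K (tri_alg A M B) (diag_der A M B \<alpha> (comp11 N \<gamma>) \<beta>)) `
      {(\<alpha>, \<gamma>, \<beta>) \<in> diag_der_data K A (M \<oplus>\<^sub>b N) B. diag_der A (M \<oplus>\<^sub>b N) B \<alpha> \<gamma> \<beta> \<in> C})"

definition H1_sub ::
    "'k ring \<Rightarrow> ('k, 'a) module \<Rightarrow> ('k, 'b) module \<Rightarrow>
     ('k, 'a, 'b, 'm) bimodule \<Rightarrow> ('k, 'a, 'b, 'n) bimodule \<Rightarrow>
     ('k, ('a \<times> ('m \<times> 'n) \<times> 'b \<Rightarrow> 'a \<times> ('m \<times> 'n) \<times> 'b) set) module" where
  "H1_sub K A B M N = (HH1 K (tri_alg A (M \<oplus>\<^sub>b N) B))\<lparr>carrier :=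
     (\<lambda>(\<alpha>, \<gamma>, \<beta>). der_class K (tri_alg A (M \<oplus>\<^sub>b N) B) (diag_der A (M \<oplus>\<^sub>b N) B \<alpha> \<gamma> \<beta>)) `
     {(\<alpha>, \<gamma>, \<beta>) \<in> diag_der_data K A (M \<oplus>\<^sub>b N) B.
        (\<forall>m\<in>carrier M. snd (\<gamma> (m, \<zero>\<^bsub>N\<^esub>)) = \<zero>\<^bsub>N\<^esub>) \<and>
        (\<forall>n\<in>carrier N. fst (\<gamma> (\<zero>\<^bsub>M\<^esub>, n)) = \<zero>\<^bsub>M\<^esub>)}\<rparr>"

definition rho1 ::
    "'k ring \<Rightarrow> ('k, 'a) module \<Rightarrow> ('k, 'b) module \<Rightarrow>
     ('k, 'a, 'b, 'm) bimodule \<Rightarrow> ('k, 'a, 'b, 'n) bimodule \<Rightarrow>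
     ('a \<times> ('m \<times> 'n) \<times> 'b \<Rightarrow> 'a \<times> ('m \<times> 'n) \<times> 'b) set \<Rightarrow>
     ('a \<times> 'm \<times> 'b \<Rightarrow> 'a \<times> 'm \<times> 'b) set" where
  "rho1 K A B M N = restrict (r1 K A B M N) (carrier (H1_sub K A B M N))"

definition delta ::
    "'k ring \<Rightarrow> ('k, 'a) module \<Rightarrow> ('k, 'b) module \<Rightarrow>
     ('k, 'a, 'b, 'm) bimodule \<Rightarrow> ('k, 'a, 'b, 'n) bimodule set" where
  "delta K A B M = {N. bimodule K A B N \<and>
     r1 K A B M N ` carrier (HH1 K (tri_alg A (M \<oplus>\<^sub>b N) B)) = carrier (HH1 K (tri_alg A M B))}"

text \<open>Exactness of \<open>0 \<rightarrow> X1 \<rightarrow> X2 \<rightarrow> X3 \<rightarrow> X4 \<rightarrow> X5 \<rightarrow> 0\<close> as a sequence of \<open>K\<close>-modules.\<close>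

definition exact_seq5 ::
    "'k ring \<Rightarrow> ('k, 'x1) module \<Rightarrow> ('x1 \<Rightarrow> 'x2) \<Rightarrow> ('k, 'x2) module \<Rightarrow> ('x2 \<Rightarrow> 'x3) \<Rightarrow>
     ('k, 'x3) module \<Rightarrow> ('x3 \<Rightarrow> 'x4) \<Rightarrow> ('k, 'x4) module \<Rightarrow> ('x4 \<Rightarrow> 'x5) \<Rightarrow>
     ('k, 'x5) module \<Rightarrow> bool" where
  "exact_seq5 K X1 f1 X2 f2 X3 f3 X4 f4 X5 \<longleftrightarrow>
     module K X1 \<and> module K X2 \<and> module K X3 \<and> module K X4 \<and> module K X5 \<and>
     f1 \<in> mod_hom K X1 X2 \<and> f2 \<in> mod_hom K X2 X3 \<and>
     f3 \<in> mod_hom K X3 X4 \<and> f4 \<in> mod_hom K X4 X5 \<and>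
     inj_on f1 (carrier X1) \<and>
     f1 ` carrier X1 = a_kernel X2 X3 f2 \<and>
     f2 ` carrier X2 = a_kernel X3 X4 f3 \<and>
     f3 ` carrier X3 = a_kernel X4 X5 f4 \<and>
     f4 ` carrier X4 = carrier X5"

end

theory Submission
  imports Defs
begin

text \<open>
  The whole statement is about derivations of triangular algebras, and the idea is to replace
  them by triples. Every class in \<open>HH\<^sup>1\<close> of a triangular algebra is represented by a diagonal
  derivation \<open>[\<alpha>, \<mu>; 0, \<beta>]\<close> (\<open>HH1_cases\<close>), and two diagonal derivations have the same class exactly
  when they differ by the inner derivation of a diagonal matrix with entries \<open>a\<close> and \<open>b\<close>
  (\<open>diag_class_eq_iff\<close>): the off-diagonal entry of the inner element must vanish, since the
  difference kills the idempotent \<open>diag(1, 0)\<close>. On the bimodule such an inner derivation is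
  \<open>m \<mapsto> a m - m b\<close>.

  For the bimodule \<open>M \<oplus> N\<close> the middle entry \<open>\<gamma>\<close> is a two by two block matrix. Its diagonal blocks
  satisfy the Leibniz identities over \<open>M\<close> and over \<open>N\<close> for the same \<open>\<alpha>\<close> and \<open>\<beta>\<close>, and its
  off-diagonal blocks are bimodule maps; conversely such blocks can be assembled freely. The map
  \<open>r\<^sup>1\<close> keeps the block \<open>M \<rightarrow> M\<close> (\<open>r1_diag_class\<close>). So a class over \<open>M\<close> lifts as soon as a middle
  entry over \<open>N\<close> exists for its \<open>\<alpha>\<close> and \<open>\<beta>\<close>, with zero off-diagonal blocks (\<open>H1_sub_lift\<close>); and if a
  class lifts, the block \<open>N \<rightarrow> N\<close> of the lift, corrected by an inner term, is such an entry
  (\<open>delta_iff\<close>).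

  A central element of the algebra of \<open>M\<close> is a diagonal matrix acting on \<open>M\<close> by zero
  commutators. Its commutator action \<open>n \<mapsto> a n - n b\<close> on \<open>N\<close> is a bimodule endomorphism, which
  vanishes exactly when the element is also central in the algebra of \<open>M \<oplus> N\<close> (\<open>r0_image\<close>). This
  is the second map of both sequences. The third sends bimodule maps \<open>(\<phi>, \<nu>, \<psi>)\<close> to the
  derivation with \<open>\<alpha> = 0\<close>, \<open>\<beta> = 0\<close> and blocks \<open>0, \<psi>, \<phi>, \<nu>\<close>. That derivation is inner only through a
  diagonal matrix that is central for \<open>M\<close>, which gives exactness in the middle
  (\<open>block_class_zero_iff\<close>). A class killed by \<open>r\<^sup>1\<close> has, after subtracting an inner derivation,
  \<open>\<alpha> = 0\<close>, \<open>\<beta> = 0\<close> and zero block \<open>M \<rightarrow> M\<close>, so the remaining blocks are bimodule maps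
  (\<open>r1_zero_lift\<close>). This lift leaves the off-diagonal blocks unchanged, hence the same argument
  serves the sequence for \<open>H\<^sup>1{M, N}\<close>.
\<close>

section \<open>Modules from closure properties\<close>

lemma (in abelian_group) neg_zero [simp]: "\<ominus> \<zero> = \<zero>"
  by (rule minus_equality) simp_all

lemma (in abelian_group) minus_eq_zero_iff:
  assumes "x \<in> carrier G" "y \<in> carrier G"
  shows "x \<ominus> y = \<zero> \<longleftrightarrow> x = y"
proof
  assume "x \<ominus> y = \<zero>"
  then have "x \<oplus> \<ominus> y \<oplus> y = y" using assms by (simp add: a_minus_def)
  then show "x = y" using assms by (simp add: a_assoc l_neg)
qed (use assms in \<open>simp add: a_minus_def r_neg\<close>)

text \<open>
  Negatives come for free from multiplication by \<open>- 1\<close>, so that only the condition on the scalar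
  zero is needed in place of the existence of inverses.
\<close>

lemma moduleI_scalar:
  fixes K (structure) and X (structure)
  assumes "cring K"
    and closed: "\<And>x y. \<lbrakk>x \<in> carrier X; y \<in> carrier X\<rbrakk> \<Longrightarrow> x \<oplus>\<^bsub>X\<^esub> y \<in> carrier X"
      "\<zero>\<^bsub>X\<^esub> \<in> carrier X"
      "\<And>k x. \<lbrakk>k \<in> carrier K; x \<in> carrier X\<rbrakk> \<Longrightarrow> k \<odot>\<^bsub>X\<^esub> x \<in> carrier X"
    and add: "\<And>x y z. \<lbrakk>x \<in> carrier X; y \<in> carrier X; z \<in> carrier X\<rbrakk>
        \<Longrightarrow> x \<oplus>\<^bsub>X\<^esub> y \<oplus>\<^bsub>X\<^esub> z = x \<oplus>\<^bsub>X\<^esub> (y \<oplus>\<^bsub>X\<^esub> z)"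
      "\<And>x y. \<lbrakk>x \<in> carrier X; y \<in> carrier X\<rbrakk> \<Longrightarrow> x \<oplus>\<^bsub>X\<^esub> y = y \<oplus>\<^bsub>X\<^esub> x"
      "\<And>x. x \<in> carrier X \<Longrightarrow> \<zero>\<^bsub>X\<^esub> \<oplus>\<^bsub>X\<^esub> x = x"
    and smult: "\<And>k l x. \<lbrakk>k \<in> carrier K; l \<in> carrier K; x \<in> carrier X\<rbrakk>
        \<Longrightarrow> (k \<oplus>\<^bsub>K\<^esub> l) \<odot>\<^bsub>X\<^esub> x = k \<odot>\<^bsub>X\<^esub> x \<oplus>\<^bsub>X\<^esub> l \<odot>\<^bsub>X\<^esub> x"
      "\<And>k x y. \<lbrakk>k \<in> carrier K; x \<in> carrier X; y \<in> carrier X\<rbrakk>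
        \<Longrightarrow> k \<odot>\<^bsub>X\<^esub> (x \<oplus>\<^bsub>X\<^esub> y) = k \<odot>\<^bsub>X\<^esub> x \<oplus>\<^bsub>X\<^esub> k \<odot>\<^bsub>X\<^esub> y"
      "\<And>k l x. \<lbrakk>k \<in> carrier K; l \<in> carrier K; x \<in> carrier X\<rbrakk>
        \<Longrightarrow> (k \<otimes>\<^bsub>K\<^esub> l) \<odot>\<^bsub>X\<^esub> x = k \<odot>\<^bsub>X\<^esub> (l \<odot>\<^bsub>X\<^esub> x)"
      "\<And>x. x \<in> carrier X \<Longrightarrow> \<one>\<^bsub>K\<^esub> \<odot>\<^bsub>X\<^esub> x = x"
      "\<And>x. x \<in> carrier X \<Longrightarrow> \<zero>\<^bsub>K\<^esub> \<odot>\<^bsub>X\<^esub> x = \<zero>\<^bsub>X\<^esub>"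
  shows "module K X"
proof -
  interpret K: cring K by fact
  have neg: "\<exists>y\<in>carrier X. y \<oplus>\<^bsub>X\<^esub> x = \<zero>\<^bsub>X\<^esub>" if x: "x \<in> carrier X" for x
  proof (rule bexI)
    have "(\<ominus>\<^bsub>K\<^esub> \<one>\<^bsub>K\<^esub>) \<odot>\<^bsub>X\<^esub> x \<oplus>\<^bsub>X\<^esub> x = (\<ominus>\<^bsub>K\<^esub> \<one>\<^bsub>K\<^esub> \<oplus>\<^bsub>K\<^esub> \<one>\<^bsub>K\<^esub>) \<odot>\<^bsub>X\<^esub> x"
      using x by (simp only: smult(1,4) K.a_inv_closed K.one_closed)
    then show "(\<ominus>\<^bsub>K\<^esub> \<one>\<^bsub>K\<^esub>) \<odot>\<^bsub>X\<^esub> x \<oplus>\<^bsub>X\<^esub> x = \<zero>\<^bsub>X\<^esub>"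
      using x by (simp add: K.l_neg smult(5))
  qed (use x closed in simp)
  have "abelian_group X"
    by (rule abelian_groupI) (use closed add neg in auto)
  then show ?thesis
    by (intro moduleI) (use assms in auto)
qed

text \<open>
  Derivations and bimodule maps are both modules of functions with pointwise operations; this
  reduces their module axioms to closure under these operations.
\<close>

lemma module_of_functions:
  fixes K (structure) and X :: "('k, 'd \<Rightarrow> 'y, 'p) module_scheme" and Y :: "('k, 'y, 'q) module_scheme"
  assumes Y: "module K Y" and sub: "carrier X \<subseteq> D \<rightarrow>\<^sub>E carrier Y"
    and ops: "zero X = (\<lambda>d\<in>D. \<zero>\<^bsub>Y\<^esub>)" "add X = (\<lambda>f g. \<lambda>d\<in>D. f d \<oplus>\<^bsub>Y\<^esub> g d)"
      "smult X = (\<lambda>k f. \<lambda>d\<in>D. k \<odot>\<^bsub>Y\<^esub> f d)"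
    and closed: "\<zero>\<^bsub>X\<^esub> \<in> carrier X"
      "\<And>f g. \<lbrakk>f \<in> carrier X; g \<in> carrier X\<rbrakk> \<Longrightarrow> f \<oplus>\<^bsub>X\<^esub> g \<in> carrier X"
      "\<And>k f. \<lbrakk>k \<in> carrier K; f \<in> carrier X\<rbrakk> \<Longrightarrow> k \<odot>\<^bsub>X\<^esub> f \<in> carrier X"
  shows "module K X"
proof -
  interpret Y: module K Y by fact
  have val: "f d \<in> carrier Y" if "f \<in> carrier X" "d \<in> D" for f d
    using sub that by auto
  have ext: "f = g" if "f \<in> D \<rightarrow>\<^sub>E carrier Y" "g \<in> D \<rightarrow>\<^sub>E carrier Y" "\<And>d. d \<in> D \<Longrightarrow> f d = g d" for f g
    using that by (rule PiE_ext)
  have res: "(\<lambda>d\<in>D. f d) = g" if "g \<in> carrier X" "\<And>d. d \<in> D \<Longrightarrow> f d = g d" for f g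
  proof (rule ext)
    show "g \<in> D \<rightarrow>\<^sub>E carrier Y" using that(1) sub by blast
    then show "(\<lambda>d\<in>D. f d) \<in> D \<rightarrow>\<^sub>E carrier Y" by (auto simp: that(2))
    show "(\<lambda>d\<in>D. f d) d = g d" if "d \<in> D" for d using that \<open>\<And>d. d \<in> D \<Longrightarrow> f d = g d\<close> by simp
  qed
  show ?thesis
  proof (rule moduleI_scalar)
    show "cring K" by (rule Y.R.is_cring)
  next
    fix f assume f: "f \<in> carrier X"
    show "\<zero>\<^bsub>X\<^esub> \<oplus>\<^bsub>X\<^esub> f = f" "\<one>\<^bsub>K\<^esub> \<odot>\<^bsub>X\<^esub> f = f"
      by (auto simp: ops val f intro!: res)
    show "\<zero>\<^bsub>K\<^esub> \<odot>\<^bsub>X\<^esub> f = \<zero>\<^bsub>X\<^esub>"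
      by (auto simp: ops val f intro!: restrict_ext)
  next
    fix f g assume f: "f \<in> carrier X" and g: "g \<in> carrier X"
    note v = val[OF f] val[OF g]
    show "f \<oplus>\<^bsub>X\<^esub> g = g \<oplus>\<^bsub>X\<^esub> f"
      by (auto simp: ops v Y.M.a_comm intro!: restrict_ext)
    show "f \<oplus>\<^bsub>X\<^esub> g \<oplus>\<^bsub>X\<^esub> h = f \<oplus>\<^bsub>X\<^esub> (g \<oplus>\<^bsub>X\<^esub> h)" if "h \<in> carrier X" for h
      by (auto simp: ops v val[OF that] Y.M.a_assoc intro!: restrict_ext)
    show "k \<odot>\<^bsub>X\<^esub> (f \<oplus>\<^bsub>X\<^esub> g) = k \<odot>\<^bsub>X\<^esub> f \<oplus>\<^bsub>X\<^esub> k \<odot>\<^bsub>X\<^esub> g" if "k \<in> carrier K" for k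
      by (auto simp: ops v that Y.smult_r_distr intro!: restrict_ext)
  next
    fix k l f assume "k \<in> carrier K" "l \<in> carrier K" and f: "f \<in> carrier X"
    then show "(k \<oplus>\<^bsub>K\<^esub> l) \<odot>\<^bsub>X\<^esub> f = k \<odot>\<^bsub>X\<^esub> f \<oplus>\<^bsub>X\<^esub> l \<odot>\<^bsub>X\<^esub> f"
      "k \<otimes>\<^bsub>K\<^esub> l \<odot>\<^bsub>X\<^esub> f = k \<odot>\<^bsub>X\<^esub> (l \<odot>\<^bsub>X\<^esub> f)"
      by (auto simp: ops val[OF f] Y.smult_l_distr Y.smult_assoc1 intro!: restrict_ext)
  qed (use closed in auto)
qed

lemma (in module) submodule_scalarI:
  assumes "H \<subseteq> carrier M" "\<zero>\<^bsub>M\<^esub> \<in> H"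
    and "\<And>x y. \<lbrakk>x \<in> H; y \<in> H\<rbrakk> \<Longrightarrow> x \<oplus>\<^bsub>M\<^esub> y \<in> H"
    and smult: "\<And>k x. \<lbrakk>k \<in> carrier R; x \<in> H\<rbrakk> \<Longrightarrow> k \<odot>\<^bsub>M\<^esub> x \<in> H"
  shows "submodule H R M"
proof (rule submoduleI)
  fix x assume x: "x \<in> H"
  then have "\<ominus>\<^bsub>M\<^esub> x = (\<ominus>\<^bsub>R\<^esub> \<one>\<^bsub>R\<^esub>) \<odot>\<^bsub>M\<^esub> x"
    using assms(1) by (subst smult_l_minus) auto
  with smult[OF _ x] show "\<ominus>\<^bsub>M\<^esub> x \<in> H" by simp
qed (use assms in auto)

section \<open>Quotients and products\<close>

lemma (in module) quot_eq_iff: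
  assumes "submodule H R M" "x \<in> carrier M" "y \<in> carrier M"
  shows "H +>\<^bsub>M\<^esub> x = H +>\<^bsub>M\<^esub> y \<longleftrightarrow> (\<exists>h\<in>H. x = h \<oplus>\<^bsub>M\<^esub> y)"
proof -
  have sg: "subgroup H (add_monoid M)" using assms(1) by (rule submodule.axioms(1))
  then interpret H: abelian_subgroup H M
    by (intro abelian_subgroupI3 additive_subgroup.intro M.abelian_group_axioms)
  show ?thesis
  proof
    assume "H +>\<^bsub>M\<^esub> x = H +>\<^bsub>M\<^esub> y"
    then have "x \<in> H +>\<^bsub>M\<^esub> y" using H.a_rcos_self[OF assms(2)] by simp
    then show "\<exists>h\<in>H. x = h \<oplus>\<^bsub>M\<^esub> y" by (auto simp: a_r_coset_def')
  next
    assume "\<exists>h\<in>H. x = h \<oplus>\<^bsub>M\<^esub> y"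
    then have "x \<in> H +>\<^bsub>M\<^esub> y" by (auto simp: a_r_coset_def')
    then show "H +>\<^bsub>M\<^esub> x = H +>\<^bsub>M\<^esub> y"
      using H.a_repr_independence'[OF _ assms(3)] by simp
  qed
qed

context
  fixes K :: "'k ring" and X :: "('k, 'x) module" and H :: "'x set"
  assumes X: "module K X" and H: "submodule H K X"
begin

interpretation X: module K X by (rule X)

interpretation H: abelian_subgroup H X
  by (intro abelian_subgroupI3 additive_subgroup.intro submodule.axioms(1)[OF H] X.M.abelian_group_axioms)

lemma carrier_quot: "carrier (quot_module X H) = (\<lambda>x. H +>\<^bsub>X\<^esub> x) ` carrier X"
  by (auto simp: quot_module_def A_RCOSETS_def')

lemma zero_quot: "\<zero>\<^bsub>quot_module X H\<^esub> = H +>\<^bsub>X\<^esub> \<zero>\<^bsub>X\<^esub>"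
  using H.a_subset by (simp add: quot_module_def)

lemma add_quot:
  "\<lbrakk>x \<in> carrier X; y \<in> carrier X\<rbrakk>
    \<Longrightarrow> (H +>\<^bsub>X\<^esub> x) \<oplus>\<^bsub>quot_module X H\<^esub> (H +>\<^bsub>X\<^esub> y) = H +>\<^bsub>X\<^esub> (x \<oplus>\<^bsub>X\<^esub> y)"
  by (simp add: quot_module_def H.a_rcos_sum)

text \<open>
  The scalar multiple of a coset is defined as a union over its elements; all members of that
  union coincide because the submodule is closed under scalars.
\<close>

lemma smult_quot:
  assumes "k \<in> carrier K" "x \<in> carrier X"
  shows "k \<odot>\<^bsub>quot_module X H\<^esub> (H +>\<^bsub>X\<^esub> x) = H +>\<^bsub>X\<^esub> (k \<odot>\<^bsub>X\<^esub> x)"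
proof -
  have "H +>\<^bsub>X\<^esub> (k \<odot>\<^bsub>X\<^esub> y) = H +>\<^bsub>X\<^esub> (k \<odot>\<^bsub>X\<^esub> x)" if y: "y \<in> H +>\<^bsub>X\<^esub> x" for y
  proof -
    obtain h where h: "h \<in> H" "y = h \<oplus>\<^bsub>X\<^esub> x" using y by (auto simp: a_r_coset_def')
    then have hX: "h \<in> carrier X" using H.a_subset by blast
    have "k \<odot>\<^bsub>X\<^esub> y = k \<odot>\<^bsub>X\<^esub> h \<oplus>\<^bsub>X\<^esub> k \<odot>\<^bsub>X\<^esub> x"
      unfolding h(2) using assms hX by (simp add: X.smult_r_distr)
    moreover have "k \<odot>\<^bsub>X\<^esub> h \<in> H" using assms h(1) submodule.smult_closed[OF H] by blast
    moreover have "y \<in> carrier X" using h(2) hX assms(2) by simp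
    ultimately show ?thesis
      using assms by (subst X.quot_eq_iff[OF H]) (blast intro: X.smult_closed)+
  qed
  moreover have "H +>\<^bsub>X\<^esub> x \<noteq> {}" using H.a_rcos_self[OF assms(2)] by blast
  ultimately have "(\<Union>y\<in>H +>\<^bsub>X\<^esub> x. H +>\<^bsub>X\<^esub> (k \<odot>\<^bsub>X\<^esub> y)) = H +>\<^bsub>X\<^esub> (k \<odot>\<^bsub>X\<^esub> x)"
    by (intro SUP_eq_const)
  then show ?thesis by (simp add: quot_module_def)
qed

lemma module_quot: "module K (quot_module X H)"
proof (rule moduleI_scalar)
  show "cring K" by (rule X.R.is_cring)
next
  fix C D E assume "C \<in> carrier (quot_module X H)" "D \<in> carrier (quot_module X H)"
    "E \<in> carrier (quot_module X H)"
  then obtain x y z where "x \<in> carrier X" "C = H +>\<^bsub>X\<^esub> x" "y \<in> carrier X" "D = H +>\<^bsub>X\<^esub> y"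
    "z \<in> carrier X" "E = H +>\<^bsub>X\<^esub> z"
    by (auto simp: carrier_quot)
  then show "C \<oplus>\<^bsub>quot_module X H\<^esub> D \<oplus>\<^bsub>quot_module X H\<^esub> E =
      C \<oplus>\<^bsub>quot_module X H\<^esub> (D \<oplus>\<^bsub>quot_module X H\<^esub> E)"
    by (simp add: add_quot X.M.a_assoc)
next
  fix C D assume "C \<in> carrier (quot_module X H)" "D \<in> carrier (quot_module X H)"
  then obtain x y where xy: "x \<in> carrier X" "C = H +>\<^bsub>X\<^esub> x" "y \<in> carrier X" "D = H +>\<^bsub>X\<^esub> y"
    by (auto simp: carrier_quot)
  then show "C \<oplus>\<^bsub>quot_module X H\<^esub> D = D \<oplus>\<^bsub>quot_module X H\<^esub> C"
    "C \<oplus>\<^bsub>quot_module X H\<^esub> D \<in> carrier (quot_module X H)"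
    by (simp_all add: add_quot X.M.a_comm carrier_quot)
  show "k \<odot>\<^bsub>quot_module X H\<^esub> (C \<oplus>\<^bsub>quot_module X H\<^esub> D) =
      k \<odot>\<^bsub>quot_module X H\<^esub> C \<oplus>\<^bsub>quot_module X H\<^esub> k \<odot>\<^bsub>quot_module X H\<^esub> D"
    if "k \<in> carrier K" for k
    using xy that by (simp add: add_quot smult_quot X.smult_r_distr)
next
  fix C k l assume "C \<in> carrier (quot_module X H)" and kl: "k \<in> carrier K" "l \<in> carrier K"
  then obtain x where x: "x \<in> carrier X" "C = H +>\<^bsub>X\<^esub> x"
    by (auto simp: carrier_quot)
  then show "(k \<oplus>\<^bsub>K\<^esub> l) \<odot>\<^bsub>quot_module X H\<^esub> C =
      k \<odot>\<^bsub>quot_module X H\<^esub> C \<oplus>\<^bsub>quot_module X H\<^esub> l \<odot>\<^bsub>quot_module X H\<^esub> C"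
    "(k \<otimes>\<^bsub>K\<^esub> l) \<odot>\<^bsub>quot_module X H\<^esub> C =
      k \<odot>\<^bsub>quot_module X H\<^esub> (l \<odot>\<^bsub>quot_module X H\<^esub> C)"
    using kl by (simp_all add: add_quot smult_quot X.smult_l_distr X.smult_assoc1)
next
  fix C assume "C \<in> carrier (quot_module X H)"
  then obtain x where x: "x \<in> carrier X" "C = H +>\<^bsub>X\<^esub> x"
    by (auto simp: carrier_quot)
  then show "\<zero>\<^bsub>quot_module X H\<^esub> \<oplus>\<^bsub>quot_module X H\<^esub> C = C"
    "\<zero>\<^bsub>K\<^esub> \<odot>\<^bsub>quot_module X H\<^esub> C = \<zero>\<^bsub>quot_module X H\<^esub>"
    "\<one>\<^bsub>K\<^esub> \<odot>\<^bsub>quot_module X H\<^esub> C = C"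
    by (simp_all only: zero_quot add_quot smult_quot X.M.zero_closed X.R.zero_closed X.R.one_closed
        X.M.l_zero X.smult_l_null X.smult_one)
  show "k \<odot>\<^bsub>quot_module X H\<^esub> C \<in> carrier (quot_module X H)" if "k \<in> carrier K" for k
    using x that by (simp add: smult_quot carrier_quot)
next
  show "\<zero>\<^bsub>quot_module X H\<^esub> \<in> carrier (quot_module X H)"
    by (simp only: zero_quot carrier_quot imageI X.M.zero_closed)
qed

end

lemma module_prod_module:
  assumes "module K X" "module K Y"
  shows "module K (prod_module X Y)"
proof -
  interpret X: module K X by fact
  interpret Y: module K Y by fact
  show ?thesis
    by (rule moduleI_scalar) (auto simp: prod_module_def X.R.is_cring X.M.a_ac
      X.smult_l_distr X.smult_r_distr X.smult_assoc1 Y.M.a_ac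
      Y.smult_l_distr Y.smult_r_distr Y.smult_assoc1)
qed

section \<open>Centers, derivations and inner derivations\<close>

definition ad :: "('k, 't) module \<Rightarrow> 't \<Rightarrow> 't \<Rightarrow> 't" where
  "ad T u t = u \<otimes>\<^bsub>T\<^esub> t \<ominus>\<^bsub>T\<^esub> t \<otimes>\<^bsub>T\<^esub> u"

lemma Inn_eq: "Inn T = (\<lambda>u. restrict (ad T u) (carrier T)) ` carrier T"
  by (simp add: Inn_def ad_def[abs_def])

context assoc_algebra
begin

lemma is_module: "module K A" by unfold_locales

lemma module_center: "module K (alg_center A)"
proof -
  have "submodule {z \<in> carrier A. \<forall>t\<in>carrier A. z \<otimes>\<^bsub>A\<^esub> t = t \<otimes>\<^bsub>A\<^esub> z} K A"
    by (rule submodule_scalarI) (auto simp: l_distr r_distr smult_mult_left smult_mult_right)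
  from submodule.submodule_is_module[OF this is_module] show ?thesis
    by (simp add: alg_center_def)
qed

lemma
  assumes "D \<in> carrier (Der K A)"
  shows Der_closed: "t \<in> carrier A \<Longrightarrow> D t \<in> carrier A"
    and Der_add: "\<lbrakk>s \<in> carrier A; t \<in> carrier A\<rbrakk> \<Longrightarrow> D (s \<oplus>\<^bsub>A\<^esub> t) = D s \<oplus>\<^bsub>A\<^esub> D t"
    and Der_smult: "\<lbrakk>k \<in> carrier K; t \<in> carrier A\<rbrakk> \<Longrightarrow> D (k \<odot>\<^bsub>A\<^esub> t) = k \<odot>\<^bsub>A\<^esub> D t"
    and Der_mult: "\<lbrakk>s \<in> carrier A; t \<in> carrier A\<rbrakk>
      \<Longrightarrow> D (s \<otimes>\<^bsub>A\<^esub> t) = D s \<otimes>\<^bsub>A\<^esub> t \<oplus>\<^bsub>A\<^esub> s \<otimes>\<^bsub>A\<^esub> D t"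
  using assms by (auto simp: Der_def mod_hom_def)

lemma DerI:
  assumes "\<And>t. t \<in> carrier A \<Longrightarrow> D t \<in> carrier A"
    and "\<And>s t. \<lbrakk>s \<in> carrier A; t \<in> carrier A\<rbrakk> \<Longrightarrow> D (s \<oplus>\<^bsub>A\<^esub> t) = D s \<oplus>\<^bsub>A\<^esub> D t"
    and "\<And>k t. \<lbrakk>k \<in> carrier K; t \<in> carrier A\<rbrakk> \<Longrightarrow> D (k \<odot>\<^bsub>A\<^esub> t) = k \<odot>\<^bsub>A\<^esub> D t"
    and "\<And>s t. \<lbrakk>s \<in> carrier A; t \<in> carrier A\<rbrakk>
      \<Longrightarrow> D (s \<otimes>\<^bsub>A\<^esub> t) = D s \<otimes>\<^bsub>A\<^esub> t \<oplus>\<^bsub>A\<^esub> s \<otimes>\<^bsub>A\<^esub> D t"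
  shows "restrict D (carrier A) \<in> carrier (Der K A)"
  using assms by (auto simp: Der_def mod_hom_def)

lemma Der_extensional: "D \<in> carrier (Der K A) \<Longrightarrow> D \<in> extensional (carrier A)"
  by (auto simp: Der_def)

lemma Der_ops:
  "\<zero>\<^bsub>Der K A\<^esub> = (\<lambda>t\<in>carrier A. \<zero>\<^bsub>A\<^esub>)"
  "D \<oplus>\<^bsub>Der K A\<^esub> E = (\<lambda>t\<in>carrier A. D t \<oplus>\<^bsub>A\<^esub> E t)"
  "k \<odot>\<^bsub>Der K A\<^esub> D = (\<lambda>t\<in>carrier A. k \<odot>\<^bsub>A\<^esub> D t)"
  by (auto simp: Der_def)

lemma module_Der: "module K (Der K A)"
proof (rule module_of_functions[OF is_module])
  show "carrier (Der K A) \<subseteq> carrier A \<rightarrow>\<^sub>E carrier A"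
    by (auto simp: Der_def mod_hom_def PiE_def)
next
  show "\<zero>\<^bsub>Der K A\<^esub> \<in> carrier (Der K A)"
    unfolding Der_ops by (rule DerI) auto
next
  fix D E assume D: "D \<in> carrier (Der K A)" and E: "E \<in> carrier (Der K A)"
  note DE = Der_closed[OF D] Der_add[OF D] Der_smult[OF D] Der_mult[OF D]
    Der_closed[OF E] Der_add[OF E] Der_smult[OF E] Der_mult[OF E]
  show "D \<oplus>\<^bsub>Der K A\<^esub> E \<in> carrier (Der K A)"
    unfolding Der_ops
    by (intro DerI) (simp_all add: DE M.a_ac smult_r_distr l_distr r_distr)
next
  fix k D assume k: "k \<in> carrier K" and D: "D \<in> carrier (Der K A)"
  show "k \<odot>\<^bsub>Der K A\<^esub> D \<in> carrier (Der K A)"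
    unfolding Der_ops using k
    by (intro DerI) (simp_all add: Der_closed[OF D] Der_add[OF D] Der_smult[OF D] Der_mult[OF D]
        smult_r_distr smult_mult_left smult_mult_right smult_assoc1[symmetric] R.m_comm)
qed (auto simp: Der_def)

lemma ad_closed: "\<lbrakk>u \<in> carrier A; t \<in> carrier A\<rbrakk> \<Longrightarrow> ad A u t \<in> carrier A"
  by (simp add: ad_def)

lemma ad_uminus: "\<lbrakk>u \<in> carrier A; t \<in> carrier A\<rbrakk> \<Longrightarrow> ad A (\<ominus>\<^bsub>A\<^esub> u) t = \<ominus>\<^bsub>A\<^esub> ad A u t"
  by (simp add: ad_def a_minus_def l_minus r_minus M.minus_add)

lemma ad_zero: "t \<in> carrier A \<Longrightarrow> ad A \<zero>\<^bsub>A\<^esub> t = \<zero>\<^bsub>A\<^esub>"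
  by (simp add: ad_def a_minus_def)

lemma ad_in_Der:
  assumes u: "u \<in> carrier A"
  shows "restrict (ad A u) (carrier A) \<in> carrier (Der K A)"
proof (rule DerI)
  fix s t assume st: "s \<in> carrier A" "t \<in> carrier A"
  have "\<ominus>\<^bsub>A\<^esub> (s \<otimes>\<^bsub>A\<^esub> (u \<otimes>\<^bsub>A\<^esub> t)) \<oplus>\<^bsub>A\<^esub> (s \<otimes>\<^bsub>A\<^esub> (u \<otimes>\<^bsub>A\<^esub> t) \<oplus>\<^bsub>A\<^esub> x) = x" if "x \<in> carrier A" for x
    using u st that by (simp add: M.r_neg1)
  then show "ad A u (s \<otimes>\<^bsub>A\<^esub> t) = ad A u s \<otimes>\<^bsub>A\<^esub> t \<oplus>\<^bsub>A\<^esub> s \<otimes>\<^bsub>A\<^esub> ad A u t"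
    using st u by (simp add: ad_def a_minus_def l_distr r_distr l_minus r_minus m_assoc M.a_assoc)
qed (use u in \<open>auto simp: ad_def smult_r_distr smult_r_minus a_minus_def l_distr r_distr
  smult_mult_left smult_mult_right M.minus_add M.a_ac\<close>)

lemma submodule_Inn: "submodule (Inn A) K (Der K A)"
proof -
  interpret D: module K "Der K A" by (rule module_Der)
  let ?ad = "\<lambda>u. \<lambda>t\<in>carrier A. ad A u t"
  show ?thesis
  proof (rule D.submodule_scalarI)
    show "Inn A \<subseteq> carrier (Der K A)" by (auto simp only: Inn_eq intro!: ad_in_Der)
  next
    have "\<zero>\<^bsub>Der K A\<^esub> = ?ad \<zero>\<^bsub>A\<^esub>"
      unfolding Der_ops by (intro restrict_ext) (simp add: ad_zero)
    then show "\<zero>\<^bsub>Der K A\<^esub> \<in> Inn A" unfolding Inn_eq by auto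
  next
    fix D E assume "D \<in> Inn A" "E \<in> Inn A"
    then obtain u v where uv: "u \<in> carrier A" "D = ?ad u" "v \<in> carrier A" "E = ?ad v"
      by (auto simp: Inn_eq)
    then have "D \<oplus>\<^bsub>Der K A\<^esub> E = ?ad (u \<oplus>\<^bsub>A\<^esub> v)"
      unfolding Der_ops
      by (intro restrict_ext) (simp add: ad_def a_minus_def l_distr r_distr M.minus_add M.a_ac)
    with uv show "D \<oplus>\<^bsub>Der K A\<^esub> E \<in> Inn A" unfolding Inn_eq by auto
  next
    fix k D assume k: "k \<in> carrier K" and "D \<in> Inn A"
    then obtain u where u: "u \<in> carrier A" "D = ?ad u" by (auto simp: Inn_eq)
    then have "k \<odot>\<^bsub>Der K A\<^esub> D = ?ad (k \<odot>\<^bsub>A\<^esub> u)"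
      unfolding Der_ops using k
      by (intro restrict_ext)
        (simp add: ad_def a_minus_def smult_r_distr smult_r_minus smult_mult_left smult_mult_right)
    with u k show "k \<odot>\<^bsub>Der K A\<^esub> D \<in> Inn A" unfolding Inn_eq by auto
  qed
qed

text \<open>
  Turns equality of cosets into a pointwise identity, the form in which all later computations
  are made.
\<close>

lemma der_class_eq_iff:
  assumes "D \<in> carrier (Der K A)" "E \<in> carrier (Der K A)"
  shows "der_class K A D = der_class K A E \<longleftrightarrow>
    (\<exists>u\<in>carrier A. \<forall>t\<in>carrier A. D t = ad A u t \<oplus>\<^bsub>A\<^esub> E t)"
proof -
  interpret D: module K "Der K A" by (rule module_Der)
  have "D = restrict (ad A u) (carrier A) \<oplus>\<^bsub>Der K A\<^esub> E \<longleftrightarrow>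
      (\<forall>t\<in>carrier A. D t = ad A u t \<oplus>\<^bsub>A\<^esub> E t)" for u
    using Der_extensional[OF assms(1)] unfolding Der_ops
    by (auto intro!: extensionalityI[where A = "carrier A"])
  then show ?thesis
    unfolding D.quot_eq_iff[OF submodule_Inn assms] unfolding Inn_eq by simp
qed

lemmas HH1_carrier = carrier_quot[OF module_Der submodule_Inn, folded HH1_def]
lemmas HH1_zero = zero_quot[OF module_Der submodule_Inn, folded HH1_def]
lemmas HH1_add = add_quot[OF module_Der submodule_Inn, folded HH1_def]
lemmas HH1_smult = smult_quot[OF module_Der submodule_Inn, folded HH1_def]
lemmas module_HH1 = module_quot[OF module_Der submodule_Inn, folded HH1_def]

lemma Der_zero: "D \<in> carrier (Der K A) \<Longrightarrow> D \<zero>\<^bsub>A\<^esub> = \<zero>\<^bsub>A\<^esub>"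
  using Der_smult[of D "\<zero>\<^bsub>K\<^esub>" "\<zero>\<^bsub>A\<^esub>"] Der_closed[of D "\<zero>\<^bsub>A\<^esub>"] by simp

end

section \<open>Bimodules and their triangular algebras\<close>

text \<open>
  The commutator with a diagonal matrix, seen on the off-diagonal entry of the triangular algebra.
\<close>

definition ad_act :: "('k, 'a, 'b, 'm) bimodule \<Rightarrow> 'a \<Rightarrow> 'b \<Rightarrow> 'm \<Rightarrow> 'm" where
  "ad_act M a b m = a \<triangleright>\<^bsub>M\<^esub> m \<ominus>\<^bsub>M\<^esub> m \<triangleleft>\<^bsub>M\<^esub> b"

lemma tri_simps:
  "carrier (tri_alg A M B) = carrier A \<times> carrier M \<times> carrier B"
  "(a, m, b) \<otimes>\<^bsub>tri_alg A M B\<^esub> (a', m', b') =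
    (a \<otimes>\<^bsub>A\<^esub> a', a \<triangleright>\<^bsub>M\<^esub> m' \<oplus>\<^bsub>M\<^esub> m \<triangleleft>\<^bsub>M\<^esub> b', b \<otimes>\<^bsub>B\<^esub> b')"
  "\<one>\<^bsub>tri_alg A M B\<^esub> = (\<one>\<^bsub>A\<^esub>, \<zero>\<^bsub>M\<^esub>, \<one>\<^bsub>B\<^esub>)"
  "\<zero>\<^bsub>tri_alg A M B\<^esub> = (\<zero>\<^bsub>A\<^esub>, \<zero>\<^bsub>M\<^esub>, \<zero>\<^bsub>B\<^esub>)"
  "(a, m, b) \<oplus>\<^bsub>tri_alg A M B\<^esub> (a', m', b') = (a \<oplus>\<^bsub>A\<^esub> a', m \<oplus>\<^bsub>M\<^esub> m', b \<oplus>\<^bsub>B\<^esub> b')"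
  "k \<odot>\<^bsub>tri_alg A M B\<^esub> (a, m, b) = (k \<odot>\<^bsub>A\<^esub> a, k \<odot>\<^bsub>M\<^esub> m, k \<odot>\<^bsub>B\<^esub> b)"
  by (simp_all add: tri_alg_def)

context bimodule
begin

declare lact_closed [simp] ract_closed [simp] one_lact [simp] ract_one [simp]

lemma zero_lact [simp]: "m \<in> carrier M \<Longrightarrow> \<zero>\<^bsub>A\<^esub> \<triangleright>\<^bsub>M\<^esub> m = \<zero>\<^bsub>M\<^esub>"
  using smult_lact[of "\<zero>\<^bsub>K\<^esub>" "\<zero>\<^bsub>A\<^esub>" m] by simp

lemma ract_zero [simp]: "m \<in> carrier M \<Longrightarrow> m \<triangleleft>\<^bsub>M\<^esub> \<zero>\<^bsub>B\<^esub> = \<zero>\<^bsub>M\<^esub>"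
  using ract_smult[of "\<zero>\<^bsub>K\<^esub>" "\<zero>\<^bsub>B\<^esub>" m] by simp

lemma lact_zero [simp]: "a \<in> carrier A \<Longrightarrow> a \<triangleright>\<^bsub>M\<^esub> \<zero>\<^bsub>M\<^esub> = \<zero>\<^bsub>M\<^esub>"
  using lact_add[of a "\<zero>\<^bsub>M\<^esub>" "\<zero>\<^bsub>M\<^esub>"] by simp

lemma zero_ract [simp]: "b \<in> carrier B \<Longrightarrow> \<zero>\<^bsub>M\<^esub> \<triangleleft>\<^bsub>M\<^esub> b = \<zero>\<^bsub>M\<^esub>"
  using add_ract[of b "\<zero>\<^bsub>M\<^esub>" "\<zero>\<^bsub>M\<^esub>"] by simp

lemma uminus_lact: "\<lbrakk>a \<in> carrier A; m \<in> carrier M\<rbrakk> \<Longrightarrow> (\<ominus>\<^bsub>A\<^esub> a) \<triangleright>\<^bsub>M\<^esub> m = \<ominus>\<^bsub>M\<^esub> (a \<triangleright>\<^bsub>M\<^esub> m)"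
  by (rule M.minus_equality[symmetric]) (simp_all add: add_lact[symmetric] A.M.l_neg)

lemma lact_uminus: "\<lbrakk>a \<in> carrier A; m \<in> carrier M\<rbrakk> \<Longrightarrow> a \<triangleright>\<^bsub>M\<^esub> (\<ominus>\<^bsub>M\<^esub> m) = \<ominus>\<^bsub>M\<^esub> (a \<triangleright>\<^bsub>M\<^esub> m)"
  by (rule M.minus_equality[symmetric]) (simp_all add: lact_add[symmetric] M.l_neg)

lemma ract_uminus: "\<lbrakk>b \<in> carrier B; m \<in> carrier M\<rbrakk> \<Longrightarrow> m \<triangleleft>\<^bsub>M\<^esub> (\<ominus>\<^bsub>B\<^esub> b) = \<ominus>\<^bsub>M\<^esub> (m \<triangleleft>\<^bsub>M\<^esub> b)"
  by (rule M.minus_equality[symmetric]) (simp_all add: ract_add[symmetric] B.M.l_neg)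

lemma uminus_ract: "\<lbrakk>b \<in> carrier B; m \<in> carrier M\<rbrakk> \<Longrightarrow> (\<ominus>\<^bsub>M\<^esub> m) \<triangleleft>\<^bsub>M\<^esub> b = \<ominus>\<^bsub>M\<^esub> (m \<triangleleft>\<^bsub>M\<^esub> b)"
  by (rule M.minus_equality[symmetric]) (simp_all add: add_ract[symmetric] M.l_neg)

text \<open>
  That the left action is linear over the scalars follows by moving \<open>k\<close> to the algebra element
  \<open>k \<cdot> 1\<close>, which commutes with every \<open>a\<close>; the same trick on the other side gives the next lemma.
\<close>

lemma lact_smult:
  assumes "k \<in> carrier K" "a \<in> carrier A" "m \<in> carrier M"
  shows "a \<triangleright>\<^bsub>M\<^esub> (k \<odot>\<^bsub>M\<^esub> m) = k \<odot>\<^bsub>M\<^esub> (a \<triangleright>\<^bsub>M\<^esub> m)"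
proof -
  have "a \<triangleright>\<^bsub>M\<^esub> (k \<odot>\<^bsub>M\<^esub> m) = a \<triangleright>\<^bsub>M\<^esub> ((k \<odot>\<^bsub>A\<^esub> \<one>\<^bsub>A\<^esub>) \<triangleright>\<^bsub>M\<^esub> m)"
    using assms by (simp add: smult_lact)
  also have "\<dots> = (k \<odot>\<^bsub>A\<^esub> a) \<triangleright>\<^bsub>M\<^esub> m"
    using assms by (simp add: mult_lact[symmetric] A.smult_mult_right)
  finally show ?thesis using assms by (simp add: smult_lact)
qed

lemma smult_ract:
  assumes "k \<in> carrier K" "b \<in> carrier B" "m \<in> carrier M"
  shows "(k \<odot>\<^bsub>M\<^esub> m) \<triangleleft>\<^bsub>M\<^esub> b = k \<odot>\<^bsub>M\<^esub> (m \<triangleleft>\<^bsub>M\<^esub> b)"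
proof -
  have "(k \<odot>\<^bsub>M\<^esub> m) \<triangleleft>\<^bsub>M\<^esub> b = (m \<triangleleft>\<^bsub>M\<^esub> (k \<odot>\<^bsub>B\<^esub> \<one>\<^bsub>B\<^esub>)) \<triangleleft>\<^bsub>M\<^esub> b"
    using assms by (simp add: ract_smult)
  also have "\<dots> = m \<triangleleft>\<^bsub>M\<^esub> (k \<odot>\<^bsub>B\<^esub> b)"
    using assms by (simp add: ract_mult[symmetric] B.smult_mult_left)
  finally show ?thesis using assms by (simp add: ract_smult)
qed

lemma module_tri: "module K (tri_alg A M B)"
  by (rule moduleI_scalar) (auto simp: tri_simps A.R.is_cring A.M.a_ac M.a_ac B.M.a_ac
    A.smult_l_distr smult_l_distr B.smult_l_distr A.smult_r_distr smult_r_distr B.smult_r_distr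
    A.smult_assoc1 smult_assoc1 B.smult_assoc1)

lemma ring_tri: "ring (tri_alg A M B)"
proof (rule ringI)
  show "abelian_group (tri_alg A M B)" using module_tri by (rule module.axioms(2))
  show "monoid (tri_alg A M B)"
    by (rule monoidI) (auto simp: tri_simps A.m_assoc B.m_assoc lact_add add_ract mult_lact ract_mult
      lact_ract M.a_assoc)
qed (auto simp: tri_simps A.l_distr A.r_distr B.l_distr B.r_distr add_lact lact_add add_ract ract_add M.a_ac)

end

sublocale bimodule \<subseteq> T: assoc_algebra K "tri_alg A M B"
proof (intro assoc_algebra.intro assoc_algebra_axioms.intro module_tri ring_tri)
qed (auto simp: tri_simps smult_lact lact_smult smult_ract ract_smult smult_r_distr A.smult_mult_left
  A.smult_mult_right B.smult_mult_left B.smult_mult_right)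

context bimodule
begin

lemma tri_uminus:
  "\<lbrakk>a \<in> carrier A; m \<in> carrier M; b \<in> carrier B\<rbrakk>
    \<Longrightarrow> \<ominus>\<^bsub>tri_alg A M B\<^esub> (a, m, b) = (\<ominus>\<^bsub>A\<^esub> a, \<ominus>\<^bsub>M\<^esub> m, \<ominus>\<^bsub>B\<^esub> b)"
  by (rule T.M.minus_equality) (simp_all add: tri_simps A.M.l_neg M.l_neg B.M.l_neg)

lemma ad_act_closed: "\<lbrakk>a \<in> carrier A; b \<in> carrier B; m \<in> carrier M\<rbrakk> \<Longrightarrow> ad_act M a b m \<in> carrier M"
  by (simp add: ad_act_def)

lemma ad_act_uminus:
  "\<lbrakk>a \<in> carrier A; b \<in> carrier B; m \<in> carrier M\<rbrakk>
    \<Longrightarrow> ad_act M (\<ominus>\<^bsub>A\<^esub> a) (\<ominus>\<^bsub>B\<^esub> b) m = \<ominus>\<^bsub>M\<^esub> ad_act M a b m"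
  by (simp add: ad_act_def a_minus_def uminus_lact ract_uminus M.minus_add)

lemma ad_act_zero:
  "\<lbrakk>a \<in> carrier A; b \<in> carrier B\<rbrakk> \<Longrightarrow> ad_act M a b \<zero>\<^bsub>M\<^esub> = \<zero>\<^bsub>M\<^esub>"
  by (simp add: ad_act_def a_minus_def)

lemma zero_ad_act: "m \<in> carrier M \<Longrightarrow> ad_act M \<zero>\<^bsub>A\<^esub> \<zero>\<^bsub>B\<^esub> m = \<zero>\<^bsub>M\<^esub>"
  by (simp add: ad_act_def a_minus_def)

text \<open>
  The part of the middle entry that comes from \<open>m\<^sub>0\<close> does not depend on \<open>m\<close>; evaluating at matrices
  with \<open>m = 0\<close> or with \<open>x = 0, y = 0\<close> separates it from the commutator part.
\<close>

lemma ad_tri: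
  assumes "a \<in> carrier A" "m\<^sub>0 \<in> carrier M" "b \<in> carrier B"
    and "x \<in> carrier A" "m \<in> carrier M" "y \<in> carrier B"
  shows "ad (tri_alg A M B) (a, m\<^sub>0, b) (x, m, y) =
    (ad A a x, ad_act M a b m \<oplus>\<^bsub>M\<^esub> (m\<^sub>0 \<triangleleft>\<^bsub>M\<^esub> y \<ominus>\<^bsub>M\<^esub> x \<triangleright>\<^bsub>M\<^esub> m\<^sub>0), ad B b y)"
  using assms by (simp add: ad_def ad_act_def tri_simps tri_uminus a_minus_def M.minus_add M.a_ac)

lemma
  assumes "\<mu> \<in> compat_end K A M B \<alpha> \<beta>"
  shows compat_closed: "m \<in> carrier M \<Longrightarrow> \<mu> m \<in> carrier M"
    and compat_add: "\<lbrakk>m \<in> carrier M; m' \<in> carrier M\<rbrakk> \<Longrightarrow> \<mu> (m \<oplus>\<^bsub>M\<^esub> m') = \<mu> m \<oplus>\<^bsub>M\<^esub> \<mu> m'"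
    and compat_smult: "\<lbrakk>k \<in> carrier K; m \<in> carrier M\<rbrakk> \<Longrightarrow> \<mu> (k \<odot>\<^bsub>M\<^esub> m) = k \<odot>\<^bsub>M\<^esub> \<mu> m"
    and compat_lact: "\<lbrakk>a \<in> carrier A; m \<in> carrier M\<rbrakk>
      \<Longrightarrow> \<mu> (a \<triangleright>\<^bsub>M\<^esub> m) = \<alpha> a \<triangleright>\<^bsub>M\<^esub> m \<oplus>\<^bsub>M\<^esub> a \<triangleright>\<^bsub>M\<^esub> \<mu> m"
    and compat_ract: "\<lbrakk>b \<in> carrier B; m \<in> carrier M\<rbrakk>
      \<Longrightarrow> \<mu> (m \<triangleleft>\<^bsub>M\<^esub> b) = \<mu> m \<triangleleft>\<^bsub>M\<^esub> b \<oplus>\<^bsub>M\<^esub> m \<triangleleft>\<^bsub>M\<^esub> \<beta> b"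
  using assms by (auto simp: compat_end_def mod_hom_def)

lemma compat_endI:
  assumes "\<And>m. m \<in> carrier M \<Longrightarrow> \<mu> m \<in> carrier M"
    and "\<And>m m'. \<lbrakk>m \<in> carrier M; m' \<in> carrier M\<rbrakk> \<Longrightarrow> \<mu> (m \<oplus>\<^bsub>M\<^esub> m') = \<mu> m \<oplus>\<^bsub>M\<^esub> \<mu> m'"
    and "\<And>k m. \<lbrakk>k \<in> carrier K; m \<in> carrier M\<rbrakk> \<Longrightarrow> \<mu> (k \<odot>\<^bsub>M\<^esub> m) = k \<odot>\<^bsub>M\<^esub> \<mu> m"
    and "\<And>a m. \<lbrakk>a \<in> carrier A; m \<in> carrier M\<rbrakk>
      \<Longrightarrow> \<mu> (a \<triangleright>\<^bsub>M\<^esub> m) = \<alpha> a \<triangleright>\<^bsub>M\<^esub> m \<oplus>\<^bsub>M\<^esub> a \<triangleright>\<^bsub>M\<^esub> \<mu> m"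
    and "\<And>b m. \<lbrakk>b \<in> carrier B; m \<in> carrier M\<rbrakk>
      \<Longrightarrow> \<mu> (m \<triangleleft>\<^bsub>M\<^esub> b) = \<mu> m \<triangleleft>\<^bsub>M\<^esub> b \<oplus>\<^bsub>M\<^esub> m \<triangleleft>\<^bsub>M\<^esub> \<beta> b"
  shows "\<mu> \<in> compat_end K A M B \<alpha> \<beta>"
  using assms by (auto simp: compat_end_def mod_hom_def)

lemma compat_zero: "\<mu> \<in> compat_end K A M B \<alpha> \<beta> \<Longrightarrow> \<mu> \<zero>\<^bsub>M\<^esub> = \<zero>\<^bsub>M\<^esub>"
  using compat_smult[of \<mu> \<alpha> \<beta> "\<zero>\<^bsub>K\<^esub>" "\<zero>\<^bsub>M\<^esub>"] compat_closed[of \<mu> \<alpha> \<beta> "\<zero>\<^bsub>M\<^esub>"] by simp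

lemma compat_end_cong:
  assumes "\<mu> \<in> compat_end K A M B \<alpha> \<beta>"
    and "\<And>a. a \<in> carrier A \<Longrightarrow> \<alpha>' a = \<alpha> a" "\<And>b. b \<in> carrier B \<Longrightarrow> \<beta>' b = \<beta> b"
  shows "\<mu> \<in> compat_end K A M B \<alpha>' \<beta>'"
  using assms by (auto simp: compat_end_def)

lemma compat_end_sum:
  assumes \<mu>: "\<mu> \<in> compat_end K A M B \<alpha> \<beta>" and \<mu>': "\<mu>' \<in> compat_end K A M B \<alpha>' \<beta>'"
    and \<alpha>: "\<And>a. a \<in> carrier A \<Longrightarrow> \<alpha> a \<in> carrier A" "\<And>a. a \<in> carrier A \<Longrightarrow> \<alpha>' a \<in> carrier A"
    and \<beta>: "\<And>b. b \<in> carrier B \<Longrightarrow> \<beta> b \<in> carrier B" "\<And>b. b \<in> carrier B \<Longrightarrow> \<beta>' b \<in> carrier B"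
  shows "(\<lambda>m. \<mu> m \<oplus>\<^bsub>M\<^esub> \<mu>' m) \<in> compat_end K A M B (\<lambda>a. \<alpha> a \<oplus>\<^bsub>A\<^esub> \<alpha>' a) (\<lambda>b. \<beta> b \<oplus>\<^bsub>B\<^esub> \<beta>' b)"
  by (rule compat_endI) (simp_all add: \<alpha> \<beta> compat_closed[OF \<mu>] compat_closed[OF \<mu>']
    compat_add[OF \<mu>] compat_add[OF \<mu>'] compat_smult[OF \<mu>] compat_smult[OF \<mu>']
    compat_lact[OF \<mu>] compat_lact[OF \<mu>'] compat_ract[OF \<mu>] compat_ract[OF \<mu>']
    lact_add add_lact add_ract ract_add smult_r_distr M.a_ac)

lemma compat_end_scalar:
  assumes \<mu>: "\<mu> \<in> compat_end K A M B \<alpha> \<beta>" and k: "k \<in> carrier K"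
    and \<alpha>: "\<And>a. a \<in> carrier A \<Longrightarrow> \<alpha> a \<in> carrier A" and \<beta>: "\<And>b. b \<in> carrier B \<Longrightarrow> \<beta> b \<in> carrier B"
  shows "(\<lambda>m. k \<odot>\<^bsub>M\<^esub> \<mu> m) \<in> compat_end K A M B (\<lambda>a. k \<odot>\<^bsub>A\<^esub> \<alpha> a) (\<lambda>b. k \<odot>\<^bsub>B\<^esub> \<beta> b)"
  by (rule compat_endI) (simp_all add: k \<alpha> \<beta> compat_closed[OF \<mu>]
    compat_add[OF \<mu>] compat_smult[OF \<mu>] compat_lact[OF \<mu>] compat_ract[OF \<mu>]
    smult_lact lact_smult smult_ract ract_smult smult_r_distr smult_assoc1[symmetric] A.R.m_comm)

text \<open>
  Makes \<open>[ad a, ad_act a b; 0, ad b]\<close> an admissible triple. It is used to correct a middle entry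
  when \<open>\<alpha>\<close> and \<open>\<beta>\<close> are changed by inner derivations.
\<close>

lemma ad_act_compat:
  assumes ab: "a \<in> carrier A" "b \<in> carrier B"
  shows "ad_act M a b \<in> compat_end K A M B (ad A a) (ad B b)"
proof (rule compat_endI)
  have cancel: "\<ominus>\<^bsub>M\<^esub> x \<oplus>\<^bsub>M\<^esub> (x \<oplus>\<^bsub>M\<^esub> y) = y" "x \<oplus>\<^bsub>M\<^esub> (\<ominus>\<^bsub>M\<^esub> x \<oplus>\<^bsub>M\<^esub> y) = y"
    if "x \<in> carrier M" "y \<in> carrier M" for x y
    using that by (simp_all add: M.r_neg1 M.r_neg2)
  fix m assume m: "m \<in> carrier M"
  show "ad_act M a b (x \<triangleright>\<^bsub>M\<^esub> m) = ad A a x \<triangleright>\<^bsub>M\<^esub> m \<oplus>\<^bsub>M\<^esub> x \<triangleright>\<^bsub>M\<^esub> ad_act M a b m"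
    if x: "x \<in> carrier A" for x
    using ab m x
    by (simp add: ad_act_def ad_def a_minus_def add_lact lact_add uminus_lact lact_uminus mult_lact
        lact_ract M.a_assoc cancel)
  show "ad_act M a b (m \<triangleleft>\<^bsub>M\<^esub> y) = ad_act M a b m \<triangleleft>\<^bsub>M\<^esub> y \<oplus>\<^bsub>M\<^esub> m \<triangleleft>\<^bsub>M\<^esub> ad B b y"
    if y: "y \<in> carrier B" for y
    using ab m y
    by (simp add: ad_act_def ad_def a_minus_def add_ract ract_add uminus_ract ract_uminus ract_mult
        lact_ract M.a_assoc cancel)
qed (use ab in \<open>simp_all add: ad_act_def a_minus_def lact_add add_ract lact_smult smult_ract
  smult_r_distr smult_r_minus M.minus_add M.a_ac\<close>)

lemma diag_der_apply:
  "\<lbrakk>a \<in> carrier A; m \<in> carrier M; b \<in> carrier B\<rbrakk>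
    \<Longrightarrow> diag_der A M B \<alpha> \<mu> \<beta> (a, m, b) = (\<alpha> a, \<mu> m, \<beta> b)"
  by (simp add: diag_der_def tri_simps)

lemma diag_der_in_Der:
  assumes \<alpha>: "\<alpha> \<in> carrier (Der K A)" and \<beta>: "\<beta> \<in> carrier (Der K B)"
    and \<mu>: "\<mu> \<in> compat_end K A M B \<alpha> \<beta>"
  shows "diag_der A M B \<alpha> \<mu> \<beta> \<in> carrier (Der K (tri_alg A M B))"
  unfolding diag_der_def
  by (rule T.DerI) (auto simp: tri_simps A.Der_closed[OF \<alpha>] A.Der_add[OF \<alpha>] A.Der_smult[OF \<alpha>]
    A.Der_mult[OF \<alpha>] B.Der_closed[OF \<beta>] B.Der_add[OF \<beta>] B.Der_smult[OF \<beta>] B.Der_mult[OF \<beta>]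
    compat_closed[OF \<mu>] compat_add[OF \<mu>] compat_smult[OF \<mu>] compat_lact[OF \<mu>] compat_ract[OF \<mu>]
    M.a_ac)

end

section \<open>Classes of diagonal derivations\<close>

abbreviation diag_class ::
    "'k ring \<Rightarrow> ('k, 'a) module \<Rightarrow> ('k, 'a, 'b, 'm) bimodule \<Rightarrow> ('k, 'b) module \<Rightarrow>
     ('a \<Rightarrow> 'a) \<Rightarrow> ('m \<Rightarrow> 'm) \<Rightarrow> ('b \<Rightarrow> 'b) \<Rightarrow> ('a \<times> 'm \<times> 'b \<Rightarrow> 'a \<times> 'm \<times> 'b) set" where
  "diag_class K A M B \<alpha> \<mu> \<beta> \<equiv> der_class K (tri_alg A M B) (diag_der A M B \<alpha> \<mu> \<beta>)"

lemma diag_der_data_iff: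
  "(\<alpha>, \<mu>, \<beta>) \<in> diag_der_data K A M B \<longleftrightarrow>
    \<alpha> \<in> carrier (Der K A) \<and> \<beta> \<in> carrier (Der K B) \<and> \<mu> \<in> compat_end K A M B \<alpha> \<beta>"
  by (simp add: diag_der_data_def)

lemma (in assoc_algebra) mem_der_class_iff:
  assumes "D \<in> carrier (Der K A)" "E \<in> carrier (Der K A)"
  shows "D \<in> der_class K A E \<longleftrightarrow> der_class K A D = der_class K A E"
proof -
  interpret D: module K "Der K A" by (rule module_Der)
  have "D \<in> der_class K A E \<longleftrightarrow> (\<exists>h\<in>Inn A. D = h \<oplus>\<^bsub>Der K A\<^esub> E)"
    by (auto simp: a_r_coset_def')
  then show ?thesis
    by (simp only: D.quot_eq_iff[OF submodule_Inn assms])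
qed

context bimodule
begin

lemma diag_der_cong:
  assumes "\<And>a. a \<in> carrier A \<Longrightarrow> \<alpha> a = \<alpha>' a" "\<And>m. m \<in> carrier M \<Longrightarrow> \<mu> m = \<mu>' m"
    "\<And>b. b \<in> carrier B \<Longrightarrow> \<beta> b = \<beta>' b"
  shows "diag_der A M B \<alpha> \<mu> \<beta> = diag_der A M B \<alpha>' \<mu>' \<beta>'"
  unfolding diag_der_def using assms by (intro restrict_ext) (auto simp: tri_simps)

text \<open>
  Two diagonal derivations are cohomologous only through a diagonal matrix: the identity for the
  middle entry at \<open>x = 0\<close>, \<open>y = 0\<close> no longer contains the off-diagonal entry \<open>m\<^sub>0\<close> of the inner
  element.
\<close>

lemma diag_class_eq_iff:
  assumes d: "(\<alpha>, \<mu>, \<beta>) \<in> diag_der_data K A M B" and d': "(\<alpha>', \<mu>', \<beta>') \<in> diag_der_data K A M B"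
  shows "diag_class K A M B \<alpha> \<mu> \<beta> = diag_class K A M B \<alpha>' \<mu>' \<beta>' \<longleftrightarrow>
    (\<exists>a\<in>carrier A. \<exists>b\<in>carrier B.
      (\<forall>x\<in>carrier A. \<alpha> x = ad A a x \<oplus>\<^bsub>A\<^esub> \<alpha>' x) \<and>
      (\<forall>m\<in>carrier M. \<mu> m = ad_act M a b m \<oplus>\<^bsub>M\<^esub> \<mu>' m) \<and>
      (\<forall>y\<in>carrier B. \<beta> y = ad B b y \<oplus>\<^bsub>B\<^esub> \<beta>' y))" (is "?L \<longleftrightarrow> ?R")
proof -
  let ?T = "tri_alg A M B" and ?D = "diag_der A M B \<alpha> \<mu> \<beta>" and ?D' = "diag_der A M B \<alpha>' \<mu>' \<beta>'"
  have \<mu>: "\<mu> \<in> compat_end K A M B \<alpha> \<beta>" and \<mu>': "\<mu>' \<in> compat_end K A M B \<alpha>' \<beta>'"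
    using d d' by (simp_all add: diag_der_data_iff)
  have Der: "?D \<in> carrier (Der K ?T)" "?D' \<in> carrier (Der K ?T)"
    using d d' by (simp_all add: diag_der_data_iff diag_der_in_Der)
  have L: "?L \<longleftrightarrow> (\<exists>u\<in>carrier ?T. \<forall>t\<in>carrier ?T. ?D t = ad ?T u t \<oplus>\<^bsub>?T\<^esub> ?D' t)"
    by (rule T.der_class_eq_iff[OF Der])
  have A0: "\<alpha>' \<zero>\<^bsub>A\<^esub> = \<zero>\<^bsub>A\<^esub>" "\<alpha> \<zero>\<^bsub>A\<^esub> = \<zero>\<^bsub>A\<^esub>" "\<beta>' \<zero>\<^bsub>B\<^esub> = \<zero>\<^bsub>B\<^esub>" "\<beta> \<zero>\<^bsub>B\<^esub> = \<zero>\<^bsub>B\<^esub>"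
    using d d' by (simp_all add: diag_der_data_iff A.Der_zero B.Der_zero)
  show ?thesis
  proof
    assume ?L
    then obtain a m\<^sub>0 b where u: "a \<in> carrier A" "m\<^sub>0 \<in> carrier M" "b \<in> carrier B"
      and eq: "\<And>x m y. \<lbrakk>x \<in> carrier A; m \<in> carrier M; y \<in> carrier B\<rbrakk>
        \<Longrightarrow> ?D (x, m, y) = ad ?T (a, m\<^sub>0, b) (x, m, y) \<oplus>\<^bsub>?T\<^esub> ?D' (x, m, y)"
      unfolding L by (auto simp: tri_simps)
    have eq': "\<alpha> x = ad A a x \<oplus>\<^bsub>A\<^esub> \<alpha>' x"
      "\<mu> m = ad_act M a b m \<oplus>\<^bsub>M\<^esub> (m\<^sub>0 \<triangleleft>\<^bsub>M\<^esub> y \<ominus>\<^bsub>M\<^esub> x \<triangleright>\<^bsub>M\<^esub> m\<^sub>0) \<oplus>\<^bsub>M\<^esub> \<mu>' m"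
      "\<beta> y = ad B b y \<oplus>\<^bsub>B\<^esub> \<beta>' y"
      if "x \<in> carrier A" "m \<in> carrier M" "y \<in> carrier B" for x m y
      using eq[OF that] that u by (simp_all add: diag_der_apply ad_tri tri_simps)
    have "\<mu> m = ad_act M a b m \<oplus>\<^bsub>M\<^esub> \<mu>' m" if "m \<in> carrier M" for m
      using eq'(2)[of "\<zero>\<^bsub>A\<^esub>" m "\<zero>\<^bsub>B\<^esub>"] that u by (simp add: ad_act_closed a_minus_def)
    then show ?R using u eq'(1)[OF _ M.zero_closed B.zero_closed] eq'(3)[OF A.zero_closed M.zero_closed]
      by blast
  next
    assume ?R
    then obtain a b where ab: "a \<in> carrier A" "b \<in> carrier B"
      and eq: "\<And>x. x \<in> carrier A \<Longrightarrow> \<alpha> x = ad A a x \<oplus>\<^bsub>A\<^esub> \<alpha>' x"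
        "\<And>m. m \<in> carrier M \<Longrightarrow> \<mu> m = ad_act M a b m \<oplus>\<^bsub>M\<^esub> \<mu>' m"
        "\<And>y. y \<in> carrier B \<Longrightarrow> \<beta> y = ad B b y \<oplus>\<^bsub>B\<^esub> \<beta>' y" by blast
    have "?D t = ad ?T (a, \<zero>\<^bsub>M\<^esub>, b) t \<oplus>\<^bsub>?T\<^esub> ?D' t" if "t \<in> carrier ?T" for t
      using that ab eq by (auto simp: diag_der_apply ad_tri tri_simps ad_act_closed a_minus_def)
    moreover have "(a, \<zero>\<^bsub>M\<^esub>, b) \<in> carrier ?T" using ab by (simp add: tri_simps)
    ultimately show ?L unfolding L by blast
  qed
qed

lemma diag_class_in_HH1:
  "(\<alpha>, \<mu>, \<beta>) \<in> diag_der_data K A M B \<Longrightarrow> diag_class K A M B \<alpha> \<mu> \<beta> \<in> carrier (HH1 K (tri_alg A M B))"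
  by (auto simp: T.HH1_carrier diag_der_data_iff diag_der_in_Der)

text \<open>
  If the idempotent \<open>e = diag(1, 0)\<close> is killed, then \<open>D (e t) = e (D t)\<close> and \<open>D (t e) = (D t) e\<close>, so the
  derivation preserves the Peirce decomposition of the triangular algebra and is diagonal.
\<close>

lemma der_idempotent_zero:
  assumes D: "D \<in> carrier (Der K (tri_alg A M B))"
    and e: "D (\<one>\<^bsub>A\<^esub>, \<zero>\<^bsub>M\<^esub>, \<zero>\<^bsub>B\<^esub>) = (\<zero>\<^bsub>A\<^esub>, \<zero>\<^bsub>M\<^esub>, \<zero>\<^bsub>B\<^esub>)"
  shows "\<exists>\<alpha> \<mu> \<beta>. (\<alpha>, \<mu>, \<beta>) \<in> diag_der_data K A M B \<and> D = diag_der A M B \<alpha> \<mu> \<beta>"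
proof -
  let ?T = "tri_alg A M B"
  define \<alpha> where "\<alpha> = (\<lambda>a\<in>carrier A. fst (D (a, \<zero>\<^bsub>M\<^esub>, \<zero>\<^bsub>B\<^esub>)))"
  define \<mu> where "\<mu> = (\<lambda>m. fst (snd (D (\<zero>\<^bsub>A\<^esub>, m, \<zero>\<^bsub>B\<^esub>))))"
  define \<beta> where "\<beta> = (\<lambda>b\<in>carrier B. snd (snd (D (\<zero>\<^bsub>A\<^esub>, \<zero>\<^bsub>M\<^esub>, b))))"
  have cl: "fst (D (a, m, b)) \<in> carrier A" "fst (snd (D (a, m, b))) \<in> carrier M"
    "snd (snd (D (a, m, b))) \<in> carrier B"
    if "a \<in> carrier A" "m \<in> carrier M" "b \<in> carrier B" for a m b
    using T.Der_closed[OF D, of "(a, m, b)"] that by (auto simp: tri_simps)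
  have \<alpha>c: "\<alpha> a \<in> carrier A" if "a \<in> carrier A" for a using that cl by (simp add: \<alpha>_def)
  have \<mu>c: "\<mu> m \<in> carrier M" if "m \<in> carrier M" for m using that cl by (simp add: \<mu>_def)
  have \<beta>c: "\<beta> b \<in> carrier B" if "b \<in> carrier B" for b using that cl by (simp add: \<beta>_def)
  have left: "D ((\<one>\<^bsub>A\<^esub>, \<zero>\<^bsub>M\<^esub>, \<zero>\<^bsub>B\<^esub>) \<otimes>\<^bsub>?T\<^esub> (a, m, b)) = (fst (D (a, m, b)), fst (snd (D (a, m, b))), \<zero>\<^bsub>B\<^esub>)"
    and right: "D ((a, m, b) \<otimes>\<^bsub>?T\<^esub> (\<one>\<^bsub>A\<^esub>, \<zero>\<^bsub>M\<^esub>, \<zero>\<^bsub>B\<^esub>)) = (fst (D (a, m, b)), \<zero>\<^bsub>M\<^esub>, \<zero>\<^bsub>B\<^esub>)"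
    if abm: "a \<in> carrier A" "m \<in> carrier M" "b \<in> carrier B" for a m b
  proof -
    obtain x y z where xyz: "D (a, m, b) = (x, y, z)" by (cases "D (a, m, b)")
    with cl[OF abm] have "x \<in> carrier A" "y \<in> carrier M" "z \<in> carrier B" by simp_all
    with abm e xyz show "D ((\<one>\<^bsub>A\<^esub>, \<zero>\<^bsub>M\<^esub>, \<zero>\<^bsub>B\<^esub>) \<otimes>\<^bsub>?T\<^esub> (a, m, b)) =
        (fst (D (a, m, b)), fst (snd (D (a, m, b))), \<zero>\<^bsub>B\<^esub>)"
      "D ((a, m, b) \<otimes>\<^bsub>?T\<^esub> (\<one>\<^bsub>A\<^esub>, \<zero>\<^bsub>M\<^esub>, \<zero>\<^bsub>B\<^esub>)) = (fst (D (a, m, b)), \<zero>\<^bsub>M\<^esub>, \<zero>\<^bsub>B\<^esub>)"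
      by (subst T.Der_mult[OF D]; simp add: tri_simps)+
  qed
  have D0: "D (\<zero>\<^bsub>A\<^esub>, \<zero>\<^bsub>M\<^esub>, \<zero>\<^bsub>B\<^esub>) = (\<zero>\<^bsub>A\<^esub>, \<zero>\<^bsub>M\<^esub>, \<zero>\<^bsub>B\<^esub>)"
    using T.Der_zero[OF D] by (simp add: tri_simps)
  have D1: "D (a, \<zero>\<^bsub>M\<^esub>, \<zero>\<^bsub>B\<^esub>) = (\<alpha> a, \<zero>\<^bsub>M\<^esub>, \<zero>\<^bsub>B\<^esub>)" if "a \<in> carrier A" for a
    using right[OF that M.zero_closed B.zero_closed] that by (simp add: tri_simps \<alpha>_def)
  have D2: "D (\<zero>\<^bsub>A\<^esub>, m, \<zero>\<^bsub>B\<^esub>) = (\<zero>\<^bsub>A\<^esub>, \<mu> m, \<zero>\<^bsub>B\<^esub>)" if "m \<in> carrier M" for m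
  proof -
    have "fst (D (\<zero>\<^bsub>A\<^esub>, m, \<zero>\<^bsub>B\<^esub>)) = \<zero>\<^bsub>A\<^esub>"
      using right[OF A.zero_closed that B.zero_closed] that D0 by (simp add: tri_simps)
    then show ?thesis
      using left[OF A.zero_closed that B.zero_closed] that by (simp add: tri_simps \<mu>_def)
  qed
  have D3: "D (\<zero>\<^bsub>A\<^esub>, \<zero>\<^bsub>M\<^esub>, b) = (\<zero>\<^bsub>A\<^esub>, \<zero>\<^bsub>M\<^esub>, \<beta> b)" if "b \<in> carrier B" for b
    using left[OF A.zero_closed M.zero_closed that] that D0
    by (cases "D (\<zero>\<^bsub>A\<^esub>, \<zero>\<^bsub>M\<^esub>, b)") (simp add: tri_simps \<beta>_def)
  have Deq: "D (a, m, b) = (\<alpha> a, \<mu> m, \<beta> b)"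
    if abm: "a \<in> carrier A" "m \<in> carrier M" "b \<in> carrier B" for a m b
  proof -
    have "D (a, m, b) = D ((a, \<zero>\<^bsub>M\<^esub>, \<zero>\<^bsub>B\<^esub>) \<oplus>\<^bsub>?T\<^esub> (\<zero>\<^bsub>A\<^esub>, m, b))"
      using abm by (simp add: tri_simps)
    also have "\<dots> = D (a, \<zero>\<^bsub>M\<^esub>, \<zero>\<^bsub>B\<^esub>) \<oplus>\<^bsub>?T\<^esub> D (\<zero>\<^bsub>A\<^esub>, m, b)"
      using abm by (intro T.Der_add[OF D]) (simp_all add: tri_simps)
    also have "D (\<zero>\<^bsub>A\<^esub>, m, b) = D ((\<zero>\<^bsub>A\<^esub>, m, \<zero>\<^bsub>B\<^esub>) \<oplus>\<^bsub>?T\<^esub> (\<zero>\<^bsub>A\<^esub>, \<zero>\<^bsub>M\<^esub>, b))"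
      using abm by (simp add: tri_simps)
    also have "\<dots> = D (\<zero>\<^bsub>A\<^esub>, m, \<zero>\<^bsub>B\<^esub>) \<oplus>\<^bsub>?T\<^esub> D (\<zero>\<^bsub>A\<^esub>, \<zero>\<^bsub>M\<^esub>, b)"
      using abm by (intro T.Der_add[OF D]) (simp_all add: tri_simps)
    finally show ?thesis
      using abm by (simp add: D1 D2 D3 tri_simps \<alpha>c \<mu>c \<beta>c)
  qed
  have add: "(\<alpha> (a \<oplus>\<^bsub>A\<^esub> a'), \<mu> (m \<oplus>\<^bsub>M\<^esub> m'), \<beta> (b \<oplus>\<^bsub>B\<^esub> b')) = (\<alpha> a \<oplus>\<^bsub>A\<^esub> \<alpha> a', \<mu> m \<oplus>\<^bsub>M\<^esub> \<mu> m', \<beta> b \<oplus>\<^bsub>B\<^esub> \<beta> b')"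
    and mult: "(\<alpha> (a \<otimes>\<^bsub>A\<^esub> a'), \<mu> (a \<triangleright>\<^bsub>M\<^esub> m' \<oplus>\<^bsub>M\<^esub> m \<triangleleft>\<^bsub>M\<^esub> b'), \<beta> (b \<otimes>\<^bsub>B\<^esub> b')) =
      (\<alpha> a \<otimes>\<^bsub>A\<^esub> a' \<oplus>\<^bsub>A\<^esub> a \<otimes>\<^bsub>A\<^esub> \<alpha> a',
       (\<alpha> a \<triangleright>\<^bsub>M\<^esub> m' \<oplus>\<^bsub>M\<^esub> \<mu> m \<triangleleft>\<^bsub>M\<^esub> b') \<oplus>\<^bsub>M\<^esub> (a \<triangleright>\<^bsub>M\<^esub> \<mu> m' \<oplus>\<^bsub>M\<^esub> m \<triangleleft>\<^bsub>M\<^esub> \<beta> b'),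
       \<beta> b \<otimes>\<^bsub>B\<^esub> b' \<oplus>\<^bsub>B\<^esub> b \<otimes>\<^bsub>B\<^esub> \<beta> b')"
    if "a \<in> carrier A" "m \<in> carrier M" "b \<in> carrier B" "a' \<in> carrier A" "m' \<in> carrier M" "b' \<in> carrier B"
    for a a' m m' b b'
    using T.Der_add[OF D, of "(a, m, b)" "(a', m', b')"] T.Der_mult[OF D, of "(a, m, b)" "(a', m', b')"] that
    by (simp_all add: tri_simps Deq)
  have smult: "(\<alpha> (k \<odot>\<^bsub>A\<^esub> a), \<mu> (k \<odot>\<^bsub>M\<^esub> m), \<beta> (k \<odot>\<^bsub>B\<^esub> b)) = (k \<odot>\<^bsub>A\<^esub> \<alpha> a, k \<odot>\<^bsub>M\<^esub> \<mu> m, k \<odot>\<^bsub>B\<^esub> \<beta> b)"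
    if "a \<in> carrier A" "m \<in> carrier M" "b \<in> carrier B" "k \<in> carrier K" for k a m b
    using T.Der_smult[OF D, of k "(a, m, b)"] that by (simp add: tri_simps Deq)
  note zc = A.zero_closed M.zero_closed B.zero_closed
  have z: "\<alpha> \<zero>\<^bsub>A\<^esub> = \<zero>\<^bsub>A\<^esub>" "\<mu> \<zero>\<^bsub>M\<^esub> = \<zero>\<^bsub>M\<^esub>" "\<beta> \<zero>\<^bsub>B\<^esub> = \<zero>\<^bsub>B\<^esub>"
    using Deq[OF zc] D0 by simp_all
  have "restrict \<alpha> (carrier A) \<in> carrier (Der K A)"
    by (rule A.DerI) (use add[OF _ zc(2,3) _ zc(2,3)] mult[OF _ zc(2,3) _ zc(2,3)] smult[OF _ zc(2,3)] \<alpha>c in auto)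
  then have 1: "\<alpha> \<in> carrier (Der K A)" by (simp add: \<alpha>_def)
  have "restrict \<beta> (carrier B) \<in> carrier (Der K B)"
    by (rule B.DerI) (use add[OF zc(1,2) _ zc(1,2)] mult[OF zc(1,2) _ zc(1,2)] smult[OF zc(1,2)] \<beta>c in auto)
  then have 2: "\<beta> \<in> carrier (Der K B)" by (simp add: \<beta>_def)
  have 3: "\<mu> \<in> compat_end K A M B \<alpha> \<beta>"
  proof (rule compat_endI)
    show "\<mu> (a \<triangleright>\<^bsub>M\<^esub> m) = \<alpha> a \<triangleright>\<^bsub>M\<^esub> m \<oplus>\<^bsub>M\<^esub> a \<triangleright>\<^bsub>M\<^esub> \<mu> m" if "a \<in> carrier A" "m \<in> carrier M" for a m
      using mult[OF that(1) zc(2,3) zc(1) that(2) zc(3)] that by (simp add: z \<alpha>c \<mu>c)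
    show "\<mu> (m \<triangleleft>\<^bsub>M\<^esub> b) = \<mu> m \<triangleleft>\<^bsub>M\<^esub> b \<oplus>\<^bsub>M\<^esub> m \<triangleleft>\<^bsub>M\<^esub> \<beta> b" if "b \<in> carrier B" "m \<in> carrier M" for b m
      using mult[OF zc(1) that(2) zc(3) zc(1,2) that(1)] that by (simp add: z \<beta>c \<mu>c)
  qed (use add[OF zc(1) _ zc(3) zc(1) _ zc(3)] smult[OF zc(1) _ zc(3)] \<mu>c in auto)
  have "D = diag_der A M B \<alpha> \<mu> \<beta>"
    by (rule extensionalityI[OF T.Der_extensional[OF D]])
      (auto simp: diag_der_def tri_simps Deq)
  with 1 2 3 show ?thesis by (auto simp: diag_der_data_iff)
qed

text \<open>
  For any derivation, \<open>D e = D (e e)\<close> forces the diagonal entries of \<open>D e\<close> to vanish. Adding the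
  inner derivation of the remaining off-diagonal entry makes \<open>e\<close> a constant, and the previous
  lemma applies.
\<close>

lemma HH1_cases:
  assumes "C \<in> carrier (HH1 K (tri_alg A M B))"
  obtains \<alpha> \<mu> \<beta> where "(\<alpha>, \<mu>, \<beta>) \<in> diag_der_data K A M B" "C = diag_class K A M B \<alpha> \<mu> \<beta>"
proof -
  let ?T = "tri_alg A M B" and ?e = "(\<one>\<^bsub>A\<^esub>, \<zero>\<^bsub>M\<^esub>, \<zero>\<^bsub>B\<^esub>)"
  obtain D where D: "D \<in> carrier (Der K ?T)" and C: "C = der_class K ?T D"
    using assms by (auto simp: T.HH1_carrier)
  have e: "?e \<in> carrier ?T" by (simp add: tri_simps)
  obtain p m q where pmq: "D ?e = (p, m, q)" by (cases "D ?e")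
  then have cl: "p \<in> carrier A" "m \<in> carrier M" "q \<in> carrier B"
    using T.Der_closed[OF D e] by (simp_all add: tri_simps)
  have "D (?e \<otimes>\<^bsub>?T\<^esub> ?e) = D ?e \<otimes>\<^bsub>?T\<^esub> ?e \<oplus>\<^bsub>?T\<^esub> ?e \<otimes>\<^bsub>?T\<^esub> D ?e"
    using T.Der_mult[OF D e e] .
  then have "p = p \<oplus>\<^bsub>A\<^esub> p" "q = \<zero>\<^bsub>B\<^esub>"
    using cl by (simp_all add: tri_simps pmq)
  then have De: "D ?e = (\<zero>\<^bsub>A\<^esub>, m, \<zero>\<^bsub>B\<^esub>)" using cl pmq by simp
  \<comment> \<open>Since \<open>ad (0, m, 0) e = (0, - m, 0)\<close>, this addition cancels \<open>D e\<close>.\<close>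
  define E where "E = restrict (ad ?T (\<zero>\<^bsub>A\<^esub>, m, \<zero>\<^bsub>B\<^esub>)) (carrier ?T) \<oplus>\<^bsub>Der K ?T\<^esub> D"
  have u: "(\<zero>\<^bsub>A\<^esub>, m, \<zero>\<^bsub>B\<^esub>) \<in> carrier ?T" using cl by (simp add: tri_simps)
  interpret Der: module K "Der K ?T" by (rule T.module_Der)
  have E: "E \<in> carrier (Der K ?T)"
    unfolding E_def using T.ad_in_Der[OF u] D by (rule Der.M.a_closed)
  have Et: "E t = ad ?T (\<zero>\<^bsub>A\<^esub>, m, \<zero>\<^bsub>B\<^esub>) t \<oplus>\<^bsub>?T\<^esub> D t" if "t \<in> carrier ?T" for t
    using that by (simp add: E_def T.Der_ops)
  have "E ?e = (\<zero>\<^bsub>A\<^esub>, \<zero>\<^bsub>M\<^esub>, \<zero>\<^bsub>B\<^esub>)"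
    using cl by (simp add: Et[OF e] De ad_tri tri_simps A.ad_zero B.ad_zero zero_ad_act a_minus_def M.l_neg)
  from der_idempotent_zero[OF E this] obtain \<alpha> \<mu> \<beta>
    where d: "(\<alpha>, \<mu>, \<beta>) \<in> diag_der_data K A M B" and "E = diag_der A M B \<alpha> \<mu> \<beta>" by blast
  moreover have "der_class K ?T E = C"
    unfolding C T.der_class_eq_iff[OF E D] using u Et by blast
  ultimately show ?thesis using that by blast
qed

lemma diag_data_zero:
  "(\<zero>\<^bsub>Der K A\<^esub>, \<lambda>m. \<zero>\<^bsub>M\<^esub>, \<zero>\<^bsub>Der K B\<^esub>) \<in> diag_der_data K A M B"
proof -
  interpret DA: module K "Der K A" by (rule A.module_Der)
  interpret DB: module K "Der K B" by (rule B.module_Der)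
  have "(\<lambda>m. \<zero>\<^bsub>M\<^esub>) \<in> compat_end K A M B \<zero>\<^bsub>Der K A\<^esub> \<zero>\<^bsub>Der K B\<^esub>"
    by (rule compat_endI) (simp_all add: A.Der_ops B.Der_ops)
  then show ?thesis
    unfolding diag_der_data_iff by (intro conjI DA.M.zero_closed DB.M.zero_closed)
qed

lemma HH1_zero_diag:
  "\<zero>\<^bsub>HH1 K (tri_alg A M B)\<^esub> = diag_class K A M B \<zero>\<^bsub>Der K A\<^esub> (\<lambda>m. \<zero>\<^bsub>M\<^esub>) \<zero>\<^bsub>Der K B\<^esub>"
proof -
  have "\<zero>\<^bsub>Der K (tri_alg A M B)\<^esub> = diag_der A M B \<zero>\<^bsub>Der K A\<^esub> (\<lambda>m. \<zero>\<^bsub>M\<^esub>) \<zero>\<^bsub>Der K B\<^esub>"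
    unfolding T.Der_ops diag_der_def by (intro restrict_ext) (auto simp: tri_simps A.Der_ops B.Der_ops)
  then show ?thesis by (simp add: T.HH1_zero)
qed

lemma
  assumes d: "(\<alpha>, \<mu>, \<beta>) \<in> diag_der_data K A M B" and d': "(\<alpha>', \<mu>', \<beta>') \<in> diag_der_data K A M B"
  shows diag_data_add:
      "(\<alpha> \<oplus>\<^bsub>Der K A\<^esub> \<alpha>', \<lambda>m. \<mu> m \<oplus>\<^bsub>M\<^esub> \<mu>' m, \<beta> \<oplus>\<^bsub>Der K B\<^esub> \<beta>') \<in> diag_der_data K A M B"
    and diag_class_add:
      "diag_class K A M B \<alpha> \<mu> \<beta> \<oplus>\<^bsub>HH1 K (tri_alg A M B)\<^esub> diag_class K A M B \<alpha>' \<mu>' \<beta>' =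
       diag_class K A M B (\<alpha> \<oplus>\<^bsub>Der K A\<^esub> \<alpha>') (\<lambda>m. \<mu> m \<oplus>\<^bsub>M\<^esub> \<mu>' m) (\<beta> \<oplus>\<^bsub>Der K B\<^esub> \<beta>')"
proof -
  interpret DA: module K "Der K A" by (rule A.module_Der)
  interpret DB: module K "Der K B" by (rule B.module_Der)
  have Der: "\<alpha> \<in> carrier (Der K A)" "\<alpha>' \<in> carrier (Der K A)" "\<beta> \<in> carrier (Der K B)" "\<beta>' \<in> carrier (Der K B)"
    and \<mu>: "\<mu> \<in> compat_end K A M B \<alpha> \<beta>" "\<mu>' \<in> compat_end K A M B \<alpha>' \<beta>'"
    using d d' by (simp_all add: diag_der_data_iff)
  have "(\<lambda>m. \<mu> m \<oplus>\<^bsub>M\<^esub> \<mu>' m) \<in> compat_end K A M B (\<alpha> \<oplus>\<^bsub>Der K A\<^esub> \<alpha>') (\<beta> \<oplus>\<^bsub>Der K B\<^esub> \<beta>')"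
    by (rule compat_end_cong[OF compat_end_sum[OF \<mu>]])
      (simp_all add: Der A.Der_closed B.Der_closed A.Der_ops B.Der_ops)
  then show "(\<alpha> \<oplus>\<^bsub>Der K A\<^esub> \<alpha>', \<lambda>m. \<mu> m \<oplus>\<^bsub>M\<^esub> \<mu>' m, \<beta> \<oplus>\<^bsub>Der K B\<^esub> \<beta>') \<in> diag_der_data K A M B"
    unfolding diag_der_data_iff using Der by (intro conjI DA.M.a_closed DB.M.a_closed)
  have "diag_der A M B \<alpha> \<mu> \<beta> \<oplus>\<^bsub>Der K (tri_alg A M B)\<^esub> diag_der A M B \<alpha>' \<mu>' \<beta>' =
      diag_der A M B (\<alpha> \<oplus>\<^bsub>Der K A\<^esub> \<alpha>') (\<lambda>m. \<mu> m \<oplus>\<^bsub>M\<^esub> \<mu>' m) (\<beta> \<oplus>\<^bsub>Der K B\<^esub> \<beta>')"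
    unfolding T.Der_ops diag_der_def by (intro restrict_ext) (auto simp: tri_simps A.Der_ops B.Der_ops)
  then show "diag_class K A M B \<alpha> \<mu> \<beta> \<oplus>\<^bsub>HH1 K (tri_alg A M B)\<^esub> diag_class K A M B \<alpha>' \<mu>' \<beta>' =
       diag_class K A M B (\<alpha> \<oplus>\<^bsub>Der K A\<^esub> \<alpha>') (\<lambda>m. \<mu> m \<oplus>\<^bsub>M\<^esub> \<mu>' m) (\<beta> \<oplus>\<^bsub>Der K B\<^esub> \<beta>')"
    using d d' by (simp add: T.HH1_add diag_der_in_Der diag_der_data_iff)
qed

lemma
  assumes k: "k \<in> carrier K" and d: "(\<alpha>, \<mu>, \<beta>) \<in> diag_der_data K A M B"
  shows diag_data_smult:
      "(k \<odot>\<^bsub>Der K A\<^esub> \<alpha>, \<lambda>m. k \<odot>\<^bsub>M\<^esub> \<mu> m, k \<odot>\<^bsub>Der K B\<^esub> \<beta>) \<in> diag_der_data K A M B"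
    and diag_class_smult:
      "k \<odot>\<^bsub>HH1 K (tri_alg A M B)\<^esub> diag_class K A M B \<alpha> \<mu> \<beta> =
       diag_class K A M B (k \<odot>\<^bsub>Der K A\<^esub> \<alpha>) (\<lambda>m. k \<odot>\<^bsub>M\<^esub> \<mu> m) (k \<odot>\<^bsub>Der K B\<^esub> \<beta>)"
proof -
  interpret DA: module K "Der K A" by (rule A.module_Der)
  interpret DB: module K "Der K B" by (rule B.module_Der)
  have Der: "\<alpha> \<in> carrier (Der K A)" "\<beta> \<in> carrier (Der K B)" and \<mu>: "\<mu> \<in> compat_end K A M B \<alpha> \<beta>"
    using d by (simp_all add: diag_der_data_iff)
  have "(\<lambda>m. k \<odot>\<^bsub>M\<^esub> \<mu> m) \<in> compat_end K A M B (k \<odot>\<^bsub>Der K A\<^esub> \<alpha>) (k \<odot>\<^bsub>Der K B\<^esub> \<beta>)"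
    by (rule compat_end_cong[OF compat_end_scalar[OF \<mu> k]])
      (simp_all add: Der A.Der_closed B.Der_closed A.Der_ops B.Der_ops)
  then show "(k \<odot>\<^bsub>Der K A\<^esub> \<alpha>, \<lambda>m. k \<odot>\<^bsub>M\<^esub> \<mu> m, k \<odot>\<^bsub>Der K B\<^esub> \<beta>) \<in> diag_der_data K A M B"
    unfolding diag_der_data_iff using Der k by (intro conjI DA.smult_closed DB.smult_closed)
  have "k \<odot>\<^bsub>Der K (tri_alg A M B)\<^esub> diag_der A M B \<alpha> \<mu> \<beta> =
      diag_der A M B (k \<odot>\<^bsub>Der K A\<^esub> \<alpha>) (\<lambda>m. k \<odot>\<^bsub>M\<^esub> \<mu> m) (k \<odot>\<^bsub>Der K B\<^esub> \<beta>)"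
    unfolding T.Der_ops diag_der_def by (intro restrict_ext) (auto simp: tri_simps A.Der_ops B.Der_ops)
  then show "k \<odot>\<^bsub>HH1 K (tri_alg A M B)\<^esub> diag_class K A M B \<alpha> \<mu> \<beta> =
       diag_class K A M B (k \<odot>\<^bsub>Der K A\<^esub> \<alpha>) (\<lambda>m. k \<odot>\<^bsub>M\<^esub> \<mu> m) (k \<odot>\<^bsub>Der K B\<^esub> \<beta>)"
    using k d by (simp add: T.HH1_smult diag_der_in_Der diag_der_data_iff)
qed

text \<open>
  Central means having zero commutators; the commutator with \<open>diag(0, 1)\<close> shows that the
  off-diagonal entry vanishes.
\<close>

lemma center_iff:
  "(a, m, b) \<in> carrier (alg_center (tri_alg A M B)) \<longleftrightarrow>
    a \<in> carrier A \<and> b \<in> carrier B \<and> m = \<zero>\<^bsub>M\<^esub> \<and> (\<forall>x\<in>carrier A. ad A a x = \<zero>\<^bsub>A\<^esub>) \<and>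
    (\<forall>x\<in>carrier M. ad_act M a b x = \<zero>\<^bsub>M\<^esub>) \<and> (\<forall>y\<in>carrier B. ad B b y = \<zero>\<^bsub>B\<^esub>)" (is "?L \<longleftrightarrow> ?R")
proof -
  let ?T = "tri_alg A M B"
  have L: "?L \<longleftrightarrow> (a, m, b) \<in> carrier ?T \<and> (\<forall>t\<in>carrier ?T. ad ?T (a, m, b) t = \<zero>\<^bsub>?T\<^esub>)"
    by (auto simp: alg_center_def ad_def T.M.minus_eq_zero_iff)
  show ?thesis
  proof
    assume ?L
    then have abm: "a \<in> carrier A" "m \<in> carrier M" "b \<in> carrier B"
      and eq: "\<And>x n y. \<lbrakk>x \<in> carrier A; n \<in> carrier M; y \<in> carrier B\<rbrakk> \<Longrightarrow>
        ad A a x = \<zero>\<^bsub>A\<^esub> \<and> ad_act M a b n \<oplus>\<^bsub>M\<^esub> (m \<triangleleft>\<^bsub>M\<^esub> y \<ominus>\<^bsub>M\<^esub> x \<triangleright>\<^bsub>M\<^esub> m) = \<zero>\<^bsub>M\<^esub> \<and> ad B b y = \<zero>\<^bsub>B\<^esub>"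
      unfolding L by (auto simp: tri_simps ad_tri)
    have "m = \<zero>\<^bsub>M\<^esub>"
      using eq[of "\<zero>\<^bsub>A\<^esub>" "\<zero>\<^bsub>M\<^esub>" "\<one>\<^bsub>B\<^esub>"] abm by (simp add: ad_act_zero a_minus_def)
    then show ?R
      using eq[of "\<zero>\<^bsub>A\<^esub>" _ "\<zero>\<^bsub>B\<^esub>"] eq[of _ "\<zero>\<^bsub>M\<^esub>" "\<zero>\<^bsub>B\<^esub>"] eq[of "\<zero>\<^bsub>A\<^esub>" "\<zero>\<^bsub>M\<^esub>" _] abm
      by (simp add: ad_act_closed a_minus_def)
  next
    assume ?R
    then show ?L unfolding L by (auto simp: tri_simps ad_tri a_minus_def)
  qed
qed

end

section \<open>Direct sums of bimodules and block matrices\<close>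

lemma bimod_sum_simps:
  "carrier (M \<oplus>\<^sub>b N) = carrier M \<times> carrier N"
  "\<zero>\<^bsub>M \<oplus>\<^sub>b N\<^esub> = (\<zero>\<^bsub>M\<^esub>, \<zero>\<^bsub>N\<^esub>)"
  "(m, n) \<oplus>\<^bsub>M \<oplus>\<^sub>b N\<^esub> (m', n') = (m \<oplus>\<^bsub>M\<^esub> m', n \<oplus>\<^bsub>N\<^esub> n')"
  "k \<odot>\<^bsub>M \<oplus>\<^sub>b N\<^esub> (m, n) = (k \<odot>\<^bsub>M\<^esub> m, k \<odot>\<^bsub>N\<^esub> n)"
  "a \<triangleright>\<^bsub>M \<oplus>\<^sub>b N\<^esub> (m, n) = (a \<triangleright>\<^bsub>M\<^esub> m, a \<triangleright>\<^bsub>N\<^esub> n)"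
  "(m, n) \<triangleleft>\<^bsub>M \<oplus>\<^sub>b N\<^esub> b = (m \<triangleleft>\<^bsub>M\<^esub> b, n \<triangleleft>\<^bsub>N\<^esub> b)"
  by (simp_all add: bimod_sum_def)

lemma bimod_sum_proj:
  "fst (x \<oplus>\<^bsub>M \<oplus>\<^sub>b N\<^esub> y) = fst x \<oplus>\<^bsub>M\<^esub> fst y" "snd (x \<oplus>\<^bsub>M \<oplus>\<^sub>b N\<^esub> y) = snd x \<oplus>\<^bsub>N\<^esub> snd y"
  "fst (k \<odot>\<^bsub>M \<oplus>\<^sub>b N\<^esub> x) = k \<odot>\<^bsub>M\<^esub> fst x" "snd (k \<odot>\<^bsub>M \<oplus>\<^sub>b N\<^esub> x) = k \<odot>\<^bsub>N\<^esub> snd x"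
  "fst (a \<triangleright>\<^bsub>M \<oplus>\<^sub>b N\<^esub> x) = a \<triangleright>\<^bsub>M\<^esub> fst x" "snd (a \<triangleright>\<^bsub>M \<oplus>\<^sub>b N\<^esub> x) = a \<triangleright>\<^bsub>N\<^esub> snd x"
  "fst (x \<triangleleft>\<^bsub>M \<oplus>\<^sub>b N\<^esub> b) = fst x \<triangleleft>\<^bsub>M\<^esub> b" "snd (x \<triangleleft>\<^bsub>M \<oplus>\<^sub>b N\<^esub> b) = snd x \<triangleleft>\<^bsub>N\<^esub> b"
  by (cases x; cases y; simp add: bimod_sum_simps)+

lemma
  assumes "f \<in> carrier (bimod_hom K A B M N)"
  shows bimod_hom_closed: "m \<in> carrier M \<Longrightarrow> f m \<in> carrier N"
    and bimod_hom_add: "\<lbrakk>m \<in> carrier M; m' \<in> carrier M\<rbrakk> \<Longrightarrow> f (m \<oplus>\<^bsub>M\<^esub> m') = f m \<oplus>\<^bsub>N\<^esub> f m'"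
    and bimod_hom_smult: "\<lbrakk>k \<in> carrier K; m \<in> carrier M\<rbrakk> \<Longrightarrow> f (k \<odot>\<^bsub>M\<^esub> m) = k \<odot>\<^bsub>N\<^esub> f m"
    and bimod_hom_lact: "\<lbrakk>a \<in> carrier A; m \<in> carrier M\<rbrakk> \<Longrightarrow> f (a \<triangleright>\<^bsub>M\<^esub> m) = a \<triangleright>\<^bsub>N\<^esub> f m"
    and bimod_hom_ract: "\<lbrakk>b \<in> carrier B; m \<in> carrier M\<rbrakk> \<Longrightarrow> f (m \<triangleleft>\<^bsub>M\<^esub> b) = f m \<triangleleft>\<^bsub>N\<^esub> b"
    and bimod_hom_extensional: "f \<in> extensional (carrier M)"
  using assms by (auto simp: bimod_hom_def mod_hom_def)

lemma bimod_hom_ops: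
  "\<zero>\<^bsub>bimod_hom K A B M N\<^esub> = (\<lambda>m\<in>carrier M. \<zero>\<^bsub>N\<^esub>)"
  "f \<oplus>\<^bsub>bimod_hom K A B M N\<^esub> g = (\<lambda>m\<in>carrier M. f m \<oplus>\<^bsub>N\<^esub> g m)"
  "k \<odot>\<^bsub>bimod_hom K A B M N\<^esub> f = (\<lambda>m\<in>carrier M. k \<odot>\<^bsub>N\<^esub> f m)"
  by (simp_all add: bimod_hom_def)

lemma prod_module_simps:
  "carrier (prod_module X Y) = carrier X \<times> carrier Y"
  "\<zero>\<^bsub>prod_module X Y\<^esub> = (\<zero>\<^bsub>X\<^esub>, \<zero>\<^bsub>Y\<^esub>)"
  "(x, y) \<oplus>\<^bsub>prod_module X Y\<^esub> (x', y') = (x \<oplus>\<^bsub>X\<^esub> x', y \<oplus>\<^bsub>Y\<^esub> y')"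
  "k \<odot>\<^bsub>prod_module X Y\<^esub> (x, y) = (k \<odot>\<^bsub>X\<^esub> x, k \<odot>\<^bsub>Y\<^esub> y)"
  by (simp_all add: prod_module_def)

lemma (in bimodule) bimod_homI:
  assumes "\<And>m. m \<in> carrier M \<Longrightarrow> f m \<in> carrier N"
    and "\<And>m m'. \<lbrakk>m \<in> carrier M; m' \<in> carrier M\<rbrakk> \<Longrightarrow> f (m \<oplus>\<^bsub>M\<^esub> m') = f m \<oplus>\<^bsub>N\<^esub> f m'"
    and "\<And>k m. \<lbrakk>k \<in> carrier K; m \<in> carrier M\<rbrakk> \<Longrightarrow> f (k \<odot>\<^bsub>M\<^esub> m) = k \<odot>\<^bsub>N\<^esub> f m"
    and "\<And>a m. \<lbrakk>a \<in> carrier A; m \<in> carrier M\<rbrakk> \<Longrightarrow> f (a \<triangleright>\<^bsub>M\<^esub> m) = a \<triangleright>\<^bsub>N\<^esub> f m"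
    and "\<And>b m. \<lbrakk>b \<in> carrier B; m \<in> carrier M\<rbrakk> \<Longrightarrow> f (m \<triangleleft>\<^bsub>M\<^esub> b) = f m \<triangleleft>\<^bsub>N\<^esub> b"
  shows "restrict f (carrier M) \<in> carrier (bimod_hom K A B M N)"
  using assms by (auto simp: bimod_hom_def mod_hom_def)

lemma (in bimodule) bimod_hom_if_compat:
  assumes \<nu>: "\<nu> \<in> compat_end K A M B \<alpha> \<beta>"
    and z: "\<And>a. a \<in> carrier A \<Longrightarrow> \<alpha> a = \<zero>\<^bsub>A\<^esub>" "\<And>b. b \<in> carrier B \<Longrightarrow> \<beta> b = \<zero>\<^bsub>B\<^esub>"
  shows "restrict \<nu> (carrier M) \<in> carrier (bimod_hom K A B M M)"
  by (rule bimod_homI) (simp_all add: z compat_closed[OF \<nu>] compat_add[OF \<nu>] compat_smult[OF \<nu>]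
    compat_lact[OF \<nu>] compat_ract[OF \<nu>])

locale bimodule_pair = M: bimodule K A B M + N: bimodule K A B N
  for K :: "'k ring" and A :: "('k, 'a) module" and B :: "('k, 'b) module"
    and M :: "('k, 'a, 'b, 'm) bimodule" and N :: "('k, 'a, 'b, 'n) bimodule"
begin

lemma module_bimod_hom: "module K (bimod_hom K A B M N)"
proof (rule module_of_functions)
  show "module K N" by unfold_locales
next
  show "carrier (bimod_hom K A B M N) \<subseteq> carrier M \<rightarrow>\<^sub>E carrier N"
    by (auto simp: bimod_hom_def mod_hom_def PiE_def)
next
  show "\<zero>\<^bsub>bimod_hom K A B M N\<^esub> \<in> carrier (bimod_hom K A B M N)"
    unfolding bimod_hom_ops by (rule M.bimod_homI) simp_all
next
  fix f g assume f: "f \<in> carrier (bimod_hom K A B M N)" and g: "g \<in> carrier (bimod_hom K A B M N)"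
  note fg = bimod_hom_closed[OF f] bimod_hom_add[OF f] bimod_hom_smult[OF f] bimod_hom_lact[OF f]
    bimod_hom_ract[OF f] bimod_hom_closed[OF g] bimod_hom_add[OF g] bimod_hom_smult[OF g]
    bimod_hom_lact[OF g] bimod_hom_ract[OF g]
  show "f \<oplus>\<^bsub>bimod_hom K A B M N\<^esub> g \<in> carrier (bimod_hom K A B M N)"
    unfolding bimod_hom_ops
    by (rule M.bimod_homI) (simp_all add: fg N.M.a_ac N.smult_r_distr N.lact_add N.add_ract)
next
  fix k f assume k: "k \<in> carrier K" and f: "f \<in> carrier (bimod_hom K A B M N)"
  note f = bimod_hom_closed[OF f] bimod_hom_add[OF f] bimod_hom_smult[OF f] bimod_hom_lact[OF f]
    bimod_hom_ract[OF f]
  show "k \<odot>\<^bsub>bimod_hom K A B M N\<^esub> f \<in> carrier (bimod_hom K A B M N)"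
    unfolding bimod_hom_ops using k
    by (intro M.bimod_homI) (simp_all add: f N.smult_r_distr N.lact_smult N.smult_ract
      N.smult_assoc1[symmetric] M.A.R.m_comm)
qed (simp_all add: bimod_hom_def)

lemma bimodule_sum: "bimodule K A B (M \<oplus>\<^sub>b N)"
proof (intro bimodule.intro bimodule_axioms.intro)
  show "assoc_algebra K A" "assoc_algebra K B" by unfold_locales
  show "module K (M \<oplus>\<^sub>b N)"
    by (rule moduleI_scalar) (auto simp: bimod_sum_simps M.A.R.is_cring M.M.a_ac N.M.a_ac
      M.smult_l_distr N.smult_l_distr M.smult_r_distr N.smult_r_distr M.smult_assoc1 N.smult_assoc1)
qed (auto simp: bimod_sum_simps M.lact_add N.lact_add M.add_lact N.add_lact M.mult_lact N.mult_lact
  M.smult_lact N.smult_lact M.add_ract N.add_ract M.ract_add N.ract_add M.ract_mult N.ract_mult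
  M.ract_smult N.ract_smult M.lact_ract N.lact_ract)

end

sublocale bimodule_pair \<subseteq> MN: bimodule K A B "M \<oplus>\<^sub>b N"
  by (rule bimodule_sum)

text \<open>
  The block matrix with rows \<open>\<mu>, \<psi>\<close> and \<open>\<phi>, \<nu>\<close>. The functions \<open>comp12\<close>, \<open>comp21\<close>, \<open>comp22\<close> below
  complete \<open>comp11\<close> to the list of blocks of an endomorphism; the off-diagonal ones are made
  extensional because they are elements of \<open>bimod_hom\<close>.
\<close>

definition block_end ::
    "('k, 'a, 'b, 'm) bimodule \<Rightarrow> ('k, 'a, 'b, 'n) bimodule \<Rightarrow>
     ('m \<Rightarrow> 'm) \<Rightarrow> ('n \<Rightarrow> 'm) \<Rightarrow> ('m \<Rightarrow> 'n) \<Rightarrow> ('n \<Rightarrow> 'n) \<Rightarrow> 'm \<times> 'n \<Rightarrow> 'm \<times> 'n" where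
  "block_end M N \<mu> \<psi> \<phi> \<nu> = (\<lambda>(m, n). (\<mu> m \<oplus>\<^bsub>M\<^esub> \<psi> n, \<phi> m \<oplus>\<^bsub>N\<^esub> \<nu> n))"

definition comp12 ::
    "('k, 'a, 'b, 'm) bimodule \<Rightarrow> ('k, 'a, 'b, 'n) bimodule \<Rightarrow> ('m \<times> 'n \<Rightarrow> 'm \<times> 'n) \<Rightarrow> 'n \<Rightarrow> 'm" where
  "comp12 M N \<gamma> = (\<lambda>n\<in>carrier N. fst (\<gamma> (\<zero>\<^bsub>M\<^esub>, n)))"

definition comp21 ::
    "('k, 'a, 'b, 'm) bimodule \<Rightarrow> ('k, 'a, 'b, 'n) bimodule \<Rightarrow> ('m \<times> 'n \<Rightarrow> 'm \<times> 'n) \<Rightarrow> 'm \<Rightarrow> 'n" where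
  "comp21 M N \<gamma> = (\<lambda>m\<in>carrier M. snd (\<gamma> (m, \<zero>\<^bsub>N\<^esub>)))"

definition comp22 ::
    "('k, 'a, 'b, 'm) bimodule \<Rightarrow> ('m \<times> 'n \<Rightarrow> 'm \<times> 'n) \<Rightarrow> 'n \<Rightarrow> 'n" where
  "comp22 M \<gamma> = (\<lambda>n. snd (\<gamma> (\<zero>\<^bsub>M\<^esub>, n)))"

context bimodule_pair
begin

lemma ad_act_sum:
  assumes "a \<in> carrier A" "b \<in> carrier B" "m \<in> carrier M" "n \<in> carrier N"
  shows "ad_act (M \<oplus>\<^sub>b N) a b (m, n) = (ad_act M a b m, ad_act N a b n)"
proof -
  have "\<ominus>\<^bsub>M \<oplus>\<^sub>b N\<^esub> (x, y) = (\<ominus>\<^bsub>M\<^esub> x, \<ominus>\<^bsub>N\<^esub> y)" if "x \<in> carrier M" "y \<in> carrier N" for x y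
    using that by (intro MN.M.minus_equality) (simp_all add: bimod_sum_simps M.M.l_neg N.M.l_neg)
  then show ?thesis
    using assms by (simp add: ad_act_def a_minus_def bimod_sum_simps)
qed

lemma block_end_compat:
  assumes \<mu>: "\<mu> \<in> compat_end K A M B \<alpha> \<beta>" and \<nu>: "\<nu> \<in> compat_end K A N B \<alpha> \<beta>"
    and \<phi>: "\<phi> \<in> carrier (bimod_hom K A B M N)" and \<psi>: "\<psi> \<in> carrier (bimod_hom K A B N M)"
    and \<alpha>: "\<alpha> \<in> carrier (Der K A)" and \<beta>: "\<beta> \<in> carrier (Der K B)"
  shows "block_end M N \<mu> \<psi> \<phi> \<nu> \<in> compat_end K A (M \<oplus>\<^sub>b N) B \<alpha> \<beta>"
proof -
  note closed = M.compat_closed[OF \<mu>] N.compat_closed[OF \<nu>] bimod_hom_closed[OF \<phi>] bimod_hom_closed[OF \<psi>]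
    M.A.Der_closed[OF \<alpha>] M.B.Der_closed[OF \<beta>]
  show ?thesis
    by (rule MN.compat_endI) (auto simp: closed block_end_def bimod_sum_simps
      M.compat_add[OF \<mu>] M.compat_smult[OF \<mu>] M.compat_lact[OF \<mu>] M.compat_ract[OF \<mu>]
      N.compat_add[OF \<nu>] N.compat_smult[OF \<nu>] N.compat_lact[OF \<nu>] N.compat_ract[OF \<nu>]
      bimod_hom_add[OF \<phi>] bimod_hom_smult[OF \<phi>] bimod_hom_lact[OF \<phi>] bimod_hom_ract[OF \<phi>]
      bimod_hom_add[OF \<psi>] bimod_hom_smult[OF \<psi>] bimod_hom_lact[OF \<psi>] bimod_hom_ract[OF \<psi>]
      M.smult_r_distr N.smult_r_distr M.lact_add M.add_ract N.lact_add N.add_ract M.M.a_ac N.M.a_ac)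
qed

text \<open>
  On \<open>M \<oplus> N\<close> the inhomogeneous terms \<open>\<alpha> a x\<close> and \<open>x \<beta> b\<close> of the Leibniz identities are diagonal.
  They survive in the diagonal blocks and disappear from the off-diagonal ones.
\<close>

lemma
  assumes \<gamma>: "\<gamma> \<in> compat_end K A (M \<oplus>\<^sub>b N) B \<alpha> \<beta>"
    and \<alpha>: "\<alpha> \<in> carrier (Der K A)" and \<beta>: "\<beta> \<in> carrier (Der K B)"
  shows comp11_compat: "comp11 N \<gamma> \<in> compat_end K A M B \<alpha> \<beta>"
    and comp22_compat: "comp22 M \<gamma> \<in> compat_end K A N B \<alpha> \<beta>"
    and comp12_hom: "comp12 M N \<gamma> \<in> carrier (bimod_hom K A B N M)"
    and comp21_hom: "comp21 M N \<gamma> \<in> carrier (bimod_hom K A B M N)"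
    and block_decomp: "\<lbrakk>m \<in> carrier M; n \<in> carrier N\<rbrakk> \<Longrightarrow> \<gamma> (m, n) =
      block_end M N (comp11 N \<gamma>) (comp12 M N \<gamma>) (comp21 M N \<gamma>) (comp22 M \<gamma>) (m, n)"
proof -
  define \<gamma>1 where "\<gamma>1 m n = fst (\<gamma> (m, n))" for m n
  define \<gamma>2 where "\<gamma>2 m n = snd (\<gamma> (m, n))" for m n
  have closed: "\<gamma>1 m n \<in> carrier M" "\<gamma>2 m n \<in> carrier N" if "m \<in> carrier M" "n \<in> carrier N" for m n
    using MN.compat_closed[OF \<gamma>, of "(m, n)"] that by (auto simp: bimod_sum_simps \<gamma>1_def \<gamma>2_def)
  have add: "\<gamma>1 (m \<oplus>\<^bsub>M\<^esub> m') (n \<oplus>\<^bsub>N\<^esub> n') = \<gamma>1 m n \<oplus>\<^bsub>M\<^esub> \<gamma>1 m' n'"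
    "\<gamma>2 (m \<oplus>\<^bsub>M\<^esub> m') (n \<oplus>\<^bsub>N\<^esub> n') = \<gamma>2 m n \<oplus>\<^bsub>N\<^esub> \<gamma>2 m' n'"
    if "m \<in> carrier M" "n \<in> carrier N" "m' \<in> carrier M" "n' \<in> carrier N" for m n m' n'
    using MN.compat_add[OF \<gamma>, of "(m, n)" "(m', n')"] that
    by (simp_all add: bimod_sum_simps bimod_sum_proj \<gamma>1_def \<gamma>2_def)
  have smult: "\<gamma>1 (k \<odot>\<^bsub>M\<^esub> m) (k \<odot>\<^bsub>N\<^esub> n) = k \<odot>\<^bsub>M\<^esub> \<gamma>1 m n"
    "\<gamma>2 (k \<odot>\<^bsub>M\<^esub> m) (k \<odot>\<^bsub>N\<^esub> n) = k \<odot>\<^bsub>N\<^esub> \<gamma>2 m n"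
    if "k \<in> carrier K" "m \<in> carrier M" "n \<in> carrier N" for k m n
    using MN.compat_smult[OF \<gamma>, of k "(m, n)"] that
    by (simp_all add: bimod_sum_simps bimod_sum_proj \<gamma>1_def \<gamma>2_def)
  have lact: "\<gamma>1 (a \<triangleright>\<^bsub>M\<^esub> m) (a \<triangleright>\<^bsub>N\<^esub> n) = \<alpha> a \<triangleright>\<^bsub>M\<^esub> m \<oplus>\<^bsub>M\<^esub> a \<triangleright>\<^bsub>M\<^esub> \<gamma>1 m n"
    "\<gamma>2 (a \<triangleright>\<^bsub>M\<^esub> m) (a \<triangleright>\<^bsub>N\<^esub> n) = \<alpha> a \<triangleright>\<^bsub>N\<^esub> n \<oplus>\<^bsub>N\<^esub> a \<triangleright>\<^bsub>N\<^esub> \<gamma>2 m n"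
    if "a \<in> carrier A" "m \<in> carrier M" "n \<in> carrier N" for a m n
    using MN.compat_lact[OF \<gamma>, of a "(m, n)"] that
    by (simp_all add: bimod_sum_simps bimod_sum_proj \<gamma>1_def \<gamma>2_def)
  have ract: "\<gamma>1 (m \<triangleleft>\<^bsub>M\<^esub> b) (n \<triangleleft>\<^bsub>N\<^esub> b) = \<gamma>1 m n \<triangleleft>\<^bsub>M\<^esub> b \<oplus>\<^bsub>M\<^esub> m \<triangleleft>\<^bsub>M\<^esub> \<beta> b"
    "\<gamma>2 (m \<triangleleft>\<^bsub>M\<^esub> b) (n \<triangleleft>\<^bsub>N\<^esub> b) = \<gamma>2 m n \<triangleleft>\<^bsub>N\<^esub> b \<oplus>\<^bsub>N\<^esub> n \<triangleleft>\<^bsub>N\<^esub> \<beta> b"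
    if "b \<in> carrier B" "m \<in> carrier M" "n \<in> carrier N" for b m n
    using MN.compat_ract[OF \<gamma>, of b "(m, n)"] that
    by (simp_all add: bimod_sum_simps bimod_sum_proj \<gamma>1_def \<gamma>2_def)
  note D = M.A.Der_closed[OF \<alpha>] M.B.Der_closed[OF \<beta>]
  have defs: "comp11 N \<gamma> = (\<lambda>m. \<gamma>1 m \<zero>\<^bsub>N\<^esub>)" "comp22 M \<gamma> = (\<lambda>n. \<gamma>2 \<zero>\<^bsub>M\<^esub> n)"
    "comp12 M N \<gamma> = (\<lambda>n\<in>carrier N. \<gamma>1 \<zero>\<^bsub>M\<^esub> n)" "comp21 M N \<gamma> = (\<lambda>m\<in>carrier M. \<gamma>2 m \<zero>\<^bsub>N\<^esub>)"
    by (simp_all add: comp11_def comp22_def comp12_def comp21_def \<gamma>1_def \<gamma>2_def)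
  show "comp11 N \<gamma> \<in> compat_end K A M B \<alpha> \<beta>"
    unfolding defs using add(1)[OF _ N.M.zero_closed _ N.M.zero_closed] smult(1)[OF _ _ N.M.zero_closed]
      lact(1)[OF _ _ N.M.zero_closed] ract(1)[OF _ _ N.M.zero_closed] closed(1)[OF _ N.M.zero_closed]
    by (intro M.compat_endI) simp_all
  show "comp22 M \<gamma> \<in> compat_end K A N B \<alpha> \<beta>"
    unfolding defs using add(2)[OF M.M.zero_closed _ M.M.zero_closed] smult(2)[OF _ M.M.zero_closed]
      lact(2)[OF _ M.M.zero_closed] ract(2)[OF _ M.M.zero_closed] closed(2)[OF M.M.zero_closed]
    by (intro N.compat_endI) simp_all
  show "comp12 M N \<gamma> \<in> carrier (bimod_hom K A B N M)"
    unfolding defs using add(1)[OF M.M.zero_closed _ M.M.zero_closed] smult(1)[OF _ M.M.zero_closed]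
      lact(1)[OF _ M.M.zero_closed] ract(1)[OF _ M.M.zero_closed] closed(1)[OF M.M.zero_closed]
    by (intro N.bimod_homI) (simp_all add: D)
  show "comp21 M N \<gamma> \<in> carrier (bimod_hom K A B M N)"
    unfolding defs using add(2)[OF _ N.M.zero_closed _ N.M.zero_closed] smult(2)[OF _ _ N.M.zero_closed]
      lact(2)[OF _ _ N.M.zero_closed] ract(2)[OF _ _ N.M.zero_closed] closed(2)[OF _ N.M.zero_closed]
    by (intro M.bimod_homI) (simp_all add: D)
  show "\<gamma> (m, n) = block_end M N (comp11 N \<gamma>) (comp12 M N \<gamma>) (comp21 M N \<gamma>) (comp22 M \<gamma>) (m, n)"
    if "m \<in> carrier M" "n \<in> carrier N"
    using add[OF that(1) N.M.zero_closed M.M.zero_closed that(2)] that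
    by (simp add: defs block_end_def prod_eq_iff \<gamma>1_def \<gamma>2_def)
qed

text \<open>
  The set of values in the definition of \<open>r1\<close> is a singleton: changing the representative changes
  \<open>\<gamma>\<close> by a commutator with a diagonal matrix, whose block \<open>M \<rightarrow> M\<close> is the commutator on \<open>M\<close>
  with the same matrix.
\<close>

lemma r1_diag_class:
  assumes d: "(\<alpha>, \<gamma>, \<beta>) \<in> diag_der_data K A (M \<oplus>\<^sub>b N) B"
  shows "(\<alpha>, comp11 N \<gamma>, \<beta>) \<in> diag_der_data K A M B"
    and "r1 K A B M N (diag_class K A (M \<oplus>\<^sub>b N) B \<alpha> \<gamma> \<beta>) = diag_class K A M B \<alpha> (comp11 N \<gamma>) \<beta>"
proof -
  have comp: "(\<alpha>', comp11 N \<gamma>', \<beta>') \<in> diag_der_data K A M B"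
    if "(\<alpha>', \<gamma>', \<beta>') \<in> diag_der_data K A (M \<oplus>\<^sub>b N) B" for \<alpha>' \<gamma>' \<beta>'
    using that comp11_compat by (simp add: diag_der_data_iff)
  show "(\<alpha>, comp11 N \<gamma>, \<beta>) \<in> diag_der_data K A M B" by (rule comp[OF d])
  have eq: "diag_class K A M B \<alpha>' (comp11 N \<gamma>') \<beta>' = diag_class K A M B \<alpha> (comp11 N \<gamma>) \<beta>"
    if d': "(\<alpha>', \<gamma>', \<beta>') \<in> diag_der_data K A (M \<oplus>\<^sub>b N) B"
      and mem: "diag_der A (M \<oplus>\<^sub>b N) B \<alpha>' \<gamma>' \<beta>' \<in> diag_class K A (M \<oplus>\<^sub>b N) B \<alpha> \<gamma> \<beta>" for \<alpha>' \<gamma>' \<beta>'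
  proof -
    have "diag_class K A (M \<oplus>\<^sub>b N) B \<alpha>' \<gamma>' \<beta>' = diag_class K A (M \<oplus>\<^sub>b N) B \<alpha> \<gamma> \<beta>"
      using mem d d' by (subst (asm) MN.T.mem_der_class_iff) (simp_all add: diag_der_data_iff MN.diag_der_in_Der)
    then obtain a b where ab: "a \<in> carrier A" "b \<in> carrier B"
      and *: "\<forall>x\<in>carrier A. \<alpha>' x = ad A a x \<oplus>\<^bsub>A\<^esub> \<alpha> x" "\<forall>y\<in>carrier B. \<beta>' y = ad B b y \<oplus>\<^bsub>B\<^esub> \<beta> y"
        "\<forall>x\<in>carrier (M \<oplus>\<^sub>b N). \<gamma>' x = ad_act (M \<oplus>\<^sub>b N) a b x \<oplus>\<^bsub>M \<oplus>\<^sub>b N\<^esub> \<gamma> x"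
      unfolding MN.diag_class_eq_iff[OF d' d] by blast
    have "comp11 N \<gamma>' m = ad_act M a b m \<oplus>\<^bsub>M\<^esub> comp11 N \<gamma> m" if "m \<in> carrier M" for m
      using *(3) that ab by (simp add: comp11_def bimod_sum_simps bimod_sum_proj ad_act_sum)
    then show ?thesis
      unfolding M.diag_class_eq_iff[OF comp[OF d'] comp[OF d]] using ab * by blast
  qed
  have self: "diag_der A (M \<oplus>\<^sub>b N) B \<alpha> \<gamma> \<beta> \<in> diag_class K A (M \<oplus>\<^sub>b N) B \<alpha> \<gamma> \<beta>"
    using d by (subst MN.T.mem_der_class_iff) (simp_all add: diag_der_data_iff MN.diag_der_in_Der)
  let ?S = "{(\<alpha>', \<gamma>', \<beta>') \<in> diag_der_data K A (M \<oplus>\<^sub>b N) B.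
    diag_der A (M \<oplus>\<^sub>b N) B \<alpha>' \<gamma>' \<beta>' \<in> diag_class K A (M \<oplus>\<^sub>b N) B \<alpha> \<gamma> \<beta>}"
  let ?h = "\<lambda>(\<alpha>, \<gamma>, \<beta>). diag_class K A M B \<alpha> (comp11 N \<gamma>) \<beta>"
  have "?h ` ?S = {diag_class K A M B \<alpha> (comp11 N \<gamma>) \<beta>}"
  proof (intro equalityI subsetI)
    fix C assume "C \<in> ?h ` ?S"
    then show "C \<in> {diag_class K A M B \<alpha> (comp11 N \<gamma>) \<beta>}" using eq by (auto simp del: insert_iff intro!: singletonI)
  next
    fix C assume C: "C \<in> {diag_class K A M B \<alpha> (comp11 N \<gamma>) \<beta>}"
    have "(\<alpha>, \<gamma>, \<beta>) \<in> ?S" using d self by simp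
    then have "?h (\<alpha>, \<gamma>, \<beta>) \<in> ?h ` ?S" by (rule imageI)
    with C show "C \<in> ?h ` ?S" by simp
  qed
  then show "r1 K A B M N (diag_class K A (M \<oplus>\<^sub>b N) B \<alpha> \<gamma> \<beta>) = diag_class K A M B \<alpha> (comp11 N \<gamma>) \<beta>"
    unfolding r1_def by simp
qed

end

section \<open>The maps of the exact sequences\<close>

lemma image_triples:
  "(\<lambda>(x, y, z). h x y z) ` {(x, y, z) \<in> S. P y \<and> Q y} =
    {h x y z |x y z. (x, y, z) \<in> S \<and> P y \<and> Q y}"
  by force

lemma carrier_update: "carrier (R\<lparr>carrier := S\<rparr>) = S"
  by simp

lemma center_ops:
  "\<zero>\<^bsub>alg_center T\<^esub> = \<zero>\<^bsub>T\<^esub>" "x \<oplus>\<^bsub>alg_center T\<^esub> y = x \<oplus>\<^bsub>T\<^esub> y" "k \<odot>\<^bsub>alg_center T\<^esub> x = k \<odot>\<^bsub>T\<^esub> x"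
  by (simp_all add: alg_center_def)

lemma (in bimodule) compat_if_bimod_hom:
  assumes \<nu>: "\<nu> \<in> carrier (bimod_hom K A B M M)"
  shows "\<nu> \<in> compat_end K A M B \<zero>\<^bsub>Der K A\<^esub> \<zero>\<^bsub>Der K B\<^esub>"
  by (rule compat_endI) (simp_all add: A.Der_ops B.Der_ops bimod_hom_closed[OF \<nu>] bimod_hom_add[OF \<nu>]
    bimod_hom_smult[OF \<nu>] bimod_hom_lact[OF \<nu>] bimod_hom_ract[OF \<nu>])

text \<open>
  The connecting maps: \<open>center_act\<close> goes from the center to the endomorphisms of \<open>N\<close>, and
  \<open>block_class\<close> from bimodule maps to classes of derivations. With these choices the first sequence
  restricts to the second.
\<close>

definition center_act ::
    "('k, 'a, 'b, 'n) bimodule \<Rightarrow> 'a \<times> 'm \<times> 'b \<Rightarrow> 'n \<Rightarrow> 'n" where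
  "center_act N = (\<lambda>(a, m, b). restrict (ad_act N a b) (carrier N))"

definition block_class ::
    "'k ring \<Rightarrow> ('k, 'a) module \<Rightarrow> ('k, 'b) module \<Rightarrow>
     ('k, 'a, 'b, 'm) bimodule \<Rightarrow> ('k, 'a, 'b, 'n) bimodule \<Rightarrow>
     ('m \<Rightarrow> 'n) \<times> ('n \<Rightarrow> 'n) \<times> ('n \<Rightarrow> 'm) \<Rightarrow>
     ('a \<times> ('m \<times> 'n) \<times> 'b \<Rightarrow> 'a \<times> ('m \<times> 'n) \<times> 'b) set" where
  "block_class K A B M N = (\<lambda>(\<phi>, \<nu>, \<psi>). diag_class K A (M \<oplus>\<^sub>b N) B
     \<zero>\<^bsub>Der K A\<^esub> (block_end M N (\<lambda>m. \<zero>\<^bsub>M\<^esub>) \<psi> \<phi> \<nu>) \<zero>\<^bsub>Der K B\<^esub>)"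

context bimodule_pair
begin

abbreviation "T\<^sub>M \<equiv> tri_alg A M B"
abbreviation "T\<^sub>M\<^sub>N \<equiv> tri_alg A (M \<oplus>\<^sub>b N) B"
abbreviation "Homs \<equiv> prod_module (bimod_hom K A B M N) (prod_module (bimod_hom K A B N N) (bimod_hom K A B N M))"

lemma center_actE:
  assumes "z \<in> carrier (alg_center T\<^sub>M)"
  obtains a b where "a \<in> carrier A" "b \<in> carrier B" "z = (a, \<zero>\<^bsub>M\<^esub>, b)"
    "\<And>x. x \<in> carrier A \<Longrightarrow> ad A a x = \<zero>\<^bsub>A\<^esub>" "\<And>y. y \<in> carrier B \<Longrightarrow> ad B b y = \<zero>\<^bsub>B\<^esub>"
    "\<And>m. m \<in> carrier M \<Longrightarrow> ad_act M a b m = \<zero>\<^bsub>M\<^esub>" "center_act N z = restrict (ad_act N a b) (carrier N)"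
  using assms by (cases z) (auto simp: M.center_iff center_act_def)

lemma center_act_hom: "center_act N \<in> mod_hom K (alg_center T\<^sub>M) (bimod_hom K A B N N)"
proof -
  have "center_act N z \<in> carrier (bimod_hom K A B N N)" if "z \<in> carrier (alg_center T\<^sub>M)" for z
    using that by (rule center_actE) (simp add: N.bimod_hom_if_compat[OF N.ad_act_compat])
  moreover have "center_act N (z \<oplus>\<^bsub>alg_center T\<^sub>M\<^esub> w) =
      center_act N z \<oplus>\<^bsub>bimod_hom K A B N N\<^esub> center_act N w"
    if z: "z \<in> carrier (alg_center T\<^sub>M)" and w: "w \<in> carrier (alg_center T\<^sub>M)" for z w
  proof -
    obtain a b where "a \<in> carrier A" "b \<in> carrier B" "z = (a, \<zero>\<^bsub>M\<^esub>, b)" using z by (rule center_actE)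
    moreover obtain a' b' where "a' \<in> carrier A" "b' \<in> carrier B" "w = (a', \<zero>\<^bsub>M\<^esub>, b')" using w by (rule center_actE)
    ultimately show ?thesis
      by (simp add: center_act_def center_ops tri_simps bimod_hom_ops)
        (rule restrict_ext, simp add: ad_act_def a_minus_def N.add_lact N.ract_add N.M.minus_add N.M.a_ac)
  qed
  moreover have "center_act N (k \<odot>\<^bsub>alg_center T\<^sub>M\<^esub> z) = k \<odot>\<^bsub>bimod_hom K A B N N\<^esub> center_act N z"
    if k: "k \<in> carrier K" and z: "z \<in> carrier (alg_center T\<^sub>M)" for k z
  proof -
    obtain a b where "a \<in> carrier A" "b \<in> carrier B" "z = (a, \<zero>\<^bsub>M\<^esub>, b)" using z by (rule center_actE)
    with k show ?thesis
      by (simp add: center_act_def center_ops tri_simps bimod_hom_ops)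
        (rule restrict_ext, simp add: ad_act_def a_minus_def N.smult_lact N.ract_smult N.smult_r_distr N.smult_r_minus)
  qed
  ultimately show ?thesis by (auto simp: mod_hom_def)
qed

lemma center_sum_iff:
  "(a, x, b) \<in> carrier (alg_center T\<^sub>M\<^sub>N) \<longleftrightarrow>
    (a, fst x, b) \<in> carrier (alg_center T\<^sub>M) \<and> snd x = \<zero>\<^bsub>N\<^esub> \<and> (\<forall>n\<in>carrier N. ad_act N a b n = \<zero>\<^bsub>N\<^esub>)"
proof (cases "a \<in> carrier A \<and> b \<in> carrier B")
  case True
  have "(\<forall>p\<in>carrier (M \<oplus>\<^sub>b N). ad_act (M \<oplus>\<^sub>b N) a b p = \<zero>\<^bsub>M \<oplus>\<^sub>b N\<^esub>) \<longleftrightarrow>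
      (\<forall>m\<in>carrier M. ad_act M a b m = \<zero>\<^bsub>M\<^esub>) \<and> (\<forall>n\<in>carrier N. ad_act N a b n = \<zero>\<^bsub>N\<^esub>)" (is "?L \<longleftrightarrow> ?R")
  proof
    assume L: ?L
    have "ad_act M a b m = \<zero>\<^bsub>M\<^esub> \<and> ad_act N a b n = \<zero>\<^bsub>N\<^esub>" if "m \<in> carrier M" "n \<in> carrier N" for m n
      using L[rule_format, of "(m, n)"] that True by (simp add: bimod_sum_simps ad_act_sum)
    then show ?R using M.M.zero_closed N.M.zero_closed by blast
  qed (use True in \<open>auto simp: bimod_sum_simps ad_act_sum\<close>)
  then show ?thesis
    by (cases x) (auto simp: M.center_iff MN.center_iff bimod_sum_simps)
qed (auto simp: M.center_iff MN.center_iff)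

lemma r0_hom: "r0 M \<in> mod_hom K (alg_center T\<^sub>M\<^sub>N) (alg_center T\<^sub>M)"
proof -
  have el: "\<exists>a b. a \<in> carrier A \<and> b \<in> carrier B \<and> z = (a, (\<zero>\<^bsub>M\<^esub>, \<zero>\<^bsub>N\<^esub>), b) \<and> (a, \<zero>\<^bsub>M\<^esub>, b) \<in> carrier (alg_center T\<^sub>M)"
    if z: "z \<in> carrier (alg_center T\<^sub>M\<^sub>N)" for z
  proof -
    obtain a x b where "z = (a, x, b)" by (cases z)
    moreover obtain m n where "x = (m, n)" by (cases x)
    ultimately show ?thesis using z by (auto simp: center_sum_iff) (auto simp: M.center_iff)
  qed
  show ?thesis
    unfolding mod_hom_def
  proof (intro CollectI conjI ballI funcsetI)
    fix z assume "z \<in> carrier (alg_center T\<^sub>M\<^sub>N)"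
    from el[OF this] show "r0 M z \<in> carrier (alg_center T\<^sub>M)" by (auto simp: r0_def)
  next
    fix z w assume "z \<in> carrier (alg_center T\<^sub>M\<^sub>N)" "w \<in> carrier (alg_center T\<^sub>M\<^sub>N)"
    from el[OF this(1)] el[OF this(2)]
    show "r0 M (z \<oplus>\<^bsub>alg_center T\<^sub>M\<^sub>N\<^esub> w) = r0 M z \<oplus>\<^bsub>alg_center T\<^sub>M\<^esub> r0 M w"
      by (auto simp: r0_def center_ops tri_simps)
  next
    fix k z assume "k \<in> carrier K" "z \<in> carrier (alg_center T\<^sub>M\<^sub>N)"
    with el[OF this(2)] show "r0 M (k \<odot>\<^bsub>alg_center T\<^sub>M\<^sub>N\<^esub> z) = k \<odot>\<^bsub>alg_center T\<^sub>M\<^esub> r0 M z"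
      by (auto simp: r0_def center_ops tri_simps)
  qed
qed

lemma r0_inj: "inj_on (r0 M) (carrier (alg_center T\<^sub>M\<^sub>N))"
  by (rule inj_onI) (auto simp: r0_def MN.center_iff bimod_sum_simps)

text \<open>
  Exactness at the center of the algebra of \<open>M\<close>: a diagonal matrix that is central for \<open>M\<close> is
  central for \<open>M \<oplus> N\<close> exactly when its commutators with \<open>N\<close> vanish as well.
\<close>

lemma r0_image:
  "r0 M ` carrier (alg_center T\<^sub>M\<^sub>N) =
    {z \<in> carrier (alg_center T\<^sub>M). center_act N z = \<zero>\<^bsub>bimod_hom K A B N N\<^esub>}"
proof (intro equalityI subsetI)
  fix z assume "z \<in> r0 M ` carrier (alg_center T\<^sub>M\<^sub>N)"
  then obtain a x b where x: "(a, x, b) \<in> carrier (alg_center T\<^sub>M\<^sub>N)" and z: "z = (a, \<zero>\<^bsub>M\<^esub>, b)"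
    by (auto simp: r0_def)
  then have "(a, fst x, b) \<in> carrier (alg_center T\<^sub>M)" and "\<forall>n\<in>carrier N. ad_act N a b n = \<zero>\<^bsub>N\<^esub>"
    by (simp_all add: center_sum_iff)
  moreover from this(1) have "fst x = \<zero>\<^bsub>M\<^esub>" by (simp add: M.center_iff)
  ultimately show "z \<in> {z \<in> carrier (alg_center T\<^sub>M). center_act N z = \<zero>\<^bsub>bimod_hom K A B N N\<^esub>}"
    by (auto simp: z center_act_def bimod_hom_ops intro!: restrict_ext)
next
  fix z assume "z \<in> {z \<in> carrier (alg_center T\<^sub>M). center_act N z = \<zero>\<^bsub>bimod_hom K A B N N\<^esub>}"
  then have z: "z \<in> carrier (alg_center T\<^sub>M)" and 0: "center_act N z = (\<lambda>n\<in>carrier N. \<zero>\<^bsub>N\<^esub>)"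
    by (simp_all add: bimod_hom_ops)
  obtain a b where ab: "z = (a, \<zero>\<^bsub>M\<^esub>, b)" "center_act N z = restrict (ad_act N a b) (carrier N)"
    using z by (rule center_actE)
  have "ad_act N a b n = \<zero>\<^bsub>N\<^esub>" if "n \<in> carrier N" for n
    using fun_cong[OF 0, of n] that by (simp add: ab(2))
  then have "(a, (\<zero>\<^bsub>M\<^esub>, \<zero>\<^bsub>N\<^esub>), b) \<in> carrier (alg_center T\<^sub>M\<^sub>N)"
    using z ab(1) by (simp add: center_sum_iff)
  then have "r0 M (a, (\<zero>\<^bsub>M\<^esub>, \<zero>\<^bsub>N\<^esub>), b) \<in> r0 M ` carrier (alg_center T\<^sub>M\<^sub>N)" by (rule imageI)
  then show "z \<in> r0 M ` carrier (alg_center T\<^sub>M\<^sub>N)" by (simp add: r0_def ab(1))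
qed

lemma r1_hom: "r1 K A B M N \<in> mod_hom K (HH1 K T\<^sub>M\<^sub>N) (HH1 K T\<^sub>M)"
  unfolding mod_hom_def
proof (intro CollectI conjI ballI funcsetI)
  fix C assume "C \<in> carrier (HH1 K T\<^sub>M\<^sub>N)"
  then obtain \<alpha> \<gamma> \<beta> where d: "(\<alpha>, \<gamma>, \<beta>) \<in> diag_der_data K A (M \<oplus>\<^sub>b N) B"
    and C: "C = diag_class K A (M \<oplus>\<^sub>b N) B \<alpha> \<gamma> \<beta>" by (rule MN.HH1_cases)
  show "r1 K A B M N C \<in> carrier (HH1 K T\<^sub>M)"
    unfolding C r1_diag_class(2)[OF d] by (rule M.diag_class_in_HH1[OF r1_diag_class(1)[OF d]])
  show "r1 K A B M N (k \<odot>\<^bsub>HH1 K T\<^sub>M\<^sub>N\<^esub> C) = k \<odot>\<^bsub>HH1 K T\<^sub>M\<^esub> r1 K A B M N C" if k: "k \<in> carrier K" for k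
  proof -
    have "comp11 N (\<lambda>m. k \<odot>\<^bsub>M \<oplus>\<^sub>b N\<^esub> \<gamma> m) = (\<lambda>m. k \<odot>\<^bsub>M\<^esub> comp11 N \<gamma> m)"
      by (simp add: comp11_def bimod_sum_proj)
    then show ?thesis
      by (simp add: C MN.diag_class_smult[OF k d] r1_diag_class(2)[OF MN.diag_data_smult[OF k d]]
          r1_diag_class(2)[OF d] M.diag_class_smult[OF k r1_diag_class(1)[OF d]])
  qed
  fix C' assume "C' \<in> carrier (HH1 K T\<^sub>M\<^sub>N)"
  then obtain \<alpha>' \<gamma>' \<beta>' where d': "(\<alpha>', \<gamma>', \<beta>') \<in> diag_der_data K A (M \<oplus>\<^sub>b N) B"
    and C': "C' = diag_class K A (M \<oplus>\<^sub>b N) B \<alpha>' \<gamma>' \<beta>'" by (rule MN.HH1_cases)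
  have "comp11 N (\<lambda>m. \<gamma> m \<oplus>\<^bsub>M \<oplus>\<^sub>b N\<^esub> \<gamma>' m) = (\<lambda>m. comp11 N \<gamma> m \<oplus>\<^bsub>M\<^esub> comp11 N \<gamma>' m)"
    by (simp add: comp11_def bimod_sum_proj)
  then show "r1 K A B M N (C \<oplus>\<^bsub>HH1 K T\<^sub>M\<^sub>N\<^esub> C') = r1 K A B M N C \<oplus>\<^bsub>HH1 K T\<^sub>M\<^esub> r1 K A B M N C'"
    by (simp add: C C' MN.diag_class_add[OF d d'] r1_diag_class(2)[OF MN.diag_data_add[OF d d']]
        r1_diag_class(2)[OF d] r1_diag_class(2)[OF d']
        M.diag_class_add[OF r1_diag_class(1)[OF d] r1_diag_class(1)[OF d']])
qed

lemma block_class_data: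
  assumes "\<phi> \<in> carrier (bimod_hom K A B M N)" "\<nu> \<in> carrier (bimod_hom K A B N N)"
    "\<psi> \<in> carrier (bimod_hom K A B N M)"
  shows "(\<zero>\<^bsub>Der K A\<^esub>, block_end M N (\<lambda>m. \<zero>\<^bsub>M\<^esub>) \<psi> \<phi> \<nu>, \<zero>\<^bsub>Der K B\<^esub>) \<in> diag_der_data K A (M \<oplus>\<^sub>b N) B"
proof -
  have "\<zero>\<^bsub>Der K A\<^esub> \<in> carrier (Der K A)" "\<zero>\<^bsub>Der K B\<^esub> \<in> carrier (Der K B)"
    "(\<lambda>m. \<zero>\<^bsub>M\<^esub>) \<in> compat_end K A M B \<zero>\<^bsub>Der K A\<^esub> \<zero>\<^bsub>Der K B\<^esub>"
    using M.diag_data_zero by (simp_all add: diag_der_data_iff)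
  with assms show ?thesis
    unfolding diag_der_data_iff by (blast intro: block_end_compat N.compat_if_bimod_hom)
qed

lemma block_class_hom: "block_class K A B M N \<in> mod_hom K Homs (HH1 K T\<^sub>M\<^sub>N)"
  unfolding mod_hom_def
proof (intro CollectI conjI ballI funcsetI)
  interpret DA: module K "Der K A" by (rule M.A.module_Der)
  interpret DB: module K "Der K B" by (rule M.B.module_Der)
  fix t assume "t \<in> carrier Homs"
  then obtain \<phi> \<nu> \<psi> where t: "t = (\<phi>, \<nu>, \<psi>)" and h: "\<phi> \<in> carrier (bimod_hom K A B M N)"
    "\<nu> \<in> carrier (bimod_hom K A B N N)" "\<psi> \<in> carrier (bimod_hom K A B N M)"
    by (auto simp: prod_module_simps)
  note c = bimod_hom_closed[OF h(1)] bimod_hom_closed[OF h(2)] bimod_hom_closed[OF h(3)]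
  show "block_class K A B M N t \<in> carrier (HH1 K T\<^sub>M\<^sub>N)"
    by (simp add: t block_class_def MN.diag_class_in_HH1[OF block_class_data[OF h]])
  show "block_class K A B M N (k \<odot>\<^bsub>Homs\<^esub> t) = k \<odot>\<^bsub>HH1 K T\<^sub>M\<^sub>N\<^esub> block_class K A B M N t"
    if k: "k \<in> carrier K" for k
    unfolding t block_class_def prod_module_simps prod.case MN.diag_class_smult[OF k block_class_data[OF h]]
    by (intro arg_cong[where f = "der_class K T\<^sub>M\<^sub>N"] MN.diag_der_cong)
      (use k c in \<open>auto simp: DA.smult_r_null DB.smult_r_null bimod_hom_ops block_end_def bimod_sum_simps
        M.smult_r_distr N.smult_r_distr\<close>)
  fix t' assume "t' \<in> carrier Homs"
  then obtain \<phi>' \<nu>' \<psi>' where t': "t' = (\<phi>', \<nu>', \<psi>')" and h': "\<phi>' \<in> carrier (bimod_hom K A B M N)"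
    "\<nu>' \<in> carrier (bimod_hom K A B N N)" "\<psi>' \<in> carrier (bimod_hom K A B N M)"
    by (auto simp: prod_module_simps)
  note c' = bimod_hom_closed[OF h'(1)] bimod_hom_closed[OF h'(2)] bimod_hom_closed[OF h'(3)]
  show "block_class K A B M N (t \<oplus>\<^bsub>Homs\<^esub> t') =
      block_class K A B M N t \<oplus>\<^bsub>HH1 K T\<^sub>M\<^sub>N\<^esub> block_class K A B M N t'"
    unfolding t t' block_class_def prod_module_simps prod.case
      MN.diag_class_add[OF block_class_data[OF h] block_class_data[OF h']]
    by (intro arg_cong[where f = "der_class K T\<^sub>M\<^sub>N"] MN.diag_der_cong)
      (use c c' in \<open>auto simp: bimod_hom_ops block_end_def bimod_sum_simps M.M.a_ac N.M.a_ac\<close>)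
qed

text \<open>
  A diagonal matrix has a diagonal commutator on \<open>M \<oplus> N\<close>. If the block derivation is inner, then
  comparing blocks gives \<open>\<phi> = 0\<close>, \<open>\<psi> = 0\<close>, zero commutators on \<open>M\<close> and the commutator \<open>\<nu>\<close> on \<open>N\<close>.
\<close>

lemma block_class_zero_iff:
  assumes h: "\<phi> \<in> carrier (bimod_hom K A B M N)" "\<nu> \<in> carrier (bimod_hom K A B N N)"
    "\<psi> \<in> carrier (bimod_hom K A B N M)"
  shows "block_class K A B M N (\<phi>, \<nu>, \<psi>) = \<zero>\<^bsub>HH1 K T\<^sub>M\<^sub>N\<^esub> \<longleftrightarrow>
    \<phi> = \<zero>\<^bsub>bimod_hom K A B M N\<^esub> \<and> \<psi> = \<zero>\<^bsub>bimod_hom K A B N M\<^esub> \<and>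
    \<nu> \<in> center_act N ` carrier (alg_center T\<^sub>M)" (is "?L \<longleftrightarrow> ?R")
proof -
  \<comment> \<open>The block \<open>M \<rightarrow> M\<close> is zero, so equality with a commutator forces the commutator on \<open>M\<close> to vanish.\<close>
  let ?\<gamma> = "block_end M N (\<lambda>m. \<zero>\<^bsub>M\<^esub>) \<psi> \<phi> \<nu>"
  note c = bimod_hom_closed[OF h(1)] bimod_hom_closed[OF h(2)] bimod_hom_closed[OF h(3)]
  have zero_M: "\<phi> \<zero>\<^bsub>M\<^esub> = \<zero>\<^bsub>N\<^esub>" and zero_N: "\<nu> \<zero>\<^bsub>N\<^esub> = \<zero>\<^bsub>N\<^esub>" "\<psi> \<zero>\<^bsub>N\<^esub> = \<zero>\<^bsub>M\<^esub>"
    using bimod_hom_lact[OF h(1), of "\<zero>\<^bsub>A\<^esub>" "\<zero>\<^bsub>M\<^esub>"] bimod_hom_lact[OF h(2), of "\<zero>\<^bsub>A\<^esub>" "\<zero>\<^bsub>N\<^esub>"]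
      bimod_hom_lact[OF h(3), of "\<zero>\<^bsub>A\<^esub>" "\<zero>\<^bsub>N\<^esub>"] c by simp_all
  have L: "?L \<longleftrightarrow> (\<exists>a\<in>carrier A. \<exists>b\<in>carrier B.
      (\<forall>x\<in>carrier A. \<zero>\<^bsub>A\<^esub> = ad A a x) \<and>
      (\<forall>p\<in>carrier (M \<oplus>\<^sub>b N). ?\<gamma> p = ad_act (M \<oplus>\<^sub>b N) a b p) \<and>
      (\<forall>y\<in>carrier B. \<zero>\<^bsub>B\<^esub> = ad B b y))"
    unfolding block_class_def prod.case MN.HH1_zero_diag
      MN.diag_class_eq_iff[OF block_class_data[OF h] MN.diag_data_zero]
    by (simp add: M.A.Der_ops M.B.Der_ops M.A.ad_closed M.B.ad_closed MN.ad_act_closed cong: bex_cong)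
  show ?thesis
  proof
    assume ?L
    then obtain a b where ab: "a \<in> carrier A" "b \<in> carrier B" and adA: "\<forall>x\<in>carrier A. ad A a x = \<zero>\<^bsub>A\<^esub>"
      and adB: "\<forall>y\<in>carrier B. ad B b y = \<zero>\<^bsub>B\<^esub>"
      and eq: "\<And>m n. \<lbrakk>m \<in> carrier M; n \<in> carrier N\<rbrakk> \<Longrightarrow> ?\<gamma> (m, n) = ad_act (M \<oplus>\<^sub>b N) a b (m, n)"
      unfolding L by (auto simp: bimod_sum_simps)
    have eq1: "\<psi> n = ad_act M a b m" and eq2: "\<phi> m \<oplus>\<^bsub>N\<^esub> \<nu> n = ad_act N a b n"
      if "m \<in> carrier M" "n \<in> carrier N" for m n
      using eq[OF that] that ab by (simp_all add: block_end_def ad_act_sum c)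
    have M0: "\<forall>m\<in>carrier M. ad_act M a b m = \<zero>\<^bsub>M\<^esub>" using eq1[OF _ N.M.zero_closed] zero_N by simp
    have \<psi>0: "\<psi> n = \<zero>\<^bsub>M\<^esub>" if "n \<in> carrier N" for n
      using eq1[OF M.M.zero_closed that] M0 by simp
    have \<phi>0: "\<phi> m = \<zero>\<^bsub>N\<^esub>" if "m \<in> carrier M" for m
      using eq2[OF that N.M.zero_closed] that ab by (simp add: zero_N c N.ad_act_zero)
    have \<nu>0: "\<nu> n = ad_act N a b n" if "n \<in> carrier N" for n
      using eq2[OF M.M.zero_closed that] that by (simp add: zero_M c)
    have z: "(a, \<zero>\<^bsub>M\<^esub>, b) \<in> carrier (alg_center T\<^sub>M)"
      using ab adA adB M0 by (simp add: M.center_iff)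
    have "\<nu> = center_act N (a, \<zero>\<^bsub>M\<^esub>, b)"
      by (rule extensionalityI[OF bimod_hom_extensional[OF h(2)]]) (simp_all add: center_act_def \<nu>0)
    moreover have "\<phi> = \<zero>\<^bsub>bimod_hom K A B M N\<^esub>"
      by (rule extensionalityI[OF bimod_hom_extensional[OF h(1)]]) (simp_all add: bimod_hom_ops \<phi>0)
    moreover have "\<psi> = \<zero>\<^bsub>bimod_hom K A B N M\<^esub>"
      by (rule extensionalityI[OF bimod_hom_extensional[OF h(3)]]) (simp_all add: bimod_hom_ops \<psi>0)
    ultimately show ?R using z by blast
  next
    assume R: ?R
    then obtain z where z: "z \<in> carrier (alg_center T\<^sub>M)" and \<nu>: "\<nu> = center_act N z" by blast
    from z obtain a b where ab: "a \<in> carrier A" "b \<in> carrier B" "z = (a, \<zero>\<^bsub>M\<^esub>, b)"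
      "\<And>x. x \<in> carrier A \<Longrightarrow> ad A a x = \<zero>\<^bsub>A\<^esub>" "\<And>y. y \<in> carrier B \<Longrightarrow> ad B b y = \<zero>\<^bsub>B\<^esub>"
      "\<And>m. m \<in> carrier M \<Longrightarrow> ad_act M a b m = \<zero>\<^bsub>M\<^esub>" "center_act N z = restrict (ad_act N a b) (carrier N)"
      by (rule center_actE) blast
    have "?\<gamma> p = ad_act (M \<oplus>\<^sub>b N) a b p" if "p \<in> carrier (M \<oplus>\<^sub>b N)" for p
      using that R ab by (auto simp: bimod_sum_simps block_end_def \<nu> ad_act_sum bimod_hom_ops N.ad_act_closed)
    then show ?L unfolding L using ab by (intro bexI[of _ a] bexI[of _ b]) auto
  qed
qed

lemma r1_block_class:
  assumes "t \<in> carrier Homs"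
  shows "r1 K A B M N (block_class K A B M N t) = \<zero>\<^bsub>HH1 K T\<^sub>M\<^esub>"
proof -
  obtain \<phi> \<nu> \<psi> where t: "t = (\<phi>, \<nu>, \<psi>)" and h: "\<phi> \<in> carrier (bimod_hom K A B M N)"
    "\<nu> \<in> carrier (bimod_hom K A B N N)" "\<psi> \<in> carrier (bimod_hom K A B N M)"
    using assms by (auto simp: prod_module_simps)
  have "\<psi> \<zero>\<^bsub>N\<^esub> = \<zero>\<^bsub>M\<^esub>"
    using bimod_hom_lact[OF h(3), of "\<zero>\<^bsub>A\<^esub>" "\<zero>\<^bsub>N\<^esub>"] bimod_hom_closed[OF h(3)] by simp
  then have "comp11 N (block_end M N (\<lambda>m. \<zero>\<^bsub>M\<^esub>) \<psi> \<phi> \<nu>) = (\<lambda>m. \<zero>\<^bsub>M\<^esub>)"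
    by (simp add: comp11_def block_end_def)
  then show ?thesis
    by (simp add: t block_class_def r1_diag_class(2)[OF block_class_data[OF h]] M.HH1_zero_diag)
qed

text \<open>
  The off-diagonal blocks of the lift are those of \<open>\<gamma>\<close> itself. This makes one lemma sufficient
  for both sequences: if they vanish, the class comes from an endomorphism of \<open>N\<close> alone.
\<close>

lemma r1_zero_lift:
  assumes d: "(\<alpha>, \<gamma>, \<beta>) \<in> diag_der_data K A (M \<oplus>\<^sub>b N) B"
    and zero: "r1 K A B M N (diag_class K A (M \<oplus>\<^sub>b N) B \<alpha> \<gamma> \<beta>) = \<zero>\<^bsub>HH1 K T\<^sub>M\<^esub>"
  shows "\<exists>\<nu>\<in>carrier (bimod_hom K A B N N).
    diag_class K A (M \<oplus>\<^sub>b N) B \<alpha> \<gamma> \<beta> = block_class K A B M N (comp21 M N \<gamma>, \<nu>, comp12 M N \<gamma>)"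
proof -
  have \<gamma>: "\<gamma> \<in> compat_end K A (M \<oplus>\<^sub>b N) B \<alpha> \<beta>" and \<alpha>: "\<alpha> \<in> carrier (Der K A)" and \<beta>: "\<beta> \<in> carrier (Der K B)"
    using d by (simp_all add: diag_der_data_iff)
  note comps = comp11_compat[OF \<gamma> \<alpha> \<beta>] comp22_compat[OF \<gamma> \<alpha> \<beta>] comp12_hom[OF \<gamma> \<alpha> \<beta>] comp21_hom[OF \<gamma> \<alpha> \<beta>]
  note c = N.compat_closed[OF comps(2)] bimod_hom_closed[OF comps(3)] bimod_hom_closed[OF comps(4)]
  have "diag_class K A M B \<alpha> (comp11 N \<gamma>) \<beta> = diag_class K A M B \<zero>\<^bsub>Der K A\<^esub> (\<lambda>m. \<zero>\<^bsub>M\<^esub>) \<zero>\<^bsub>Der K B\<^esub>"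
    using zero by (simp add: r1_diag_class(2)[OF d] M.HH1_zero_diag)
  then obtain a b where ab: "a \<in> carrier A" "b \<in> carrier B"
    and eq: "\<forall>x\<in>carrier A. \<alpha> x = ad A a x \<oplus>\<^bsub>A\<^esub> \<zero>\<^bsub>Der K A\<^esub> x"
      "\<forall>m\<in>carrier M. comp11 N \<gamma> m = ad_act M a b m \<oplus>\<^bsub>M\<^esub> \<zero>\<^bsub>M\<^esub>"
      "\<forall>y\<in>carrier B. \<beta> y = ad B b y \<oplus>\<^bsub>B\<^esub> \<zero>\<^bsub>Der K B\<^esub> y"
    unfolding M.diag_class_eq_iff[OF r1_diag_class(1)[OF d] M.diag_data_zero] by blast
  have eq': "\<alpha> x = ad A a x" "comp11 N \<gamma> m = ad_act M a b m" "\<beta> y = ad B b y"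
    if "x \<in> carrier A" "m \<in> carrier M" "y \<in> carrier B" for x m y
    using eq that ab by (simp_all add: M.A.Der_ops M.B.Der_ops M.A.ad_closed M.B.ad_closed M.ad_act_closed)
  \<comment> \<open>Subtracting the inner derivation leaves \<open>\<alpha> = 0\<close> and \<open>\<beta> = 0\<close>, so the corrected block is a bimodule map.\<close>
  define \<nu> where "\<nu> = (\<lambda>n\<in>carrier N. comp22 M \<gamma> n \<oplus>\<^bsub>N\<^esub> ad_act N (\<ominus>\<^bsub>A\<^esub> a) (\<ominus>\<^bsub>B\<^esub> b) n)"
  have ab': "\<ominus>\<^bsub>A\<^esub> a \<in> carrier A" "\<ominus>\<^bsub>B\<^esub> b \<in> carrier B" using ab by simp_all
  have "(\<lambda>n. comp22 M \<gamma> n \<oplus>\<^bsub>N\<^esub> ad_act N (\<ominus>\<^bsub>A\<^esub> a) (\<ominus>\<^bsub>B\<^esub> b) n) \<in>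
      compat_end K A N B (\<lambda>x. \<alpha> x \<oplus>\<^bsub>A\<^esub> ad A (\<ominus>\<^bsub>A\<^esub> a) x) (\<lambda>y. \<beta> y \<oplus>\<^bsub>B\<^esub> ad B (\<ominus>\<^bsub>B\<^esub> b) y)"
    by (rule N.compat_end_sum[OF comps(2) N.ad_act_compat[OF ab']])
      (simp_all add: M.A.Der_closed[OF \<alpha>] M.B.Der_closed[OF \<beta>] M.A.ad_closed M.B.ad_closed ab)
  then have \<nu>: "\<nu> \<in> carrier (bimod_hom K A B N N)"
    unfolding \<nu>_def
    by (rule N.bimod_hom_if_compat) (use eq'(1)[OF _ M.M.zero_closed M.B.zero_closed]
        eq'(3)[OF M.A.zero_closed M.M.zero_closed] ab
        in \<open>simp_all add: M.A.ad_uminus M.B.ad_uminus M.A.M.r_neg M.B.M.r_neg M.A.ad_closed M.B.ad_closed\<close>)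
  have cancel: "x \<oplus>\<^bsub>N\<^esub> (y \<oplus>\<^bsub>N\<^esub> (w \<oplus>\<^bsub>N\<^esub> \<ominus>\<^bsub>N\<^esub> x)) = y \<oplus>\<^bsub>N\<^esub> w"
    if "x \<in> carrier N" "y \<in> carrier N" "w \<in> carrier N" for x y w
  proof -
    have "y \<oplus>\<^bsub>N\<^esub> (w \<oplus>\<^bsub>N\<^esub> \<ominus>\<^bsub>N\<^esub> x) = \<ominus>\<^bsub>N\<^esub> x \<oplus>\<^bsub>N\<^esub> (y \<oplus>\<^bsub>N\<^esub> w)"
      using that by (simp add: N.M.a_ac)
    then show ?thesis using that by (simp add: N.M.r_neg2)
  qed
  have "\<gamma> p = ad_act (M \<oplus>\<^sub>b N) a b p \<oplus>\<^bsub>M \<oplus>\<^sub>b N\<^esub>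
      block_end M N (\<lambda>m. \<zero>\<^bsub>M\<^esub>) (comp12 M N \<gamma>) (comp21 M N \<gamma>) \<nu> p" if "p \<in> carrier (M \<oplus>\<^sub>b N)" for p
  proof -
    obtain m n where p: "p = (m, n)" by (cases p)
    then have mn: "m \<in> carrier M" "n \<in> carrier N" using that by (simp_all add: bimod_sum_simps)
    show ?thesis
      using mn ab unfolding p block_decomp[OF \<gamma> \<alpha> \<beta> mn]
      by (simp add: block_end_def bimod_sum_simps ad_act_sum \<nu>_def c N.ad_act_uminus N.ad_act_closed
          eq'(2)[OF M.A.zero_closed mn(1) M.B.zero_closed] cancel)
  qed
  then have "diag_class K A (M \<oplus>\<^sub>b N) B \<alpha> \<gamma> \<beta> = block_class K A B M N (comp21 M N \<gamma>, \<nu>, comp12 M N \<gamma>)"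
    unfolding block_class_def prod.case
      MN.diag_class_eq_iff[OF d block_class_data[OF comps(4) \<nu> comps(3)]]
    using ab eq(1,3) by blast
  with \<nu> show ?thesis by blast
qed

lemma H1_sub_carrier:
  "carrier (H1_sub K A B M N) = {diag_class K A (M \<oplus>\<^sub>b N) B \<alpha> \<gamma> \<beta> |\<alpha> \<gamma> \<beta>.
    (\<alpha>, \<gamma>, \<beta>) \<in> diag_der_data K A (M \<oplus>\<^sub>b N) B \<and>
    (\<forall>m\<in>carrier M. snd (\<gamma> (m, \<zero>\<^bsub>N\<^esub>)) = \<zero>\<^bsub>N\<^esub>) \<and> (\<forall>n\<in>carrier N. fst (\<gamma> (\<zero>\<^bsub>M\<^esub>, n)) = \<zero>\<^bsub>M\<^esub>)}"
  by (simp only: H1_sub_def carrier_update image_triples)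

lemma H1_sub_memI:
  assumes "(\<alpha>, \<gamma>, \<beta>) \<in> diag_der_data K A (M \<oplus>\<^sub>b N) B"
    "\<And>m. m \<in> carrier M \<Longrightarrow> snd (\<gamma> (m, \<zero>\<^bsub>N\<^esub>)) = \<zero>\<^bsub>N\<^esub>"
    "\<And>n. n \<in> carrier N \<Longrightarrow> fst (\<gamma> (\<zero>\<^bsub>M\<^esub>, n)) = \<zero>\<^bsub>M\<^esub>"
  shows "diag_class K A (M \<oplus>\<^sub>b N) B \<alpha> \<gamma> \<beta> \<in> carrier (H1_sub K A B M N)"
  unfolding H1_sub_carrier using assms by blast

lemma H1_sub_memE:
  assumes "C \<in> carrier (H1_sub K A B M N)"
  obtains \<alpha> \<gamma> \<beta> where "(\<alpha>, \<gamma>, \<beta>) \<in> diag_der_data K A (M \<oplus>\<^sub>b N) B"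
    "C = diag_class K A (M \<oplus>\<^sub>b N) B \<alpha> \<gamma> \<beta>"
    "\<forall>m\<in>carrier M. snd (\<gamma> (m, \<zero>\<^bsub>N\<^esub>)) = \<zero>\<^bsub>N\<^esub>" "\<forall>n\<in>carrier N. fst (\<gamma> (\<zero>\<^bsub>M\<^esub>, n)) = \<zero>\<^bsub>M\<^esub>"
  using assms unfolding H1_sub_carrier by blast

lemma H1_sub_ops:
  "\<zero>\<^bsub>H1_sub K A B M N\<^esub> = \<zero>\<^bsub>HH1 K T\<^sub>M\<^sub>N\<^esub>"
  "C \<oplus>\<^bsub>H1_sub K A B M N\<^esub> D = C \<oplus>\<^bsub>HH1 K T\<^sub>M\<^sub>N\<^esub> D"
  "k \<odot>\<^bsub>H1_sub K A B M N\<^esub> C = k \<odot>\<^bsub>HH1 K T\<^sub>M\<^sub>N\<^esub> C"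
  by (simp_all add: H1_sub_def)

lemma H1_sub_subset: "carrier (H1_sub K A B M N) \<subseteq> carrier (HH1 K T\<^sub>M\<^sub>N)"
  by (auto elim!: H1_sub_memE simp: MN.diag_class_in_HH1)

lemma H1_sub_submodule: "submodule (carrier (H1_sub K A B M N)) K (HH1 K T\<^sub>M\<^sub>N)"
proof -
  interpret HH: module K "HH1 K T\<^sub>M\<^sub>N" by (rule MN.T.module_HH1)
  show ?thesis
  proof (rule HH.submodule_scalarI)
    show "carrier (H1_sub K A B M N) \<subseteq> carrier (HH1 K T\<^sub>M\<^sub>N)" by (rule H1_sub_subset)
    show "\<zero>\<^bsub>HH1 K T\<^sub>M\<^sub>N\<^esub> \<in> carrier (H1_sub K A B M N)"
      unfolding MN.HH1_zero_diag
      by (rule H1_sub_memI[OF MN.diag_data_zero]) (simp_all add: bimod_sum_simps)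
  next
    fix C D assume C: "C \<in> carrier (H1_sub K A B M N)" and D: "D \<in> carrier (H1_sub K A B M N)"
    obtain \<alpha> \<gamma> \<beta> where d: "(\<alpha>, \<gamma>, \<beta>) \<in> diag_der_data K A (M \<oplus>\<^sub>b N) B"
      and C: "C = diag_class K A (M \<oplus>\<^sub>b N) B \<alpha> \<gamma> \<beta>"
      and z: "\<forall>m\<in>carrier M. snd (\<gamma> (m, \<zero>\<^bsub>N\<^esub>)) = \<zero>\<^bsub>N\<^esub>" "\<forall>n\<in>carrier N. fst (\<gamma> (\<zero>\<^bsub>M\<^esub>, n)) = \<zero>\<^bsub>M\<^esub>"
      using C by (rule H1_sub_memE)
    obtain \<alpha>' \<gamma>' \<beta>' where d': "(\<alpha>', \<gamma>', \<beta>') \<in> diag_der_data K A (M \<oplus>\<^sub>b N) B"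
      and D: "D = diag_class K A (M \<oplus>\<^sub>b N) B \<alpha>' \<gamma>' \<beta>'"
      and z': "\<forall>m\<in>carrier M. snd (\<gamma>' (m, \<zero>\<^bsub>N\<^esub>)) = \<zero>\<^bsub>N\<^esub>" "\<forall>n\<in>carrier N. fst (\<gamma>' (\<zero>\<^bsub>M\<^esub>, n)) = \<zero>\<^bsub>M\<^esub>"
      using D by (rule H1_sub_memE)
    show "C \<oplus>\<^bsub>HH1 K T\<^sub>M\<^sub>N\<^esub> D \<in> carrier (H1_sub K A B M N)"
      unfolding C D MN.diag_class_add[OF d d']
      by (rule H1_sub_memI[OF MN.diag_data_add[OF d d']]) (simp_all add: bimod_sum_proj z z')
  next
    fix k C assume k: "k \<in> carrier K" and C: "C \<in> carrier (H1_sub K A B M N)"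
    obtain \<alpha> \<gamma> \<beta> where d: "(\<alpha>, \<gamma>, \<beta>) \<in> diag_der_data K A (M \<oplus>\<^sub>b N) B"
      and C: "C = diag_class K A (M \<oplus>\<^sub>b N) B \<alpha> \<gamma> \<beta>"
      and z: "\<forall>m\<in>carrier M. snd (\<gamma> (m, \<zero>\<^bsub>N\<^esub>)) = \<zero>\<^bsub>N\<^esub>" "\<forall>n\<in>carrier N. fst (\<gamma> (\<zero>\<^bsub>M\<^esub>, n)) = \<zero>\<^bsub>M\<^esub>"
      using C by (rule H1_sub_memE)
    show "k \<odot>\<^bsub>HH1 K T\<^sub>M\<^sub>N\<^esub> C \<in> carrier (H1_sub K A B M N)"
      unfolding C MN.diag_class_smult[OF k d]
      by (rule H1_sub_memI[OF MN.diag_data_smult[OF k d]]) (simp_all add: bimod_sum_proj z k)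
  qed
qed

lemma module_H1_sub: "module K (H1_sub K A B M N)"
proof -
  have "H1_sub K A B M N = (HH1 K T\<^sub>M\<^sub>N)\<lparr>carrier := carrier (H1_sub K A B M N)\<rparr>"
    by (simp add: H1_sub_def)
  then show ?thesis
    using submodule.submodule_is_module[OF H1_sub_submodule MN.T.module_HH1] by simp
qed

text \<open>
  The middle entry over \<open>M\<close> and one over \<open>N\<close> for the same \<open>\<alpha>\<close> and \<open>\<beta>\<close> form a block diagonal entry
  over \<open>M \<oplus> N\<close>. The lift therefore lies in \<open>H1_sub\<close>, which settles surjectivity for \<open>r1\<close> and \<open>rho1\<close>
  at once.
\<close>

lemma H1_sub_lift:
  assumes lift: "\<And>\<alpha> \<beta>. \<lbrakk>\<alpha> \<in> carrier (Der K A); \<beta> \<in> carrier (Der K B); compat_end K A M B \<alpha> \<beta> \<noteq> {}\<rbrakk>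
      \<Longrightarrow> compat_end K A N B \<alpha> \<beta> \<noteq> {}"
  shows "carrier (HH1 K T\<^sub>M) \<subseteq> r1 K A B M N ` carrier (H1_sub K A B M N)"
proof
  fix C assume "C \<in> carrier (HH1 K T\<^sub>M)"
  then obtain \<alpha> \<mu> \<beta> where d: "(\<alpha>, \<mu>, \<beta>) \<in> diag_der_data K A M B" and C: "C = diag_class K A M B \<alpha> \<mu> \<beta>"
    by (rule M.HH1_cases)
  then have \<alpha>: "\<alpha> \<in> carrier (Der K A)" and \<beta>: "\<beta> \<in> carrier (Der K B)" and \<mu>: "\<mu> \<in> compat_end K A M B \<alpha> \<beta>"
    by (simp_all add: diag_der_data_iff)
  with lift obtain \<nu> where \<nu>: "\<nu> \<in> compat_end K A N B \<alpha> \<beta>" by blast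
  define \<gamma> where "\<gamma> = block_end M N \<mu> (\<lambda>n\<in>carrier N. \<zero>\<^bsub>M\<^esub>) (\<lambda>m\<in>carrier M. \<zero>\<^bsub>N\<^esub>) \<nu>"
  have "(\<lambda>m\<in>carrier M. \<zero>\<^bsub>N\<^esub>) \<in> carrier (bimod_hom K A B M N)"
    "(\<lambda>n\<in>carrier N. \<zero>\<^bsub>M\<^esub>) \<in> carrier (bimod_hom K A B N M)"
    by (rule M.bimod_homI N.bimod_homI; simp)+
  then have \<gamma>: "(\<alpha>, \<gamma>, \<beta>) \<in> diag_der_data K A (M \<oplus>\<^sub>b N) B"
    unfolding diag_der_data_iff \<gamma>_def using \<alpha> \<beta> \<mu> \<nu> by (blast intro: block_end_compat)
  have \<gamma>0: "\<gamma> (m, \<zero>\<^bsub>N\<^esub>) = (\<mu> m, \<zero>\<^bsub>N\<^esub>)" "\<gamma> (\<zero>\<^bsub>M\<^esub>, n) = (\<zero>\<^bsub>M\<^esub>, \<nu> n)" if "m \<in> carrier M" "n \<in> carrier N" for m n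
    using that by (simp_all add: \<gamma>_def block_end_def M.compat_closed[OF \<mu>] N.compat_closed[OF \<nu>]
      M.compat_zero[OF \<mu>] N.compat_zero[OF \<nu>])
  have "diag_class K A (M \<oplus>\<^sub>b N) B \<alpha> \<gamma> \<beta> \<in> carrier (H1_sub K A B M N)"
    by (rule H1_sub_memI[OF \<gamma>]) (simp_all add: \<gamma>0(1)[OF _ N.M.zero_closed] \<gamma>0(2)[OF M.M.zero_closed])
  moreover have "diag_der A M B \<alpha> (comp11 N \<gamma>) \<beta> = diag_der A M B \<alpha> \<mu> \<beta>"
    by (rule M.diag_der_cong) (simp_all add: comp11_def \<gamma>0(1)[OF _ N.M.zero_closed])
  then have "r1 K A B M N (diag_class K A (M \<oplus>\<^sub>b N) B \<alpha> \<gamma> \<beta>) = C"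
    by (simp add: r1_diag_class(2)[OF \<gamma>] C)
  ultimately show "C \<in> r1 K A B M N ` carrier (H1_sub K A B M N)" by blast
qed

text \<open>
  Surjectivity only yields a lift for some \<open>\<alpha>', \<beta>'\<close> in the classes of \<open>\<alpha>, \<beta>\<close>. Adding \<open>ad_act N a b\<close> to its
  block \<open>N \<rightarrow> N\<close> returns to the given derivations.
\<close>

lemma delta_iff:
  "N \<in> delta K A B M \<longleftrightarrow> (\<forall>\<alpha>\<in>carrier (Der K A). \<forall>\<beta>\<in>carrier (Der K B).
    compat_end K A M B \<alpha> \<beta> \<noteq> {} \<longrightarrow> compat_end K A N B \<alpha> \<beta> \<noteq> {})" (is "_ \<longleftrightarrow> ?R")
proof
  assume "N \<in> delta K A B M"
  then have surj: "r1 K A B M N ` carrier (HH1 K T\<^sub>M\<^sub>N) = carrier (HH1 K T\<^sub>M)" by (simp add: delta_def)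
  have "compat_end K A N B \<alpha> \<beta> \<noteq> {}"
    if \<alpha>: "\<alpha> \<in> carrier (Der K A)" and \<beta>: "\<beta> \<in> carrier (Der K B)" and \<mu>: "\<mu> \<in> compat_end K A M B \<alpha> \<beta>" for \<alpha> \<beta> \<mu>
  proof -
    have d: "(\<alpha>, \<mu>, \<beta>) \<in> diag_der_data K A M B" using \<alpha> \<beta> \<mu> by (simp add: diag_der_data_iff)
    then obtain C where C: "C \<in> carrier (HH1 K T\<^sub>M\<^sub>N)" "diag_class K A M B \<alpha> \<mu> \<beta> = r1 K A B M N C"
      using M.diag_class_in_HH1[OF d] unfolding surj[symmetric] by blast
    from C(1) obtain \<alpha>' \<gamma>' \<beta>' where d': "(\<alpha>', \<gamma>', \<beta>') \<in> diag_der_data K A (M \<oplus>\<^sub>b N) B"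
      and "C = diag_class K A (M \<oplus>\<^sub>b N) B \<alpha>' \<gamma>' \<beta>'" by (rule MN.HH1_cases)
    then have "diag_class K A M B \<alpha> \<mu> \<beta> = diag_class K A M B \<alpha>' (comp11 N \<gamma>') \<beta>'"
      using C(2) by (simp add: r1_diag_class(2)[OF d'])
    then obtain a b where ab: "a \<in> carrier A" "b \<in> carrier B"
      and eq: "\<forall>x\<in>carrier A. \<alpha> x = ad A a x \<oplus>\<^bsub>A\<^esub> \<alpha>' x" "\<forall>y\<in>carrier B. \<beta> y = ad B b y \<oplus>\<^bsub>B\<^esub> \<beta>' y"
      unfolding M.diag_class_eq_iff[OF d r1_diag_class(1)[OF d']] by blast
    have \<alpha>': "\<alpha>' \<in> carrier (Der K A)" and \<beta>': "\<beta>' \<in> carrier (Der K B)"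
      and \<gamma>': "\<gamma>' \<in> compat_end K A (M \<oplus>\<^sub>b N) B \<alpha>' \<beta>'"
      using d' by (simp_all add: diag_der_data_iff)
    have "(\<lambda>n. ad_act N a b n \<oplus>\<^bsub>N\<^esub> comp22 M \<gamma>' n) \<in>
        compat_end K A N B (\<lambda>x. ad A a x \<oplus>\<^bsub>A\<^esub> \<alpha>' x) (\<lambda>y. ad B b y \<oplus>\<^bsub>B\<^esub> \<beta>' y)"
      by (rule N.compat_end_sum[OF N.ad_act_compat[OF ab] comp22_compat[OF \<gamma>' \<alpha>' \<beta>']])
        (simp_all add: ab M.A.ad_closed M.B.ad_closed M.A.Der_closed[OF \<alpha>'] M.B.Der_closed[OF \<beta>'])
    then have "(\<lambda>n. ad_act N a b n \<oplus>\<^bsub>N\<^esub> comp22 M \<gamma>' n) \<in> compat_end K A N B \<alpha> \<beta>"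
      by (rule N.compat_end_cong) (use eq in simp_all)
    then show ?thesis by blast
  qed
  then show ?R by blast
next
  assume R: ?R
  have "carrier (HH1 K T\<^sub>M) \<subseteq> r1 K A B M N ` carrier (HH1 K T\<^sub>M\<^sub>N)"
    using H1_sub_lift R image_mono[OF H1_sub_subset] by (meson order.trans)
  moreover have "r1 K A B M N ` carrier (HH1 K T\<^sub>M\<^sub>N) \<subseteq> carrier (HH1 K T\<^sub>M)"
    using r1_hom by (auto simp: mod_hom_def)
  moreover have "bimodule K A B N" by unfold_locales
  ultimately show "N \<in> delta K A B M" by (auto simp: delta_def)
qed

section \<open>Exactness\<close>

lemma center_act_in_Hom:
  "z \<in> carrier (alg_center T\<^sub>M) \<Longrightarrow> center_act N z \<in> carrier (bimod_hom K A B N N)"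
  using center_act_hom by (auto simp: mod_hom_def)

context
  assumes delta: "N \<in> delta K A B M"
begin

lemma exact_HH1:
  "exact_seq5 K (alg_center T\<^sub>M\<^sub>N) (r0 M) (alg_center T\<^sub>M)
    (\<lambda>z. (\<zero>\<^bsub>bimod_hom K A B M N\<^esub>, center_act N z, \<zero>\<^bsub>bimod_hom K A B N M\<^esub>)) Homs
    (block_class K A B M N) (HH1 K T\<^sub>M\<^sub>N) (r1 K A B M N) (HH1 K T\<^sub>M)"
proof -
  interpret NM: bimodule_pair K A B N M ..
  interpret NN: bimodule_pair K A B N N ..
  interpret HMN: module K "bimod_hom K A B M N" by (rule module_bimod_hom)
  interpret HNM: module K "bimod_hom K A B N M" by (rule NM.module_bimod_hom)
  let ?f = "\<lambda>z. (\<zero>\<^bsub>bimod_hom K A B M N\<^esub>, center_act N z, \<zero>\<^bsub>bimod_hom K A B N M\<^esub>)"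
  have Homs: "module K Homs"
    by (intro module_prod_module module_bimod_hom NM.module_bimod_hom NN.module_bimod_hom)
  have f: "?f \<in> mod_hom K (alg_center T\<^sub>M) Homs"
    using center_act_hom HMN.smult_r_null HNM.smult_r_null
    by (auto simp: mod_hom_def prod_module_simps)
  have 1: "r0 M ` carrier (alg_center T\<^sub>M\<^sub>N) = a_kernel (alg_center T\<^sub>M) Homs ?f"
    unfolding r0_image a_kernel_def' by (simp add: prod_module_simps)
  have 2: "?f ` carrier (alg_center T\<^sub>M) = a_kernel Homs (HH1 K T\<^sub>M\<^sub>N) (block_class K A B M N)"
  proof (intro equalityI subsetI)
    fix t assume "t \<in> ?f ` carrier (alg_center T\<^sub>M)"
    then obtain z where z: "z \<in> carrier (alg_center T\<^sub>M)" and t: "t = ?f z" by blast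
    show "t \<in> a_kernel Homs (HH1 K T\<^sub>M\<^sub>N) (block_class K A B M N)"
      unfolding t a_kernel_def'
      using z block_class_zero_iff[OF HMN.M.zero_closed center_act_in_Hom[OF z] HNM.M.zero_closed]
      by (simp add: prod_module_simps center_act_in_Hom)
  next
    fix t assume "t \<in> a_kernel Homs (HH1 K T\<^sub>M\<^sub>N) (block_class K A B M N)"
    then obtain \<phi> \<nu> \<psi> where t: "t = (\<phi>, \<nu>, \<psi>)" and h: "\<phi> \<in> carrier (bimod_hom K A B M N)"
      "\<nu> \<in> carrier (bimod_hom K A B N N)" "\<psi> \<in> carrier (bimod_hom K A B N M)"
      and z: "block_class K A B M N (\<phi>, \<nu>, \<psi>) = \<zero>\<^bsub>HH1 K T\<^sub>M\<^sub>N\<^esub>"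
      by (auto simp: a_kernel_def' prod_module_simps)
    then show "t \<in> ?f ` carrier (alg_center T\<^sub>M)"
      unfolding t using z[unfolded block_class_zero_iff[OF h]] by blast
  qed
  have 3: "block_class K A B M N ` carrier Homs = a_kernel (HH1 K T\<^sub>M\<^sub>N) (HH1 K T\<^sub>M) (r1 K A B M N)"
  proof (intro equalityI subsetI)
    fix C assume "C \<in> block_class K A B M N ` carrier Homs"
    then show "C \<in> a_kernel (HH1 K T\<^sub>M\<^sub>N) (HH1 K T\<^sub>M) (r1 K A B M N)"
      using block_class_hom r1_block_class by (auto simp: a_kernel_def' mod_hom_def)
  next
    fix C assume "C \<in> a_kernel (HH1 K T\<^sub>M\<^sub>N) (HH1 K T\<^sub>M) (r1 K A B M N)"
    then have C: "C \<in> carrier (HH1 K T\<^sub>M\<^sub>N)" and z: "r1 K A B M N C = \<zero>\<^bsub>HH1 K T\<^sub>M\<^esub>"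
      by (simp_all add: a_kernel_def')
    obtain \<alpha> \<gamma> \<beta> where d: "(\<alpha>, \<gamma>, \<beta>) \<in> diag_der_data K A (M \<oplus>\<^sub>b N) B"
      and eq: "C = diag_class K A (M \<oplus>\<^sub>b N) B \<alpha> \<gamma> \<beta>" using C by (rule MN.HH1_cases)
    obtain \<nu> where \<nu>: "\<nu> \<in> carrier (bimod_hom K A B N N)"
      and *: "C = block_class K A B M N (comp21 M N \<gamma>, \<nu>, comp12 M N \<gamma>)"
      using r1_zero_lift[OF d z[unfolded eq]] unfolding eq by blast
    have "(comp21 M N \<gamma>, \<nu>, comp12 M N \<gamma>) \<in> carrier Homs"
      using d \<nu> by (auto simp: prod_module_simps diag_der_data_iff intro: comp12_hom comp21_hom)
    then show "C \<in> block_class K A B M N ` carrier Homs" unfolding * by (rule imageI)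
  qed
  have 4: "r1 K A B M N ` carrier (HH1 K T\<^sub>M\<^sub>N) = carrier (HH1 K T\<^sub>M)"
    using delta by (simp add: delta_def)
  show ?thesis
    unfolding exact_seq5_def
    by (intro conjI MN.T.module_center M.T.module_center Homs MN.T.module_HH1 M.T.module_HH1
        r0_hom f block_class_hom r1_hom r0_inj 1 2 3 4)
qed

lemma exact_H1_sub:
  "exact_seq5 K (alg_center T\<^sub>M\<^sub>N) (r0 M) (alg_center T\<^sub>M) (center_act N) (bimod_hom K A B N N)
    (\<lambda>\<nu>. block_class K A B M N (\<zero>\<^bsub>bimod_hom K A B M N\<^esub>, \<nu>, \<zero>\<^bsub>bimod_hom K A B N M\<^esub>))
    (H1_sub K A B M N) (rho1 K A B M N) (HH1 K T\<^sub>M)"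
proof -
  interpret NM: bimodule_pair K A B N M ..
  interpret NN: bimodule_pair K A B N N ..
  interpret HMN: module K "bimod_hom K A B M N" by (rule module_bimod_hom)
  interpret HNM: module K "bimod_hom K A B N M" by (rule NM.module_bimod_hom)
  interpret H1: module K "H1_sub K A B M N" by (rule module_H1_sub)
  let ?j = "\<lambda>\<nu>. (\<zero>\<^bsub>bimod_hom K A B M N\<^esub>, \<nu>, \<zero>\<^bsub>bimod_hom K A B N M\<^esub>)"
  let ?g = "\<lambda>\<nu>. block_class K A B M N (?j \<nu>)"
  have j: "?j \<in> mod_hom K (bimod_hom K A B N N) Homs"
    using HMN.smult_r_null HNM.smult_r_null by (auto simp: mod_hom_def prod_module_simps)
  have j_closed: "?j \<nu> \<in> carrier Homs" if "\<nu> \<in> carrier (bimod_hom K A B N N)" for \<nu>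
    using j that by (auto simp: mod_hom_def)
  have g_mem: "?g \<nu> \<in> carrier (H1_sub K A B M N)" if \<nu>: "\<nu> \<in> carrier (bimod_hom K A B N N)" for \<nu>
    unfolding block_class_def prod.case
  proof (rule H1_sub_memI[OF block_class_data[OF HMN.M.zero_closed \<nu> HNM.M.zero_closed]])
    have "\<nu> \<zero>\<^bsub>N\<^esub> = \<zero>\<^bsub>N\<^esub>"
      using bimod_hom_lact[OF \<nu>, of "\<zero>\<^bsub>A\<^esub>" "\<zero>\<^bsub>N\<^esub>"] bimod_hom_closed[OF \<nu>] by simp
    then show "snd (block_end M N (\<lambda>m. \<zero>\<^bsub>M\<^esub>) \<zero>\<^bsub>bimod_hom K A B N M\<^esub> \<zero>\<^bsub>bimod_hom K A B M N\<^esub> \<nu> (m, \<zero>\<^bsub>N\<^esub>)) = \<zero>\<^bsub>N\<^esub>"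
      if "m \<in> carrier M" for m using that by (simp add: block_end_def bimod_hom_ops)
  qed (simp add: block_end_def bimod_hom_ops)
  have g: "?g \<in> mod_hom K (bimod_hom K A B N N) (H1_sub K A B M N)"
    using j block_class_hom g_mem j_closed by (simp add: mod_hom_def H1_sub_ops)
  have rho: "rho1 K A B M N \<in> mod_hom K (H1_sub K A B M N) (HH1 K T\<^sub>M)"
  proof -
    have "rho1 K A B M N C = r1 K A B M N C" if "C \<in> carrier (H1_sub K A B M N)" for C
      using that by (simp add: rho1_def)
    then show ?thesis
      using r1_hom H1_sub_subset H1.M.a_closed H1.smult_closed
      unfolding mod_hom_def H1_sub_ops by (auto simp: subset_iff)
  qed
  have 1: "r0 M ` carrier (alg_center T\<^sub>M\<^sub>N) = a_kernel (alg_center T\<^sub>M) (bimod_hom K A B N N) (center_act N)"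
    unfolding r0_image a_kernel_def' ..
  have 2: "center_act N ` carrier (alg_center T\<^sub>M) = a_kernel (bimod_hom K A B N N) (H1_sub K A B M N) ?g"
    unfolding a_kernel_def' H1_sub_ops
    using center_act_in_Hom block_class_zero_iff[OF HMN.M.zero_closed _ HNM.M.zero_closed] by blast
  have 3: "?g ` carrier (bimod_hom K A B N N) = a_kernel (H1_sub K A B M N) (HH1 K T\<^sub>M) (rho1 K A B M N)"
  proof (intro equalityI subsetI)
    fix C assume "C \<in> ?g ` carrier (bimod_hom K A B N N)"
    then show "C \<in> a_kernel (H1_sub K A B M N) (HH1 K T\<^sub>M) (rho1 K A B M N)"
      using g_mem j_closed r1_block_class by (auto simp: a_kernel_def' rho1_def)
  next
    fix C assume "C \<in> a_kernel (H1_sub K A B M N) (HH1 K T\<^sub>M) (rho1 K A B M N)"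
    then have C: "C \<in> carrier (H1_sub K A B M N)" and z: "r1 K A B M N C = \<zero>\<^bsub>HH1 K T\<^sub>M\<^esub>"
      by (simp_all add: a_kernel_def' rho1_def split: if_splits)
    obtain \<alpha> \<gamma> \<beta> where d: "(\<alpha>, \<gamma>, \<beta>) \<in> diag_der_data K A (M \<oplus>\<^sub>b N) B"
      and eq: "C = diag_class K A (M \<oplus>\<^sub>b N) B \<alpha> \<gamma> \<beta>"
      and off: "\<forall>m\<in>carrier M. snd (\<gamma> (m, \<zero>\<^bsub>N\<^esub>)) = \<zero>\<^bsub>N\<^esub>" "\<forall>n\<in>carrier N. fst (\<gamma> (\<zero>\<^bsub>M\<^esub>, n)) = \<zero>\<^bsub>M\<^esub>"
      using C by (rule H1_sub_memE)
    obtain \<nu> where \<nu>: "\<nu> \<in> carrier (bimod_hom K A B N N)"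
      and *: "C = block_class K A B M N (comp21 M N \<gamma>, \<nu>, comp12 M N \<gamma>)"
      using r1_zero_lift[OF d z[unfolded eq]] unfolding eq by blast
    have "comp21 M N \<gamma> = \<zero>\<^bsub>bimod_hom K A B M N\<^esub>" "comp12 M N \<gamma> = \<zero>\<^bsub>bimod_hom K A B N M\<^esub>"
      unfolding comp21_def comp12_def bimod_hom_ops using off by (auto intro!: restrict_ext)
    then show "C \<in> ?g ` carrier (bimod_hom K A B N N)" unfolding * using \<nu> by simp
  qed
  have 4: "rho1 K A B M N ` carrier (H1_sub K A B M N) = carrier (HH1 K T\<^sub>M)"
  proof
    show "rho1 K A B M N ` carrier (H1_sub K A B M N) \<subseteq> carrier (HH1 K T\<^sub>M)"
      using rho by (auto simp: mod_hom_def)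
    show "carrier (HH1 K T\<^sub>M) \<subseteq> rho1 K A B M N ` carrier (H1_sub K A B M N)"
      using H1_sub_lift delta unfolding delta_iff rho1_def image_restrict_eq by blast
  qed
  show ?thesis
    unfolding exact_seq5_def
    by (intro conjI MN.T.module_center M.T.module_center NN.module_bimod_hom module_H1_sub M.T.module_HH1
        r0_hom center_act_hom g rho r0_inj 1 2 3 4)
qed

end

end

theorem mainTheorem6:
  fixes K :: "'k ring" and A :: "('k, 'a) module" and B :: "('k, 'b) module"
    and M :: "('k, 'a, 'b, 'm) bimodule" and N :: "('k, 'a, 'b, 'n) bimodule"
  assumes "cring K" and "assoc_algebra K A" and "assoc_algebra K B"
    and "bimodule K A B M" and "bimodule K A B N"
  shows "(N \<in> delta K A B M \<longleftrightarrow>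
      (\<forall>\<alpha>\<in>carrier (Der K A). \<forall>\<beta>\<in>carrier (Der K B).
        (\<exists>\<mu>\<in>mod_hom K M M.
          (\<forall>a\<in>carrier A. \<forall>m\<in>carrier M. \<mu> (a \<triangleright>\<^bsub>M\<^esub> m) = \<alpha> a \<triangleright>\<^bsub>M\<^esub> m \<oplus>\<^bsub>M\<^esub> a \<triangleright>\<^bsub>M\<^esub> \<mu> m) \<and>
          (\<forall>b\<in>carrier B. \<forall>m\<in>carrier M. \<mu> (m \<triangleleft>\<^bsub>M\<^esub> b) = \<mu> m \<triangleleft>\<^bsub>M\<^esub> b \<oplus>\<^bsub>M\<^esub> m \<triangleleft>\<^bsub>M\<^esub> \<beta> b)) \<longrightarrow>
        (\<exists>\<nu>\<in>mod_hom K N N.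
          (\<forall>a\<in>carrier A. \<forall>n\<in>carrier N. \<nu> (a \<triangleright>\<^bsub>N\<^esub> n) = \<alpha> a \<triangleright>\<^bsub>N\<^esub> n \<oplus>\<^bsub>N\<^esub> a \<triangleright>\<^bsub>N\<^esub> \<nu> n) \<and>
          (\<forall>b\<in>carrier B. \<forall>n\<in>carrier N. \<nu> (n \<triangleleft>\<^bsub>N\<^esub> b) = \<nu> n \<triangleleft>\<^bsub>N\<^esub> b \<oplus>\<^bsub>N\<^esub> n \<triangleleft>\<^bsub>N\<^esub> \<beta> b)))) \<and>
    (N \<in> delta K A B M \<longrightarrow>
      (\<exists>f g f' g'.
        exact_seq5 K
          (alg_center (tri_alg A (M \<oplus>\<^sub>b N) B)) (r0 M)
          (alg_center (tri_alg A M B)) f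
          (prod_module (bimod_hom K A B M N)
            (prod_module (bimod_hom K A B N N) (bimod_hom K A B N M))) g
          (HH1 K (tri_alg A (M \<oplus>\<^sub>b N) B)) (r1 K A B M N)
          (HH1 K (tri_alg A M B)) \<and>
        exact_seq5 K
          (alg_center (tri_alg A (M \<oplus>\<^sub>b N) B)) (r0 M)
          (alg_center (tri_alg A M B)) f'
          (bimod_hom K A B N N) g'
          (H1_sub K A B M N) (rho1 K A B M N)
          (HH1 K (tri_alg A M B)) \<and>
        (\<forall>z\<in>carrier (alg_center (tri_alg A M B)).
          f z = (\<zero>\<^bsub>bimod_hom K A B M N\<^esub>, f' z, \<zero>\<^bsub>bimod_hom K A B N M\<^esub>)) \<and>
        (\<forall>\<nu>\<in>carrier (bimod_hom K A B N N).
          g' \<nu> = g (\<zero>\<^bsub>bimod_hom K A B M N\<^esub>, \<nu>, \<zero>\<^bsub>bimod_hom K A B N M\<^esub>))))"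
proof -
  interpret bimodule_pair K A B M N
    using assms(4,5) by (rule bimodule_pair.intro)
  have compat_iff: "(\<exists>\<mu>\<in>mod_hom K X X.
      (\<forall>a\<in>carrier A. \<forall>m\<in>carrier X. \<mu> (a \<triangleright>\<^bsub>X\<^esub> m) = \<alpha> a \<triangleright>\<^bsub>X\<^esub> m \<oplus>\<^bsub>X\<^esub> a \<triangleright>\<^bsub>X\<^esub> \<mu> m) \<and>
      (\<forall>b\<in>carrier B. \<forall>m\<in>carrier X. \<mu> (m \<triangleleft>\<^bsub>X\<^esub> b) = \<mu> m \<triangleleft>\<^bsub>X\<^esub> b \<oplus>\<^bsub>X\<^esub> m \<triangleleft>\<^bsub>X\<^esub> \<beta> b)) \<longleftrightarrow>
      compat_end K A X B \<alpha> \<beta> \<noteq> {}" for X \<alpha> \<beta>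
    unfolding compat_end_def by blast
  show ?thesis
    unfolding compat_iff
    by (rule conjI, rule delta_iff, rule impI, intro exI, intro conjI, erule exact_HH1, erule exact_H1_sub)
      simp_all
qed

end
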